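(* Let $A(\cdot,\cdot)$ be a sesquilinear form on $V$ of the form $$A(w,v)=\int_\Omega \nabla w\,\mathbf{C}(x)(\overline{\nabla v})^T+(\mathbf{a}(x)\cdot\nabla w)\overline{v}+r(x)w\overline{v}\,dx,\qquad w,v\in V,$$ satisfying, for positive constants $c_0,c_1$, $\Re(A(v,v))\ge c_0\|v\|_V^2$ and $|A(w,v)|\le c_1\|w\|_V\|v\|_V$ for all $w,v\in V$. Let $\mathcal{A}$ be the regularly accretive operator associated with $A(\cdot,\cdot)$, $\beta$ its index, and $\mathcal{A}_h$ its discrete counterpart. Let $\alpha\in(0,1)$, $b\ge1$, $f\in L^2(\Omega)$, $f_h=\pi_hf$, $\kappa_1=\alpha(\pi-\arctan\beta)$ and $\kappa_2=(1-\alpha)\pi$. Let $u_h=(\mathcal{A}_h^\alpha+b\mathcal{I})^{-1}f_h$ and, for $\tau>0$, $$u_{h,\tau}=\frac{\sin\pi\alpha}{\alpha\pi}\,\tau\sum_{n=-\infty}^{\infty}\frac{(1+e^{-n\tau/\alpha}\mathcal{A}_h)^{-1}f_h}{e^{n\tau}+2b\cos\pi\alpha+b^2e^{-n\tau}}.$$ Then for $\tau<\pi-\arctan\beta$, $$\|u_h-u_{h,\tau}\|\le\frac{C(\alpha)}{b}\,C(\tau)\,e^{-2\pi\min(\kappa_1,\kappa_2)/\tau}\,\|f_h\|,$$ where $$C(\tau)=\begin{cases}\sin^{-1}\!\Big(\min\Big\{\frac{\kappa_1-\kappa_2}{\alpha}+\frac{1-\alpha}{\alpha}\tau,\ \frac{\pi}{2}\Big\}\Big)\,(1+|\ln\tau|),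 & \kappa_1>\kappa_2,\\[4pt] \sin^{-1}\!\Big(\min\Big\{\tau,\ \frac{\pi}{2}\Big\}\Big)\,\big(1+|\ln(\kappa_2-\kappa_1+\alpha\tau)|\big), & \kappa_1\le\kappa_2,\end{cases}$$ and $C(\alpha)$ is a constant depending only on $\alpha$.
   Context: Here $\sin^{-1}(x)$ denotes the reciprocal $1/\sin(x)$ (not the arcsine). Setting. $\Omega\subset\mathbb{R}^d$ ($d\ge1$) is a bounded polygonal domain with Lipschitz boundary $\Gamma=\Gamma_D\cup\Gamma_N$, $\Gamma_D\cap\Gamma_N=\emptyset$, with $\Gamma_D$ nonempty and containing no part of dimension less than $d-1$. $V\subset H^1(\Omega)$ is the set of (complex-valued) functions with vanishing trace on $\Gamma_D$, equipped with the $H^1(\Omega)$-norm $\|\cdot\|_V$. $(\cdot,\cdot)$ and $\|\cdot\|$ are the inner product and norm of complex $L^2(\Omega)$. $\mathbf{C}$ is a complex-valued $d\times d$ matrix, $\mathbf{a}$ a complex $d$-vector and $r$ a complex scalar function on $\Omega$. Operator. For $G$ in the space of bounded antilinear functionals on $V$, let $TG\in V$ be the unique element (Lax–Milgram) with $A(TG,v)=G(v)$ for all $v\in V$; $\mathcal{A}=T^{-1}$ is the operator associated with $A(\cdot,\cdot)$. Let $A^*(v,w)=\overline{A(w,v)}$, $A_{\mathrm{Re}}=\frac12(A+A^* )$ and $A_{\mathrm{Im}}=\frac1{2\mathrm i}(A-A^* )$. The index $\beta$ of $\mathcal{A}$ is the smallest number $\widetilde\beta\ge0$ such that $|A_{\mathrm{Im}}(v,v)|\le\widetilde\beta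 A_{\mathrm{Re}}(v,v)$ for all $v\in V$ (finite under the two inequalities assumed on $A$). Discretization. $\mathcal{T}_h$ is a quasi-uniform triangulation of $\Omega$ into finitely many simplices with mesh size $h$, such that any simplex of the mesh of dimension less than $d$ lying on $\Gamma$ is contained either in $\Gamma_D$ or in $\Gamma_N$. $V_h$ is the space of continuous piecewise linear functions on $\mathcal{T}_h$ belonging to $V$. $\mathcal{A}_h:V_h\to V_h$ is defined by $(\mathcal{A}_hw_h,v_h)=A(w_h,v_h)$ for all $w_h,v_h\in V_h$, and $\pi_h:L^2(\Omega)\to V_h$ is the $L^2$-projection. The fractional power $\mathcal{A}_h^\alpha$ is defined by the Dunford–Taylor calculus with the principal branch of $z^\alpha$. *)

theory Defs
  imports "HOL-Complex_Analysis.Complex_Analysis" "HOL-Library.Poly_Mapping"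
begin

section \<open>Euclidean spaces of all dimensions inside one type\<close>

text \<open>
  The constant in the error estimate may not depend on the space dimension \<open>d\<close>, so \<open>d\<close> has to be
  quantified inside the statement and cannot be the cardinality of an index type.  We therefore work
  in the inner product space of finitely supported real sequences, where \<open>\<real>\<^sup>d\<close> is the subspace
  \<open>euc d\<close> of the sequences supported in \<open>{..<d}\<close>; coordinates are numbered from 0.
\<close>

instantiation poly_mapping :: (type, real_vector) real_vector
begin

lift_definition scaleR_poly_mapping :: "real \<Rightarrow> ('a \<Rightarrow>\<^sub>0 'b) \<Rightarrow> 'a \<Rightarrow>\<^sub>0 'b"
  is "\<lambda>c f k. c *\<^sub>R f k"
  by (rule finite_subset[rotated]) auto

instance
  by intro_classes (transfer, simp add: fun_eq_iff algebra_simps)+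

end

lemma lookup_scaleR [simp]:
  "Poly_Mapping.lookup (c *\<^sub>R x) i = c *\<^sub>R Poly_Mapping.lookup x i"
  by transfer simp

instantiation poly_mapping :: (type, real_inner) real_inner
begin

definition inner_poly_mapping :: "('a \<Rightarrow>\<^sub>0 'b) \<Rightarrow> ('a \<Rightarrow>\<^sub>0 'b) \<Rightarrow> real" where
  "inner_poly_mapping x y =
    (\<Sum>i\<in>Poly_Mapping.keys x. Poly_Mapping.lookup x i \<bullet> Poly_Mapping.lookup y i)"

definition norm_poly_mapping :: "('a \<Rightarrow>\<^sub>0 'b) \<Rightarrow> real" where
  "norm_poly_mapping x = sqrt (x \<bullet> x)"

definition sgn_poly_mapping :: "('a \<Rightarrow>\<^sub>0 'b) \<Rightarrow> ('a \<Rightarrow>\<^sub>0 'b)" where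
  "sgn_poly_mapping x = inverse (norm x) *\<^sub>R x"

definition dist_poly_mapping :: "('a \<Rightarrow>\<^sub>0 'b) \<Rightarrow> ('a \<Rightarrow>\<^sub>0 'b) \<Rightarrow> real" where
  "dist_poly_mapping x y = norm (x - y)"

definition uniformity_poly_mapping :: "(('a \<Rightarrow>\<^sub>0 'b) \<times> ('a \<Rightarrow>\<^sub>0 'b)) filter" where
  "uniformity_poly_mapping = (INF e\<in>{0<..}. principal {(x, y). dist x y < e})"

definition open_poly_mapping :: "('a \<Rightarrow>\<^sub>0 'b) set \<Rightarrow> bool" where
  "open_poly_mapping U \<longleftrightarrow> (\<forall>x\<in>U. \<forall>\<^sub>F (x', y) in uniformity. x' = x \<longrightarrow> y \<in> U)"

lemma inner_poly_mapping_superset: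
  fixes x y :: "'a \<Rightarrow>\<^sub>0 'b"
  assumes "finite K" "Poly_Mapping.keys x \<subseteq> K"
  shows "x \<bullet> y = (\<Sum>i\<in>K. Poly_Mapping.lookup x i \<bullet> Poly_Mapping.lookup y i)"
  unfolding inner_poly_mapping_def
  by (rule sum.mono_neutral_left) (use assms in \<open>auto simp: in_keys_iff\<close>)

instance
proof
  fix x y z :: "'a \<Rightarrow>\<^sub>0 'b" and r :: real
  let ?K = "Poly_Mapping.keys x \<union> Poly_Mapping.keys y"
  have fin: "finite ?K" by simp
  show "dist x y = norm (x - y)" by (rule dist_poly_mapping_def)
  show "sgn x = x /\<^sub>R norm x" by (rule sgn_poly_mapping_def)
  show "(uniformity :: (('a \<Rightarrow>\<^sub>0 'b) \<times> ('a \<Rightarrow>\<^sub>0 'b)) filter) =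
      (INF e\<in>{0<..}. principal {(x, y). dist x y < e})"
    by (rule uniformity_poly_mapping_def)
  show "open U \<longleftrightarrow> (\<forall>x\<in>U. \<forall>\<^sub>F (x', y) in uniformity. x' = x \<longrightarrow> y \<in> U)"
    for U :: "('a \<Rightarrow>\<^sub>0 'b) set"
    by (rule open_poly_mapping_def)
  show "x \<bullet> y = y \<bullet> x"
    using inner_poly_mapping_superset[OF fin, of x y] inner_poly_mapping_superset[OF fin, of y x]
    by (simp add: inner_commute)
  have "Poly_Mapping.keys (x + y) \<subseteq> ?K" by (rule Poly_Mapping.keys_add)
  then show "(x + y) \<bullet> z = x \<bullet> z + y \<bullet> z"
    using inner_poly_mapping_superset[OF fin, of x z] inner_poly_mapping_superset[OF fin, of y z]
      inner_poly_mapping_superset[OF fin, of "x + y" z]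
    by (simp add: lookup_add inner_add_left sum.distrib)
  have "Poly_Mapping.keys (r *\<^sub>R x) \<subseteq> Poly_Mapping.keys x"
    by (auto simp: in_keys_iff)
  then show "(r *\<^sub>R x) \<bullet> y = r * (x \<bullet> y)"
    using inner_poly_mapping_superset[of "Poly_Mapping.keys x" "r *\<^sub>R x" y]
    by (simp add: inner_poly_mapping_def sum_distrib_left)
  show "0 \<le> x \<bullet> x"
    unfolding inner_poly_mapping_def by (rule sum_nonneg) simp
  show "x \<bullet> x = 0 \<longleftrightarrow> x = 0"
  proof
    assume "x \<bullet> x = 0"
    then have "\<forall>i\<in>Poly_Mapping.keys x. Poly_Mapping.lookup x i \<bullet> Poly_Mapping.lookup x i = 0"
      unfolding inner_poly_mapping_def by (subst (asm) sum_nonneg_eq_0_iff) auto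
    then have "Poly_Mapping.lookup x i = 0" for i
      by (cases "i \<in> Poly_Mapping.keys x") (auto simp: in_keys_iff)
    then show "x = 0" by (intro poly_mapping_eqI) simp
  qed (simp add: inner_poly_mapping_def)
  show "norm x = sqrt (x \<bullet> x)" by (rule norm_poly_mapping_def)
qed

end

type_synonym point = "nat \<Rightarrow>\<^sub>0 real"

abbreviation coord :: "point \<Rightarrow> nat \<Rightarrow> real" where
  "coord \<equiv> Poly_Mapping.lookup"

abbreviation unit_vec :: "nat \<Rightarrow> point" where
  "unit_vec i \<equiv> Poly_Mapping.single i 1"

definition euc :: "nat \<Rightarrow> point set" where
  "euc d = {x. Poly_Mapping.keys x \<subseteq> {..<d}}"

abbreviation boundary :: "nat \<Rightarrow> point set \<Rightarrow> point set" where
  "boundary d \<Omega> \<equiv> (top_of_set (euc d)) frontier_of \<Omega>"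

definition lebesgue_euc :: "nat \<Rightarrow> point measure" where
  "lebesgue_euc d = completion
    (distr (Pi\<^sub>M {..<d} (\<lambda>_. lborel)) borel (\<lambda>f. \<Sum>i<d. Poly_Mapping.single i (f i)))"

abbreviation leb_on :: "nat \<Rightarrow> point set \<Rightarrow> point measure" where
  "leb_on d \<Omega> \<equiv> restrict_space (lebesgue_euc d) \<Omega>"

text \<open>
  Hausdorff measure with gauge \<open>diam\<^sup>s\<close>, where \<open>0\<^sup>0 = 1\<close> on nonempty sets, so that \<open>s = 0\<close> gives the
  counting measure.  For \<open>s = d - 1\<close> it is the surface measure up to a constant factor, which affects
  neither convergence in \<open>L\<^sup>2(\<Gamma>)\<close> nor the null sets.
\<close>

definition hausdorff_pre :: "nat \<Rightarrow> real \<Rightarrow> 'a::metric_space set \<Rightarrow> ennreal" where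
  "hausdorff_pre s \<delta> S =
    (INF F\<in>{F :: nat \<Rightarrow> 'a set. S \<subseteq> (\<Union>k. F k) \<and> (\<forall>k. bounded (F k) \<and> diameter (F k) \<le> \<delta>)}.
      suminf (\<lambda>k. if F k = {} then 0 else ennreal (diameter (F k) ^ s)))"

definition hausdorff_measure :: "nat \<Rightarrow> 'a::metric_space measure" where
  "hausdorff_measure s =
    measure_of UNIV (sets borel) (\<lambda>S. SUP \<delta>\<in>{0<..}. hausdorff_pre s \<delta> S)"

abbreviation surface_measure :: "nat \<Rightarrow> point measure" where
  "surface_measure d \<equiv> hausdorff_measure (d - 1)"


section \<open>Domain and boundary decomposition\<close>

text \<open>The library notion of a simplex is restricted to the class of Euclidean spaces.\<close>

definition is_simplex :: "nat \<Rightarrow> 'a::real_vector set \<Rightarrow> bool" where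
  "is_simplex k S \<longleftrightarrow>
    (\<exists>P. finite P \<and> \<not> affine_dependent P \<and> card P = k + 1 \<and> S = convex hull P)"

definition lipschitz_boundary :: "nat \<Rightarrow> point set \<Rightarrow> bool" where
  "lipschitz_boundary d \<Omega> \<longleftrightarrow>
    (\<forall>x\<in>boundary d \<Omega>. \<exists>U e (g :: point \<Rightarrow> real) L.
      open U \<and> x \<in> U \<and> e \<in> euc d \<and> norm e = 1 \<and> L-lipschitz_on (euc d) g \<and>
      \<Omega> \<inter> U = {y \<in> euc d \<inter> U. g (y - (y \<bullet> e) *\<^sub>R e) < y \<bullet> e})"

definition polygonal_lipschitz_domain :: "nat \<Rightarrow> point set \<Rightarrow> bool" where
  "polygonal_lipschitz_domain d \<Omega> \<longleftrightarrow>
    \<Omega> \<noteq> {} \<and> openin (top_of_set (euc d)) \<Omega> \<and> connected \<Omega> \<and> bounded \<Omega> \<and>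
    (\<exists>\<F>. finite \<F> \<and> (\<forall>F\<in>\<F>. is_simplex (d - 1) F) \<and> boundary d \<Omega> = \<Union>\<F>) \<and>
    lipschitz_boundary d \<Omega>"

text \<open>
  An affine subspace of dimension less than \<open>d - 1\<close> is the affine hull of fewer than \<open>d\<close> points, so
  the following says that \<open>S\<close> is nowhere locally of dimension less than \<open>d - 1\<close>.
\<close>

definition no_lower_dim_part :: "nat \<Rightarrow> point set \<Rightarrow> bool" where
  "no_lower_dim_part d S \<longleftrightarrow>
    (\<forall>U. open U \<and> S \<inter> U \<noteq> {} \<longrightarrow>
      \<not> (\<exists>\<F>. finite \<F> \<and> (\<forall>P\<in>\<F>. finite P \<and> card P < d) \<and> S \<inter> U \<subseteq> (\<Union>P\<in>\<F>. affine hull P)))"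

definition boundary_partition :: "nat \<Rightarrow> point set \<Rightarrow> point set \<Rightarrow> point set \<Rightarrow> bool" where
  "boundary_partition d \<Omega> \<Gamma>\<^sub>D \<Gamma>\<^sub>N \<longleftrightarrow>
    boundary d \<Omega> = \<Gamma>\<^sub>D \<union> \<Gamma>\<^sub>N \<and> \<Gamma>\<^sub>D \<inter> \<Gamma>\<^sub>N = {} \<and> \<Gamma>\<^sub>D \<noteq> {} \<and> no_lower_dim_part d \<Gamma>\<^sub>D"


section \<open>Lebesgue and Sobolev spaces\<close>

text \<open>Elements of \<open>L\<^sup>2(\<Omega>)\<close> and of \<open>V\<close> are represented by functions, not by equivalence classes.\<close>

definition L2 :: "nat \<Rightarrow> point set \<Rightarrow> (point \<Rightarrow> complex) set" where
  "L2 d \<Omega> = {u \<in> borel_measurable (leb_on d \<Omega>). integrable (leb_on d \<Omega>) (\<lambda>x. (cmod (u x))\<^sup>2)}"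

definition L2_inner :: "nat \<Rightarrow> point set \<Rightarrow> (point \<Rightarrow> complex) \<Rightarrow> (point \<Rightarrow> complex) \<Rightarrow> complex" where
  "L2_inner d \<Omega> u v = (LINT x|leb_on d \<Omega>. u x * cnj (v x))"

definition L2_norm :: "nat \<Rightarrow> point set \<Rightarrow> (point \<Rightarrow> complex) \<Rightarrow> real" where
  "L2_norm d \<Omega> u = sqrt (LINT x|leb_on d \<Omega>. (cmod (u x))\<^sup>2)"

definition partial_deriv :: "nat \<Rightarrow> (point \<Rightarrow> complex) \<Rightarrow> point \<Rightarrow> complex" where
  "partial_deriv i \<phi> x = vector_derivative (\<lambda>t. \<phi> (x + t *\<^sub>R unit_vec i)) (at 0)"

primrec continuously_diff :: "nat \<Rightarrow> nat \<Rightarrow> (point \<Rightarrow> complex) \<Rightarrow> bool" where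
  "continuously_diff d 0 \<phi> \<longleftrightarrow> continuous_on (euc d) \<phi>"
| "continuously_diff d (Suc k) \<phi> \<longleftrightarrow> continuous_on (euc d) \<phi> \<and>
    (\<forall>i<d. (\<forall>x\<in>euc d. (\<lambda>t::real. \<phi> (x + t *\<^sub>R unit_vec i)) differentiable (at 0)) \<and>
           continuously_diff d k (partial_deriv i \<phi>))"

definition smooth :: "nat \<Rightarrow> (point \<Rightarrow> complex) \<Rightarrow> bool" where
  "smooth d \<phi> \<longleftrightarrow> (\<forall>k. continuously_diff d k \<phi>)"

definition test_functions :: "nat \<Rightarrow> point set \<Rightarrow> (point \<Rightarrow> complex) set" where
  "test_functions d \<Omega> =
    {\<phi>. smooth d \<phi> \<and> (\<exists>K. compact K \<and> K \<subseteq> \<Omega> \<and> (\<forall>x. x \<notin> K \<longrightarrow> \<phi> x = 0))}"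

definition is_weak_gradient ::
    "nat \<Rightarrow> point set \<Rightarrow> (point \<Rightarrow> complex) \<Rightarrow> (nat \<Rightarrow> point \<Rightarrow> complex) \<Rightarrow> bool" where
  "is_weak_gradient d \<Omega> u G \<longleftrightarrow>
    (\<forall>i<d. G i \<in> L2 d \<Omega> \<and>
      (\<forall>\<phi>\<in>test_functions d \<Omega>.
        (LINT x|leb_on d \<Omega>. u x * partial_deriv i \<phi> x) = - (LINT x|leb_on d \<Omega>. G i x * \<phi> x)))"

definition H1 :: "nat \<Rightarrow> point set \<Rightarrow> (point \<Rightarrow> complex) set" where
  "H1 d \<Omega> = {u \<in> L2 d \<Omega>. \<exists>G. is_weak_gradient d \<Omega> u G}"

text \<open>The weak gradient is determined almost everywhere; all uses below are inside integrals.\<close>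

definition weak_grad :: "nat \<Rightarrow> point set \<Rightarrow> (point \<Rightarrow> complex) \<Rightarrow> nat \<Rightarrow> point \<Rightarrow> complex" where
  "weak_grad d \<Omega> u = (SOME G. is_weak_gradient d \<Omega> u G)"

definition H1_norm :: "nat \<Rightarrow> point set \<Rightarrow> (point \<Rightarrow> complex) \<Rightarrow> real" where
  "H1_norm d \<Omega> u = sqrt ((L2_norm d \<Omega> u)\<^sup>2 + (\<Sum>i<d. (L2_norm d \<Omega> (weak_grad d \<Omega> u i))\<^sup>2))"

text \<open>
  The trace operator is the continuous extension to \<open>H\<^sup>1(\<Omega>)\<close> of the restriction to the boundary,
  defined on (restrictions to \<open>\<Omega>\<close> of) smooth functions, with values in \<open>L\<^sup>2(\<Gamma>)\<close>.
\<close>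

definition has_trace :: "nat \<Rightarrow> point set \<Rightarrow> (point \<Rightarrow> complex) \<Rightarrow> (point \<Rightarrow> complex) \<Rightarrow> bool" where
  "has_trace d \<Omega> u g \<longleftrightarrow> g \<in> borel_measurable borel \<and>
    (\<exists>\<phi> G. (\<forall>n::nat. smooth d (\<phi> n)) \<and> is_weak_gradient d \<Omega> u G \<and>
      (\<lambda>n. L2_norm d \<Omega> (\<lambda>x. \<phi> n x - u x)) \<longlonglongrightarrow> 0 \<and>
      (\<forall>i<d. (\<lambda>n. L2_norm d \<Omega> (\<lambda>x. partial_deriv i (\<phi> n) x - G i x)) \<longlonglongrightarrow> 0) \<and>
      (\<lambda>n. \<integral>\<^sup>+x\<in>boundary d \<Omega>. ennreal ((cmod (\<phi> n x - g x))\<^sup>2) \<partial>surface_measure d) \<longlonglongrightarrow> 0)"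

definition V_space :: "nat \<Rightarrow> point set \<Rightarrow> point set \<Rightarrow> (point \<Rightarrow> complex) set" where
  "V_space d \<Omega> \<Gamma>\<^sub>D =
    {u \<in> H1 d \<Omega>. \<exists>g. has_trace d \<Omega> u g \<and> (AE x in surface_measure d. x \<in> \<Gamma>\<^sub>D \<longrightarrow> g x = 0)}"


section \<open>Sesquilinear forms and the index\<close>

definition sesquilinear_on ::
    "('a \<Rightarrow> complex) set \<Rightarrow> (('a \<Rightarrow> complex) \<Rightarrow> ('a \<Rightarrow> complex) \<Rightarrow> complex) \<Rightarrow> bool" where
  "sesquilinear_on V A \<longleftrightarrow>
    (\<forall>u\<in>V. \<forall>v\<in>V. \<forall>w\<in>V. A (\<lambda>x. u x + v x) w = A u w + A v w \<and> A w (\<lambda>x. u x + v x) = A w u + A w v) \<and>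
    (\<forall>u\<in>V. \<forall>v\<in>V. \<forall>c. A (\<lambda>x. c * u x) v = c * A u v \<and> A u (\<lambda>x. c * v x) = cnj c * A u v)"

definition form_integrand ::
    "nat \<Rightarrow> point set \<Rightarrow> (point \<Rightarrow> nat \<Rightarrow> nat \<Rightarrow> complex) \<Rightarrow> (point \<Rightarrow> nat \<Rightarrow> complex) \<Rightarrow>
     (point \<Rightarrow> complex) \<Rightarrow> (point \<Rightarrow> complex) \<Rightarrow> (point \<Rightarrow> complex) \<Rightarrow> point \<Rightarrow> complex" where
  "form_integrand d \<Omega> C a r w v x =
    (\<Sum>i<d. \<Sum>j<d. weak_grad d \<Omega> w i x * C x i j * cnj (weak_grad d \<Omega> v j x)) +
    (\<Sum>i<d. a x i * weak_grad d \<Omega> w i x) * cnj (v x) + r x * w x * cnj (v x)"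

definition adjoint_form :: "('v \<Rightarrow> 'v \<Rightarrow> complex) \<Rightarrow> 'v \<Rightarrow> 'v \<Rightarrow> complex" where
  "adjoint_form A v w = cnj (A w v)"

definition form_Re :: "('v \<Rightarrow> 'v \<Rightarrow> complex) \<Rightarrow> 'v \<Rightarrow> 'v \<Rightarrow> complex" where
  "form_Re A v w = 1 / 2 * (A v w + adjoint_form A v w)"

definition form_Im :: "('v \<Rightarrow> 'v \<Rightarrow> complex) \<Rightarrow> 'v \<Rightarrow> 'v \<Rightarrow> complex" where
  "form_Im A v w = 1 / (2 * \<i>) * (A v w - adjoint_form A v w)"

text \<open>
  The operator associated with \<open>A\<close> maps \<open>w \<in> V\<close> to the antilinear functional \<open>A w\<close> on \<open>V\<close>, so the form
  in curried shape is that operator.  The real part below only turns the (real) complex number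
  \<open>form_Re A v v\<close> into an element of type \<^typ>\<open>real\<close>.
\<close>

definition index_of :: "'v set \<Rightarrow> ('v \<Rightarrow> 'v \<Rightarrow> complex) \<Rightarrow> real" where
  "index_of V A =
    (LEAST \<beta>. 0 \<le> \<beta> \<and> (\<forall>v\<in>V. cmod (form_Im A v v) \<le> \<beta> * Re (form_Re A v v)))"


section \<open>Finite element discretization\<close>

text \<open>
  \<open>\<T>\<close> consists of the simplices of full dimension; the lower dimensional simplices of the mesh are
  their proper faces.  The mesh is the disjoint union of its relatively open simplices, and it is
  those that lie in one of the two (disjoint) boundary parts: neighbouring closed boundary faces
  share vertices, and could never lie in different parts.
\<close>

definition fe_mesh ::
    "nat \<Rightarrow> point set \<Rightarrow> point set \<Rightarrow> point set \<Rightarrow> real \<Rightarrow> real \<Rightarrow> point set set \<Rightarrow> bool" where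
  "fe_mesh d \<Omega> \<Gamma>\<^sub>D \<Gamma>\<^sub>N \<rho> h \<T> \<longleftrightarrow>
    finite \<T> \<and> (\<forall>T\<in>\<T>. is_simplex d T) \<and> (\<forall>T\<in>\<T>. \<forall>T'\<in>\<T>. (T \<inter> T') face_of T) \<and>
    \<Union>\<T> = closure \<Omega> \<and>
    h = Max (diameter ` \<T>) \<and> 0 < \<rho> \<and> (\<forall>T\<in>\<T>. \<exists>x\<in>T. cball x (\<rho> * h) \<inter> euc d \<subseteq> T) \<and>
    (\<forall>T\<in>\<T>. \<forall>F. F face_of T \<and> F \<noteq> T \<and> F \<subseteq> boundary d \<Omega> \<longrightarrow>
      rel_interior F \<subseteq> \<Gamma>\<^sub>D \<or> rel_interior F \<subseteq> \<Gamma>\<^sub>N)"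

text \<open>
  Finite element functions live on \<open>closure \<Omega>\<close>; they are extended by zero so that each is
  represented by exactly one function.
\<close>

definition Vh_space ::
    "nat \<Rightarrow> point set \<Rightarrow> point set \<Rightarrow> point set set \<Rightarrow> (point \<Rightarrow> complex) set" where
  "Vh_space d \<Omega> \<Gamma>\<^sub>D \<T> = {v \<in> V_space d \<Omega> \<Gamma>\<^sub>D.
    continuous_on (closure \<Omega>) v \<and> (\<forall>x. x \<notin> closure \<Omega> \<longrightarrow> v x = 0) \<and>
    (\<forall>T\<in>\<T>. \<exists>c p. \<forall>x\<in>T. v x = c + (\<Sum>i<d. p i * of_real (coord x i)))}"

definition L2_projection ::
    "nat \<Rightarrow> point set \<Rightarrow> (point \<Rightarrow> complex) set \<Rightarrow> (point \<Rightarrow> complex) \<Rightarrow> point \<Rightarrow> complex" where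
  "L2_projection d \<Omega> W f = (THE w. w \<in> W \<and> (\<forall>v\<in>W. L2_inner d \<Omega> w v = L2_inner d \<Omega> f v))"

definition discrete_operator ::
    "nat \<Rightarrow> point set \<Rightarrow> (point \<Rightarrow> complex) set \<Rightarrow>
     ((point \<Rightarrow> complex) \<Rightarrow> (point \<Rightarrow> complex) \<Rightarrow> complex) \<Rightarrow> (point \<Rightarrow> complex) \<Rightarrow> point \<Rightarrow> complex" where
  "discrete_operator d \<Omega> W A w = (THE u. u \<in> W \<and> (\<forall>v\<in>W. L2_inner d \<Omega> u v = A w v))"


section \<open>Dunford--Taylor calculus on a finite dimensional space of functions\<close>

definition op_resolvent ::
    "('a \<Rightarrow> complex) set \<Rightarrow> (('a \<Rightarrow> complex) \<Rightarrow> 'a \<Rightarrow> complex) \<Rightarrow> complex \<Rightarrow>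
     ('a \<Rightarrow> complex) \<Rightarrow> 'a \<Rightarrow> complex" where
  "op_resolvent W B z = inv_into W (\<lambda>u x. z * u x - B u x)"

definition op_spectrum ::
    "('a \<Rightarrow> complex) set \<Rightarrow> (('a \<Rightarrow> complex) \<Rightarrow> 'a \<Rightarrow> complex) \<Rightarrow> complex set" where
  "op_spectrum W B = {z. \<not> bij_betw (\<lambda>u x. z * u x - B u x) W W}"

definition dunford_contour :: "complex set \<Rightarrow> (real \<Rightarrow> complex) \<Rightarrow> bool" where
  "dunford_contour S \<gamma> \<longleftrightarrow> valid_path \<gamma> \<and> pathfinish \<gamma> = pathstart \<gamma> \<and>
    path_image \<gamma> \<inter> (S \<union> \<real>\<^sub>\<le>\<^sub>0) = {} \<and> (\<forall>z\<in>S. winding_number \<gamma> z = 1)"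

text \<open>
  The contour surrounds the spectrum once inside the plane slit along the branch cut of \<open>z\<^sup>\<alpha>\<close>; by
  Cauchy's theorem its choice is immaterial.  The integral of the function-valued integrand is taken
  pointwise, which on a finite dimensional function space is the usual one.
\<close>

definition fractional_power ::
    "('a \<Rightarrow> complex) set \<Rightarrow> (('a \<Rightarrow> complex) \<Rightarrow> 'a \<Rightarrow> complex) \<Rightarrow> real \<Rightarrow>
     ('a \<Rightarrow> complex) \<Rightarrow> 'a \<Rightarrow> complex" where
  "fractional_power W B \<alpha> v x =
    1 / (2 * of_real pi * \<i>) *
    contour_integral (SOME \<gamma>. dunford_contour (op_spectrum W B) \<gamma>)
      (\<lambda>z. z powr of_real \<alpha> * op_resolvent W B z v x)"

definition u_exact ::
    "('a \<Rightarrow> complex) set \<Rightarrow> (('a \<Rightarrow> complex) \<Rightarrow> 'a \<Rightarrow> complex) \<Rightarrow> real \<Rightarrow> real \<Rightarrow>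
     ('a \<Rightarrow> complex) \<Rightarrow> 'a \<Rightarrow> complex" where
  "u_exact W B \<alpha> b g = inv_into W (\<lambda>w x. fractional_power W B \<alpha> w x + of_real b * w x) g"

definition u_sinc ::
    "('a \<Rightarrow> complex) set \<Rightarrow> (('a \<Rightarrow> complex) \<Rightarrow> 'a \<Rightarrow> complex) \<Rightarrow> real \<Rightarrow> real \<Rightarrow> real \<Rightarrow>
     ('a \<Rightarrow> complex) \<Rightarrow> 'a \<Rightarrow> complex" where
  "u_sinc W B \<alpha> b \<tau> g x =
    of_real (sin (pi * \<alpha>) / (\<alpha> * pi) * \<tau>) *
    (\<Sum>\<^sub>\<infinity>n::int.
      inv_into W (\<lambda>w y. w y + of_real (exp (- (of_int n * \<tau>) / \<alpha>)) * B w y) g x /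
      of_real (exp (of_int n * \<tau>) + 2 * b * cos (pi * \<alpha>) + b\<^sup>2 * exp (- (of_int n * \<tau>))))"

definition C_tau :: "real \<Rightarrow> real \<Rightarrow> real \<Rightarrow> real \<Rightarrow> real" where
  "C_tau \<alpha> \<kappa>\<^sub>1 \<kappa>\<^sub>2 \<tau> =
    (if \<kappa>\<^sub>1 > \<kappa>\<^sub>2
     then 1 / sin (min ((\<kappa>\<^sub>1 - \<kappa>\<^sub>2) / \<alpha> + (1 - \<alpha>) / \<alpha> * \<tau>) (pi / 2)) * (1 + \<bar>ln \<tau>\<bar>)
     else 1 / sin (min \<tau> (pi / 2)) * (1 + \<bar>ln (\<kappa>\<^sub>2 - \<kappa>\<^sub>1 + \<alpha> * \<tau>)\<bar>))"

end

theory Submission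
  imports Defs "HOL-Computational_Algebra.Fundamental_Theorem_Algebra"
begin

text \<open>
  The discrete operator acts on a finite-dimensional inner product space, so the Dunford--Taylor
  integral can be evaluated by Newton interpolation along the eigenvalues: every operator function
  involved is a combination of divided differences, and scalar identities in \<open>z\<close> carry over to
  \<open>A\<^sub>h\<close>. In particular the scalar Balakrishnan formula, obtained from the residue theorem on a strip
  of width \<open>2\<pi>\<close>, shows that \<open>u\<^sub>h\<close> is the integral over the real line whose trapezoidal sum with step
  \<open>\<tau>\<close> is \<open>u\<^sub>h\<^sub>\<tau>\<close>.

  The trapezoidal error is a contour integral of the integrand against
  \<open>1 / (exp (-2\<pi>iz/\<tau>) - 1)\<close> over the boundary of a strip of height \<open>s\<close>, which gains the factor
  \<open>1 / (exp (2\<pi>s/\<tau>) - 1)\<close>. On that strip the scalar weight has its nearest pole at height \<open>\<kappa>\<^sub>2\<close>,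
  and its integral grows like \<open>ln (1 / (\<kappa>\<^sub>2 - s))\<close>; the resolvent meets the numerical range at height
  \<open>\<kappa>\<^sub>1\<close> and is bounded by \<open>1 / sin ((\<kappa>\<^sub>1 - s) / \<alpha>)\<close>. The estimate follows by taking \<open>s\<close> at distance
  of order \<open>\<tau>\<close> below \<open>min \<kappa>\<^sub>1 \<kappa>\<^sub>2\<close>.
\<close>

section \<open>Trapezoidal rule on a strip\<close>

text \<open>The constant may depend on \<alpha> alone, so no bound that enters the estimate may
  involve the eigenvalues, the dimension or the constants of the form. The coefficients of the
  Newton expansion do depend on the eigenvalues; they serve only to make integrals and sums
  converge. The quantitative resolvent bound comes from a rotation of the numerical range. To stay
  with scalar integrals, the error \<open>e\<close> itself is the test function: the quadrature
  theorem is applied to the inner product of the integrand with \<open>e\<close>, its bound carries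
  a factor \<open>nrm e\<close>, and cancelling that factor leaves the norm estimate. The weight is
  majorised by \<open>log_kernel\<close>, centred at \<open>ln b\<close>, whose integral is
  \<open>2 * ln (1 + 1 / \<epsilon>)\<close> with \<epsilon> the distance to the pole. This is the
  source of the logarithm in \<open>C_tau\<close>; the \<open>1 / b\<close> comes from factoring the
  denominator. \<open>A\<^sub>h\<close> need not be diagonalisable, so each vector is handled
  through a list of eigenvalues whose product of shifts annihilates it, in place of a spectral
  decomposition.\<close>

lemma contour_integral_linepath_horizontal:
  assumes "a < b"
  shows "contour_integral (linepath (Complex a c) (Complex b c)) f = integral {a..b} (\<lambda>x. f (Complex x c))"
proof -
  have "(f has_contour_integral I) (linepath (Complex a c) (Complex b c)) \<longleftrightarrow>
      ((\<lambda>z. f (z + \<i> * c)) has_contour_integral I) (linepath (of_real a) (of_real b))" for I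
    by (auto simp: has_contour_integral linepath_def Complex_eq algebra_simps scaleR_conv_of_real)
  then have iff: "(f has_contour_integral I) (linepath (Complex a c) (Complex b c)) \<longleftrightarrow>
      ((\<lambda>x. f (Complex x c)) has_integral I) {a..b}" for I
    using has_contour_integral_linepath_Reals_iff[of "of_real a" "of_real b" "\<lambda>z. f (z + \<i> * c)" I] assms
    by (simp add: Complex_eq)
  \<comment> \<open>Existence on the two sides is equivalent by \<open>iff\<close>; where it fails,
    both sides are the default value 0.\<close>
  show ?thesis
    by (metis iff contour_integral_unique contour_integrable_on_def integrable_integral
        integral_unique not_integrable_contour_integral not_integrable_integral integrable_on_def)
qed

text \<open>The residue theorem on a rectangle. The poles lie in the open box, so every winding
  number is 1, and the two vertical sides, each of length \<open>d - c\<close>, account for the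
  whole right-hand side.\<close>

lemma rectangle_residue_bound:
  assumes S: "open S" "convex S" and fin: "finite P" and holo: "f holomorphic_on S - P"
    and ab: "a < b" and cd: "c < d" and sub: "cbox (Complex a c) (Complex b d) \<subseteq> S"
    and P: "P \<subseteq> box (Complex a c) (Complex b d)"
    and M: "\<And>y. y \<in> {c..d} \<Longrightarrow> cmod (f (Complex a y)) \<le> M"
      "\<And>y. y \<in> {c..d} \<Longrightarrow> cmod (f (Complex b y)) \<le> M"
  shows "cmod (integral {a..b} (\<lambda>x. f (Complex x c)) - integral {a..b} (\<lambda>x. f (Complex x d))
           - 2 * pi * \<i> * (\<Sum>p\<in>P. residue f p)) \<le> 2 * M * (d - c)"
proof -
  let ?g = "rectpath (Complex a c) (Complex b d)"
  let ?l1 = "linepath (Complex a c) (Complex b c)" and ?l2 = "linepath (Complex b c) (Complex b d)"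
    and ?l3 = "linepath (Complex b d) (Complex a d)" and ?l4 = "linepath (Complex a d) (Complex a c)"
  have pim: "path_image ?g \<subseteq> S - P"
    using path_image_rectpath_subset_cbox[of "Complex a c" "Complex b d"]
      path_image_rectpath_inter_box[of "Complex a c" "Complex b d"] ab cd sub P by auto
  have "contour_integral ?g f = 2 * pi * \<i> * (\<Sum>p\<in>P. winding_number ?g p * residue f p)"
  proof (rule Residue_theorem[OF S(1) convex_connected[OF S(2)] fin holo _ _ pim])
    show "\<forall>z. z \<notin> S \<longrightarrow> winding_number ?g z = 0"
      using sub ab cd by (intro allI impI winding_number_rectpath_outside) auto
  qed auto
  also have "(\<Sum>p\<in>P. winding_number ?g p * residue f p) = (\<Sum>p\<in>P. residue f p)"
    using P by (intro sum.cong refl) (auto simp: winding_number_rectpath)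
  finally have res: "contour_integral ?g f = 2 * pi * \<i> * (\<Sum>p\<in>P. residue f p)" .
  have op: "open (S - P)"
    using S(1) fin by (simp add: finite_imp_closed open_Diff)
  have sub': "path_image ?l1 \<union> path_image ?l2 \<union> path_image ?l3 \<union> path_image ?l4 \<subseteq> path_image ?g"
    unfolding rectpath_def Let_def by (auto simp: path_image_join)
  have int: "f contour_integrable_on ?l1" "f contour_integrable_on ?l2"
    "f contour_integrable_on ?l3" "f contour_integrable_on ?l4"
    by (rule contour_integrable_holomorphic_simple[OF holo op];
        use sub' pim in \<open>simp; fail | (simp only: Un_subset_iff, blast intro: order_trans)\<close>)+
  have "contour_integral ?g f = contour_integral ?l1 f + contour_integral ?l2 f
      + contour_integral ?l3 f + contour_integral ?l4 f"
    unfolding rectpath_def Let_def using int by simp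
  moreover have "contour_integral ?l3 f = - contour_integral (linepath (Complex a d) (Complex b d)) f"
    using contour_integral_reversepath[of "linepath (Complex a d) (Complex b d)" f] by simp
  moreover have "cmod (contour_integral ?l2 f) \<le> M * cmod (Complex b d - Complex b c)"
  proof (rule contour_integral_bound_linepath[OF int(2)])
    show "0 \<le> M" using M(1)[of c] cd by (auto intro: order_trans[OF norm_ge_zero])
  next
    fix z assume "z \<in> closed_segment (Complex b c) (Complex b d)"
    then show "cmod (f z) \<le> M"
      using M(2)[of "Im z"] cd by (simp add: closed_segment_same_Re closed_segment_eq_real_ivl)
        (metis complex_surj)
  qed
  moreover have "cmod (contour_integral ?l4 f) \<le> M * cmod (Complex a c - Complex a d)"
  proof (rule contour_integral_bound_linepath[OF int(4)])
    show "0 \<le> M" using M(1)[of c] cd by (auto intro: order_trans[OF norm_ge_zero])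
  next
    fix z assume "z \<in> closed_segment (Complex a d) (Complex a c)"
    then show "cmod (f z) \<le> M"
      using M(1)[of "Im z"] cd by (simp add: closed_segment_same_Re closed_segment_eq_real_ivl)
        (metis complex_surj)
  qed
  moreover have "cmod (Complex b d - Complex b c) = d - c" "cmod (Complex a c - Complex a d) = d - c"
    using cd by (simp_all add: cmod_def)
  ultimately have "cmod (contour_integral ?l2 f) + cmod (contour_integral ?l4 f) \<le> 2 * M * (d - c)"
     and eq: "integral {a..b} (\<lambda>x. f (Complex x c)) - integral {a..b} (\<lambda>x. f (Complex x d))
           - 2 * pi * \<i> * (\<Sum>p\<in>P. residue f p) = - (contour_integral ?l2 f + contour_integral ?l4 f)"
    using res contour_integral_linepath_horizontal[OF ab, of c f] contour_integral_linepath_horizontal[OF ab, of d f]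
    by (auto simp: algebra_simps)
  then show ?thesis
    unfolding eq norm_minus_cancel by (metis norm_triangle_ineq order_trans)
qed

lemma integral_expanding_intervals:
  fixes g :: "real \<Rightarrow> complex"
  assumes g: "integrable lborel g" and a: "filterlim a at_bot sequentially" and b: "filterlim b at_top sequentially"
  shows "(\<lambda>n. integral {a n..b n} g) \<longlonglongrightarrow> (LINT x|lborel. g x)"
proof -
  have "integral {a n..b n} g = (LINT x|lborel. indicator {a n..b n} x *\<^sub>R g x)" for n
    by (subst set_borel_integral_eq_integral(2)[symmetric])
       (auto simp: set_lebesgue_integral_def set_integrable_def intro!: integrable_mult_indicator g)
  moreover have "(\<lambda>n. LINT x|lborel. indicator {a n..b n} x *\<^sub>R g x) \<longlonglongrightarrow> (LINT x|lborel. g x)"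
  proof (rule integral_dominated_convergence)
    show "integrable lborel (\<lambda>x. norm (g x))" using g by simp
    show "AE x in lborel. (\<lambda>n. indicator {a n..b n} x *\<^sub>R g x) \<longlonglongrightarrow> g x"
    proof (rule AE_I2)
      fix x
      have "eventually (\<lambda>n. a n \<le> x) sequentially" "eventually (\<lambda>n. x \<le> b n) sequentially"
        using a b by (auto simp: filterlim_at_bot filterlim_at_top)
      then have "eventually (\<lambda>n. indicator {a n..b n} x *\<^sub>R g x = g x) sequentially"
        by eventually_elim auto
      then show "(\<lambda>n. indicator {a n..b n} x *\<^sub>R g x) \<longlonglongrightarrow> g x" by (rule tendsto_eventually)
    qed
    show "AE x in lborel. norm (indicator {a n..b n} x *\<^sub>R g x) \<le> norm (g x)" for n
      by (auto simp: indicator_def)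
    show "g \<in> borel_measurable lborel" using g by auto
    then show "(\<lambda>x. indicator {a n..b n} x *\<^sub>R g x) \<in> borel_measurable lborel" for n by measurable
  qed
  ultimately show ?thesis by simp
qed

text \<open>The vertical sides vanish in the limit. Region and pole set may vary with
  \<open>n\<close> because a kernel with poles at all multiples of \<tau> has only finitely many of
  them in each rectangle; the lemma is also applied with a single pole and with none.\<close>

lemma strip_residues:
  assumes a: "filterlim a at_bot sequentially" and b: "filterlim b at_top sequentially"
    and ab: "\<And>n. a n < b n" and cd: "c < d"
    and S: "\<And>n. open (S n)" "\<And>n. convex (S n)" "\<And>n. cbox (Complex (a n) c) (Complex (b n) d) \<subseteq> S n"
    and P: "\<And>n. finite (P n)" "\<And>n. P n \<subseteq> box (Complex (a n) c) (Complex (b n) d)"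
    and holo: "\<And>n. f holomorphic_on S n - P n"
    and M: "\<And>n y. y \<in> {c..d} \<Longrightarrow> cmod (f (Complex (a n) y)) \<le> M n"
      "\<And>n y. y \<in> {c..d} \<Longrightarrow> cmod (f (Complex (b n) y)) \<le> M n" "M \<longlonglongrightarrow> 0"
    and int: "integrable lborel (\<lambda>x. f (Complex x c))" "integrable lborel (\<lambda>x. f (Complex x d))"
  shows "(\<lambda>n. 2 * pi * \<i> * (\<Sum>p\<in>P n. residue f p)) \<longlonglongrightarrow>
     (LINT x|lborel. f (Complex x c)) - (LINT x|lborel. f (Complex x d))"
proof -
  let ?D = "\<lambda>n. integral {a n..b n} (\<lambda>x. f (Complex x c)) - integral {a n..b n} (\<lambda>x. f (Complex x d))"
  have "(\<lambda>n. ?D n - 2 * pi * \<i> * (\<Sum>p\<in>P n. residue f p)) \<longlonglongrightarrow> 0"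
  proof (rule Lim_null_comparison)
    show "\<forall>\<^sub>F n in sequentially. cmod (?D n - 2 * pi * \<i> * (\<Sum>p\<in>P n. residue f p)) \<le> 2 * M n * (d - c)"
      by (intro always_eventually allI rectangle_residue_bound[OF S(1,2) P(1) holo ab cd S(3) P(2)] M)
    show "(\<lambda>n. 2 * M n * (d - c)) \<longlonglongrightarrow> 0" using M(3) by (auto intro!: tendsto_eq_intros)
  qed
  moreover have "?D \<longlonglongrightarrow> (LINT x|lborel. f (Complex x c)) - (LINT x|lborel. f (Complex x d))"
    by (intro tendsto_diff integral_expanding_intervals[OF int(1) a b] integral_expanding_intervals[OF int(2) a b])
  ultimately show ?thesis
    using tendsto_diff[of ?D] by fastforce
qed

section \<open>The trapezoidal kernel and the quadrature error\<close>

lemma cmod_exp_minus_one_ge: "cmod (exp w - 1) \<ge> exp (Re w) - 1"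
  using norm_triangle_ineq2[of "exp w" 1] by simp

lemma open_strip: "open {z. \<bar>Im z\<bar> < D}"
  by (intro open_Collect_less continuous_intros)

lemma convex_strip: "convex {z. \<bar>Im z\<bar> < D}"
proof -
  have "{z. \<bar>Im z\<bar> < D} = {z. Im z < D} \<inter> {z. Im z > - D}" by auto
  then show ?thesis by (simp add: convex_Int convex_halfspace_Im_lt convex_halfspace_Im_gt)
qed

text \<open>On the upper line the exponential has modulus \<open>exp (2 * pi * d / \<tau>)\<close>
  and the kernel is small; on the lower line the modulus is the reciprocal and the kernel is close
  to -1. That -1 is what will produce the exact integral.\<close>

lemma sinc_kernel_bounds:
  fixes \<tau> d x :: real
  assumes "0 < d" "0 < \<tau>"
  shows "cmod (1 / (exp (- (2 * pi * \<i> / \<tau>) * Complex x d) - 1)) \<le> 1 / (exp (2 * pi * d / \<tau>) - 1)" (is ?A)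
    and "cmod (1 / (exp (- (2 * pi * \<i> / \<tau>) * Complex x (- d)) - 1) + 1) \<le> 1 / (exp (2 * pi * d / \<tau>) - 1)" (is ?B)
proof -
  have pos: "exp (2 * pi * d / \<tau>) - 1 > 0" using assms by simp
  let ?w = "2 * pi * \<i> / \<tau> * Complex x (- d)"
  have "Re (- (2 * pi * \<i> / \<tau>) * Complex x d) = 2 * pi * d / \<tau>" by simp
  then show ?A
    using cmod_exp_minus_one_ge[of "- (2 * pi * \<i> / \<tau>) * Complex x d"] pos
    by (simp only: norm_divide norm_one) (intro divide_left_mono mult_pos_pos, linarith+)
  have Re: "Re ?w = 2 * pi * d / \<tau>" by simp
  then have ge: "cmod (exp ?w - 1) \<ge> exp (2 * pi * d / \<tau>) - 1"
    using cmod_exp_minus_one_ge[of ?w] by simp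
  then have ne: "exp ?w \<noteq> 1" using pos by auto
  have "1 / (inverse E - 1) + 1 = - 1 / (E - 1)" if "E \<noteq> 0" "E \<noteq> 1" for E :: complex
    using that by (simp add: field_simps)
  moreover have "exp (- (2 * pi * \<i> / \<tau>) * Complex x (- d)) = inverse (exp ?w)"
    by (simp add: exp_minus[symmetric])
  ultimately have "1 / (exp (- (2 * pi * \<i> / \<tau>) * Complex x (- d)) - 1) + 1 = - 1 / (exp ?w - 1)"
    using ne by simp
  then show ?B
    using ge pos by (simp only: norm_divide norm_minus_cancel norm_one) (intro divide_left_mono mult_pos_pos, linarith+)
qed

text \<open>The denominator has a simple zero at each node, with derivative
  \<open>- (2 * pi * \<i> / \<tau>)\<close>; the residue is \<open>F\<close> divided by this
  derivative.\<close>

lemma residue_sinc_kernel: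
  fixes \<tau> D :: real and j :: int
  assumes holo: "F holomorphic_on {z. \<bar>Im z\<bar> < D}" and "0 < D" "0 < \<tau>"
  shows "residue (\<lambda>z. F z * (1 / (exp (- (2 * pi * \<i> / \<tau>) * z) - 1))) (of_real (j * \<tau>))
       = - (\<tau> / (2 * pi * \<i>)) * F (of_real (j * \<tau>))"
proof -
  let ?p = "complex_of_real (j * \<tau>)" and ?c = "- (2 * pi * \<i> / \<tau>)"
  let ?E = "\<lambda>z. exp (?c * z)"
  \<comment> \<open>Half-width \<tau>, with strict inequality, leaves \<open>j * \<tau>\<close> as
    the only node in the box.\<close>
  let ?S = "{z. \<bar>Im z\<bar> < D \<and> \<bar>Re z - j * \<tau>\<bar> < \<tau>}"
  have Ep: "?E ?p = 1"
    by (subst exp_eq_1) (use assms in \<open>auto intro!: exI[of _ "- j"]\<close>)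
  have op: "open ?S"
    by (intro open_Collect_conj open_Collect_less continuous_intros)
  have ne: "?E z \<noteq> 1" if z: "z \<in> ?S - {?p}" for z
  proof
    assume "?E z = 1"
    then obtain n :: int where "Im z = 0" "- (pi * Re z) = pi * (\<tau> * real_of_int n)"
      using assms by (auto simp: exp_eq_1 divide_simps)
    moreover from this(2) have "pi * Re z = pi * (- n * \<tau>)" by (simp add: algebra_simps)
    ultimately have n: "Im z = 0" "Re z = - n * \<tau>"
      by (simp, simp only: mult_cancel_left pi_neq_zero simp_thms)
    then have "\<bar>real_of_int (- n - j)\<bar> * \<tau> < 1 * \<tau>"
      using z assms(3) abs_mult_pos[of \<tau> "real_of_int (- n - j)"] by (simp add: algebra_simps)
    then have "\<bar>real_of_int (- n - j)\<bar> < 1" using assms(3) by (simp only: mult_less_cancel_right_pos)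
    then have "- n = j" by linarith
    then show False using n z by (auto simp: complex_eq_iff)
  qed
  show ?thesis
  proof (rule residue_simple'[OF op])
    show "?p \<in> ?S" using assms by simp
    show "(\<lambda>z. F z * (1 / (?E z - 1))) holomorphic_on (?S - {?p})"
      using ne by (intro holomorphic_intros holomorphic_on_subset[OF holo]) auto
    have "(?E has_field_derivative (?E ?p * (?c * 1))) (at ?p)"
      by (intro DERIV_fun_exp DERIV_cmult DERIV_ident)
    then have "(?E has_field_derivative ?c) (at ?p)"
      by (simp only: Ep mult_1_left mult_1_right)
    then have "((\<lambda>z. (?E z - 1) / (z - ?p)) \<longlongrightarrow> ?c) (at ?p)"
      unfolding has_field_derivative_iff Ep .
    then have "((\<lambda>z. inverse ((?E z - 1) / (z - ?p))) \<longlongrightarrow> inverse ?c) (at ?p)"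
      using assms by (intro tendsto_inverse) auto
    moreover have "(F \<longlongrightarrow> F ?p) (at ?p)"
    proof -
      have "continuous (at ?p) F"
        using holomorphic_on_imp_continuous_on[OF holo] assms by (simp add: continuous_on_eq_continuous_at open_strip)
      then show ?thesis by (simp add: continuous_within)
    qed
    ultimately have "((\<lambda>z. inverse ((?E z - 1) / (z - ?p)) * F z) \<longlongrightarrow> inverse ?c * F ?p) (at ?p)"
      by (intro tendsto_mult)
    moreover have "inverse ?c = - (\<tau> / (2 * pi * \<i>))" by (simp add: field_simps)
    moreover have "inverse ((?E z - 1) / (z - ?p)) * F z = F z * (1 / (?E z - 1)) * (z - ?p)" for z
      by (simp only: divide_inverse inverse_mult_distrib inverse_inverse_eq mult_1_left ac_simps)
    ultimately show "((\<lambda>z. F z * (1 / (?E z - 1)) * (z - ?p)) \<longlongrightarrow> - (\<tau> / (2 * pi * \<i>)) * F ?p) (at ?p)"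
      by (simp only:)
  qed
qed

lemma holomorphic_line_integrable:
  assumes holo: "F holomorphic_on {z. \<bar>Im z\<bar> < D}" and "\<bar>c\<bar> < D"
    and int: "integrable lborel (\<phi> :: real \<Rightarrow> real)" and bound: "\<And>x. cmod (F (Complex x c)) \<le> \<phi> x"
  shows "integrable lborel (\<lambda>x. F (Complex x c))"
proof (rule Bochner_Integration.integrable_bound[OF int])
  have "continuous_on UNIV (\<lambda>x. F (Complex x c))"
    using assms(2) by (intro continuous_on_compose2[OF holomorphic_on_imp_continuous_on[OF holo]])
      (auto simp: Complex_eq intro!: continuous_intros)
  then show "(\<lambda>x. F (Complex x c)) \<in> borel_measurable lborel"
    by (simp add: borel_measurable_continuous_onI)
  show "AE x in lborel. norm (F (Complex x c)) \<le> norm (\<phi> x)"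
    using bound by (auto intro!: AE_I2 intro: order_trans abs_ge_self)
qed

text \<open>The case of \<open>strip_residues\<close> without poles, between the heights
  \<open>- d\<close> and 0. It brings the integral left over on the lower line back to the real
  axis.\<close>

lemma line_integral_shift:
  assumes holo: "F holomorphic_on {z. \<bar>Im z\<bar> < D}" and d: "0 < d" "d < D"
    and int: "integrable lborel (\<phi> :: real \<Rightarrow> real)" and bound: "\<And>x y. \<bar>y\<bar> \<le> d \<Longrightarrow> cmod (F (Complex x y)) \<le> \<phi> x"
    and lim: "(\<phi> \<longlongrightarrow> 0) at_top" "(\<phi> \<longlongrightarrow> 0) at_bot"
  shows "(LINT x|lborel. F (Complex x (- d))) = (LINT x|lborel. F (of_real x))"
proof -
  \<comment> \<open>The left end is \<open>- 1 - n\<close> so that the interval is nondegenerate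
    already for \<open>n = 0\<close>.\<close>
  have a: "filterlim (\<lambda>n. - 1 - real n) at_bot sequentially" "filterlim (\<lambda>n. real n) at_top sequentially"
    by real_asymp+
  have nonneg: "0 \<le> \<phi> x" for x using bound[of 0 x] d by (auto intro: order_trans[OF norm_ge_zero])
  have "(\<lambda>n. 2 * pi * \<i> * (\<Sum>p\<in>{}. residue F p)) \<longlonglongrightarrow>
     (LINT x|lborel. F (Complex x (- d))) - (LINT x|lborel. F (Complex x 0))"
  proof (rule strip_residues[OF a, where S = "\<lambda>_. {z. \<bar>Im z\<bar> < D}" and M = "\<lambda>n. \<phi> (- 1 - real n) + \<phi> (real n)"])
    show "(\<lambda>n. \<phi> (- 1 - real n) + \<phi> (real n)) \<longlonglongrightarrow> 0"
      by (intro tendsto_add_zero filterlim_compose[OF lim(1) a(2)] filterlim_compose[OF lim(2) a(1)])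
    show "cmod (F (Complex (- 1 - real n) y)) \<le> \<phi> (- 1 - real n) + \<phi> (real n)"
      "cmod (F (Complex (real n) y)) \<le> \<phi> (- 1 - real n) + \<phi> (real n)" if "y \<in> {- d..0}" for n y
      using bound[of y] nonneg that by (auto intro: add_increasing add_increasing2)
  qed (use d in \<open>auto simp: in_cbox_complex_iff holo open_strip convex_strip
         intro!: holomorphic_line_integrable[OF holo _ int] bound\<close>)
  then have "(LINT x|lborel. F (Complex x (- d))) - (LINT x|lborel. F (Complex x 0)) = 0"
    by (simp add: LIMSEQ_const_iff)
  then show ?thesis by (simp add: complex_of_real_def)
qed

text \<open>The majorant \<open>\<phi>\<close> has three uses: it makes the line integrals exist,
  its limits at infinity remove the vertical sides, and its integral measures the error. The factor
  2 counts the two edges of the strip.\<close>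

theorem sinc_quadrature_error:
  fixes F :: "complex \<Rightarrow> complex" and \<tau> d D :: real and \<phi> :: "real \<Rightarrow> real"
  assumes holo: "F holomorphic_on {z. \<bar>Im z\<bar> < D}" and d: "0 < d" "d < D" and \<tau>: "0 < \<tau>"
    and int: "integrable lborel \<phi>" and bound: "\<And>x y. \<bar>y\<bar> \<le> d \<Longrightarrow> cmod (F (Complex x y)) \<le> \<phi> x"
    and lim: "(\<phi> \<longlongrightarrow> 0) at_top" "(\<phi> \<longlongrightarrow> 0) at_bot"
    and summ: "(\<lambda>n::int. F (of_real (n * \<tau>))) summable_on UNIV"
  shows "cmod ((LINT x|lborel. F (of_real x)) - \<tau> * (\<Sum>\<^sub>\<infinity>n::int. F (of_real (n * \<tau>))))
     \<le> 2 * (LINT x|lborel. \<phi> x) / (exp (2 * pi * d / \<tau>) - 1)"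
proof -
  define k where "k z = 1 / (exp (- (2 * pi * \<i> / \<tau>) * z) - 1)" for z
  let ?q = "1 / (exp (2 * pi * d / \<tau>) - 1)"
  define P where "P N = (\<lambda>j::int. complex_of_real (j * \<tau>)) ` {- int N..int N}" for N :: nat
  \<comment> \<open>Wide enough for the nodes up to index \<open>N\<close>, too narrow for the next
    ones.\<close>
  define S where "S N = {z. \<bar>Im z\<bar> < D} \<inter> {z. - (real N + 1) * \<tau> < Re z} \<inter> {z. Re z < (real N + 1) * \<tau>}" for N :: nat
  \<comment> \<open>Halfway between two nodes, where the exponential of the kernel is a negative
    real, so that the kernel has modulus at most 1 on the vertical sides.\<close>
  define b where "b N = (real N + 1 / 2) * \<tau>" for N :: nat
  have nonneg: "0 \<le> \<phi> x" for x using bound[of 0 x] d by (auto intro: order_trans[OF norm_ge_zero])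
  have pos: "?q > 0" using d \<tau> by simp
  have blim: "filterlim (\<lambda>N. - b N) at_bot sequentially" "filterlim b at_top sequentially"
    unfolding b_def using \<tau> by real_asymp+
  have kup: "cmod (k (Complex x d)) \<le> ?q" and klo: "cmod (k (Complex x (- d)) + 1) \<le> ?q" for x
    unfolding k_def using sinc_kernel_bounds[OF d(1) \<tau>] by auto
  have kside: "cmod (k (Complex x y)) \<le> 1" if "x = b N \<or> x = - b N" for x y N
  proof -
    have "exp (- (2 * pi * \<i> / \<tau>) * Complex x y) = - of_real (exp (2 * pi * y / \<tau>))"
    proof -
      have "- (2 * pi * \<i> / \<tau>) * Complex x y = of_real (2 * pi * y / \<tau>) - \<i> * of_real (2 * pi * x / \<tau>)"
        by (simp add: complex_eq_iff)
      moreover have "exp (\<i> * of_real (2 * pi * x / \<tau>)) = - 1"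
      proof -
        have eq: "2 * pi * b N / \<tau> = 2 * pi * N + pi" using \<tau> by (simp add: b_def field_simps)
        have "2 * pi * x / \<tau> = 2 * pi * N + pi \<or> 2 * pi * x / \<tau> = - (2 * pi * N + pi)"
          using that eq by (auto simp del: minus_add_distrib)
        moreover have "cis (2 * pi * N + pi) = - 1"
          by (simp add: cis_mult[symmetric] cis_multiple_2pi)
        moreover from this have "cis (- (2 * pi * N + pi)) = - 1"
          by (simp only: cis_inverse[symmetric], simp)
        ultimately show ?thesis unfolding cis_conv_exp[symmetric] by metis
      qed
      ultimately show ?thesis by (simp only: exp_diff exp_of_real) simp
    qed
    then have "k (Complex x y) = - 1 / of_real (1 + exp (2 * pi * y / \<tau>))"
      unfolding k_def by (simp only: diff_conv_add_uminus minus_add_distrib[symmetric] of_real_add of_real_1 add.commute divide_minus_right divide_minus_left)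
    then have "cmod (k (Complex x y)) = 1 / \<bar>1 + exp (2 * pi * y / \<tau>)\<bar>"
      by (simp only: norm_divide norm_of_real norm_minus_cancel norm_one)
    then show ?thesis by (simp add: add_pos_pos)
  qed
  have Gholo: "(\<lambda>z. F z * k z) holomorphic_on S N - P N" for N
  proof -
    have "exp (- (2 * pi * \<i> / \<tau>) * z) - 1 \<noteq> 0" if z: "z \<in> S N - P N" for z
    proof
      assume "exp (- (2 * pi * \<i> / \<tau>) * z) - 1 = 0"
      then obtain n :: int where "Im z = 0" "- (pi * Re z) = pi * (\<tau> * real_of_int n)"
        using \<tau> by (auto simp: exp_eq_1 divide_simps)
      moreover from this(2) have "pi * Re z = pi * (- n * \<tau>)" by (simp add: algebra_simps)
      ultimately have n: "Im z = 0" "Re z = real_of_int (- n) * \<tau>"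
        by (simp, simp only: mult_cancel_left pi_neq_zero simp_thms of_int_minus)
      then have "- (real N + 1) < real_of_int (- n)" "real_of_int (- n) < real N + 1"
        using z \<tau> by (simp_all only: S_def Diff_iff Int_iff mem_Collect_eq mult_less_cancel_right_pos)
      then have "- n \<in> {- int N..int N}" by auto
      then have "complex_of_real (real_of_int (- n) * \<tau>) \<in> P N" unfolding P_def by (rule imageI)
      moreover have "z = complex_of_real (real_of_int (- n) * \<tau>)"
        using n by (intro complex_eqI) (simp_all only: Re_complex_of_real Im_complex_of_real)
      ultimately show False using z by blast
    qed
    then show ?thesis unfolding k_def
      by (intro holomorphic_intros holomorphic_on_subset[OF holo]) (auto simp: S_def)
  qed
  have lineF: "integrable lborel (\<lambda>x. F (Complex x c))" if "\<bar>c\<bar> \<le> d" for c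
    using that d bound by (intro holomorphic_line_integrable[OF holo _ int]) auto
  have meask: "(\<lambda>x. k (Complex x c)) \<in> borel_measurable borel" for c
    unfolding k_def Complex_eq by measurable
  have prod: "integrable lborel (\<lambda>x. F (Complex x c) * g x)" "cmod (LINT x|lborel. F (Complex x c) * g x) \<le> (LINT x|lborel. \<phi> x) * ?q"
    if "\<bar>c\<bar> \<le> d" "g \<in> borel_measurable borel" "\<And>x. cmod (g x) \<le> ?q" for g c
  proof -
    have le: "cmod (F (Complex x c) * g x) \<le> \<phi> x * ?q" for x
      unfolding norm_mult using that bound[of c x] nonneg by (intro mult_mono) auto
    have int': "integrable lborel (\<lambda>x. \<phi> x * ?q)" using int by simp
    show 1: "integrable lborel (\<lambda>x. F (Complex x c) * g x)"
      using lineF[OF that(1)] that(2) le pos nonneg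
      by (intro Bochner_Integration.integrable_bound[OF int']) (auto intro!: AE_I2 simp del: norm_mult)
    have "cmod (LINT x|lborel. F (Complex x c) * g x) \<le> (LINT x|lborel. cmod (F (Complex x c) * g x))"
      by (rule integral_norm_bound)
    also have "\<dots> \<le> (LINT x|lborel. \<phi> x * ?q)"
      using 1 int' le by (intro integral_mono) auto
    finally show "cmod (LINT x|lborel. F (Complex x c) * g x) \<le> (LINT x|lborel. \<phi> x) * ?q" by simp
  qed
  note up = prod[OF _ meask kup] and lo = prod[OF _ borel_measurable_add[OF meask borel_measurable_const] klo]
  \<comment> \<open>The term split off here becomes the integral that the trapezoidal sum
    approximates.\<close>
  have lo_eq: "F (Complex x (- d)) * k (Complex x (- d)) =
      F (Complex x (- d)) * (k (Complex x (- d)) + 1) - F (Complex x (- d))" for x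
    by (simp add: algebra_simps)
  have intlo: "integrable lborel (\<lambda>x. F (Complex x (- d)) * k (Complex x (- d)))"
    unfolding lo_eq using lo(1)[of "- d"] lineF[of "- d"] d by (intro Bochner_Integration.integrable_diff) auto
  let ?I = "LINT x|lborel. F (Complex x (- d)) * k (Complex x (- d))"
    and ?J = "LINT x|lborel. F (Complex x d) * k (Complex x d)"
  have "(\<lambda>N. 2 * pi * \<i> * (\<Sum>p\<in>P N. residue (\<lambda>z. F z * k z) p)) \<longlonglongrightarrow> ?I - ?J"
  proof (rule strip_residues[OF blim, where S = S and M = "\<lambda>N. \<phi> (- b N) + \<phi> (b N)"])
    show "(\<lambda>N. \<phi> (- b N) + \<phi> (b N)) \<longlonglongrightarrow> 0"
      by (intro tendsto_add_zero filterlim_compose[OF lim(1) blim(2)] filterlim_compose[OF lim(2) blim(1)])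
    show "cmod (F (Complex (- b N) y) * k (Complex (- b N) y)) \<le> \<phi> (- b N) + \<phi> (b N)"
      "cmod (F (Complex (b N) y) * k (Complex (b N) y)) \<le> \<phi> (- b N) + \<phi> (b N)" if "y \<in> {- d..d}" for N y
    proof -
      have y: "\<bar>y\<bar> \<le> d" using that by auto
      have "cmod (F (Complex x y) * k (Complex x y)) \<le> \<phi> x * 1" if "x = b N \<or> x = - b N" for x
        unfolding norm_mult using kside[OF that] bound[OF y] nonneg by (intro mult_mono) auto
      then show "cmod (F (Complex (- b N) y) * k (Complex (- b N) y)) \<le> \<phi> (- b N) + \<phi> (b N)"
      "cmod (F (Complex (b N) y) * k (Complex (b N) y)) \<le> \<phi> (- b N) + \<phi> (b N)"
        using nonneg by (fastforce intro: add_increasing add_increasing2)+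
    qed
    show "convex (S N)" for N
      unfolding S_def by (intro convex_Int convex_strip convex_halfspace_Re_gt convex_halfspace_Re_lt)
    show "open (S N)" for N
      unfolding S_def by (intro open_Int open_strip open_halfspace_Re_gt open_halfspace_Re_lt)
    show "cbox (Complex (- b N) (- d)) (Complex (b N) d) \<subseteq> S N" for N
    proof
      fix z assume "z \<in> cbox (Complex (- b N) (- d)) (Complex (b N) d)"
      then have "- b N \<le> Re z" "Re z \<le> b N" "\<bar>Im z\<bar> \<le> d" by (auto simp: in_cbox_complex_iff)
      moreover have "b N < (real N + 1) * \<tau>" unfolding b_def using \<tau> by (intro mult_strict_right_mono) auto
      ultimately have "\<bar>Im z\<bar> < D" "- ((real N + 1) * \<tau>) < Re z" "Re z < (real N + 1) * \<tau>"
        using d by linarith+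
      then show "z \<in> S N" unfolding S_def by (simp only: Int_iff mem_Collect_eq minus_mult_left)
    qed
    show "finite (P N)" for N by (simp add: P_def)
    show "P N \<subseteq> box (Complex (- b N) (- d)) (Complex (b N) d)" for N
    proof
      fix p assume "p \<in> P N"
      then obtain j :: int where "p = complex_of_real (j * \<tau>)" "j \<in> {- int N..int N}"
        unfolding P_def by (rule imageE)
      then have j: "p = complex_of_real (j * \<tau>)" "- int N \<le> j" "j \<le> int N" by auto
      have "- (real N + 1/2) * \<tau> < j * \<tau>" and lt: "j * \<tau> < (real N + 1/2) * \<tau>"
        using j \<tau> by (intro mult_strict_right_mono; linarith)+
      then have "- ((real N + 1/2) * \<tau>) < j * \<tau>" by (simp only: minus_mult_left)
      with lt show "p \<in> box (Complex (- b N) (- d)) (Complex (b N) d)"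
        using j(1) d by (simp only: in_box_complex_iff b_def) (simp del: distrib_right_numeral)
    qed
    show "- b N < b N" for N using \<tau> by (simp add: b_def)
  qed (use d Gholo intlo up(1)[of d] in auto)
  moreover have "2 * pi * \<i> * (\<Sum>p\<in>P N. residue (\<lambda>z. F z * k z) p) = - \<tau> * (\<Sum>j\<in>{- int N..int N}. F (of_real (j * \<tau>)))" for N
  proof -
    have "(\<Sum>p\<in>P N. residue (\<lambda>z. F z * k z) p) =
        (\<Sum>j\<in>{- int N..int N}. residue (\<lambda>z. F z * k z) (of_real (j * \<tau>)))"
      unfolding P_def by (subst sum.reindex) (use \<tau> in \<open>auto simp: inj_on_def\<close>)
    also have "\<dots> = (\<Sum>j\<in>{- int N..int N}. - (\<tau> / (2 * pi * \<i>)) * F (of_real (j * \<tau>)))"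
      unfolding k_def using d by (intro sum.cong refl residue_sinc_kernel[OF holo _ \<tau>]) auto
    finally show ?thesis unfolding sum_distrib_left[symmetric] by simp
  qed
  moreover have "(\<lambda>N. \<Sum>j\<in>{- int N..int N}. F (of_real (j * \<tau>))) \<longlonglongrightarrow> (\<Sum>\<^sub>\<infinity>n::int. F (of_real (n * \<tau>)))"
  proof -
    \<comment> \<open>\<open>infsum\<close> is a limit along all finite subsets; the symmetric
      intervals eventually contain each of these, so they compute the same limit.\<close>
    have "filterlim (\<lambda>N::nat. {- int N..int N}) (finite_subsets_at_top UNIV) sequentially"
    proof (subst filterlim_finite_subsets_at_top, intro allI impI)
      fix X :: "int set" assume X: "finite X \<and> X \<subseteq> UNIV"
      show "\<forall>\<^sub>F N in sequentially. finite {- int N..int N} \<and> X \<subseteq> {- int N..int N} \<and> {- int N..int N} \<subseteq> UNIV"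
      \<comment> \<open>The sum dominates every single element and also makes sense when
        \<open>X\<close> is empty.\<close>
      proof (rule eventually_sequentiallyI[of "nat (\<Sum>x\<in>X. \<bar>x\<bar>)"])
        fix N assume N: "nat (\<Sum>x\<in>X. \<bar>x\<bar>) \<le> N"
        have "\<bar>x\<bar> \<le> (\<Sum>x\<in>X. \<bar>x\<bar>)" if "x \<in> X" for x using X that by (intro member_le_sum) auto
        then show "finite {- int N..int N} \<and> X \<subseteq> {- int N..int N} \<and> {- int N..int N} \<subseteq> UNIV"
          using N by fastforce
      qed
    qed
    then show ?thesis
      using has_sum_infsum[OF summ] unfolding has_sum_def by (rule filterlim_compose[rotated])
  qed
  ultimately have "?I - ?J = - \<tau> * (\<Sum>\<^sub>\<infinity>n::int. F (of_real (n * \<tau>)))"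
    by (simp only:) (rule LIMSEQ_unique, assumption, rule tendsto_mult_left)
  moreover have "?I = (LINT x|lborel. F (Complex x (- d)) * (k (Complex x (- d)) + 1)) - (LINT x|lborel. F (of_real x))"
    unfolding lo_eq using lo(1)[of "- d"] lineF[of "- d"] d line_integral_shift[OF holo d int bound lim]
    by (subst Bochner_Integration.integral_diff) auto
  ultimately have "(LINT x|lborel. F (of_real x)) - \<tau> * (\<Sum>\<^sub>\<infinity>n::int. F (of_real (n * \<tau>)))
      = (LINT x|lborel. F (Complex x (- d)) * (k (Complex x (- d)) + 1)) - ?J"
    by (simp add: algebra_simps)
  also have "cmod \<dots> \<le> (LINT x|lborel. \<phi> x) * ?q + (LINT x|lborel. \<phi> x) * ?q"
    using lo(2)[of "- d"] up(2)[of d] d by (intro norm_triangle_le_diff add_mono) auto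
  finally show ?thesis by simp
qed

section \<open>The scalar weight and the Balakrishnan formula\<close>

text \<open>Up to \<open>pi / 3\<close> the derivative of \<open>sin t - t / 4\<close> is at least
  1/4; beyond that point the sine is at least 1/2 while \<open>x / 4\<close> is at most 1/2.\<close>

lemma sin_ge_quarter:
  assumes "0 \<le> x" "x \<le> pi / 2"
  shows "sin x \<ge> x / 4"
proof (cases "x \<le> pi / 3")
  case True
  have "(\<lambda>t. sin t - t / 4) 0 \<le> (\<lambda>t. sin t - t / 4) x"
  proof (rule DERIV_nonneg_imp_nondecreasing[OF assms(1)])
    fix t assume t: "0 \<le> t" "t \<le> x"
    have "cos (pi / 3) \<le> cos t"
      using t True by (intro cos_monotone_0_pi_le) auto
    then show "\<exists>y. ((\<lambda>t. sin t - t / 4) has_real_derivative y) (at t) \<and> 0 \<le> y"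
      by (intro exI[of _ "cos t - 1 / 4"]) (auto intro!: derivative_eq_intros simp: cos_60)
  qed
  then show ?thesis by simp
next
  case False
  have "sin (pi / 6) \<le> sin x"
    using False assms by (intro sin_monotone_2pi_le) auto
  moreover have "x / 4 \<le> 1 / 2" using assms pi_less_4 by simp
  ultimately show ?thesis by (simp add: sin_30)
qed

text \<open>This is \<open>\<bar>x / 2\<bar> \<le> \<bar>sinh (x / 2)\<bar>\<close>, squared and
  multiplied by \<open>4 * exp x\<close>.\<close>

lemma sq_times_exp_le: "x\<^sup>2 * exp x \<le> (exp x - 1)\<^sup>2" for x :: real
proof -
  have *: "2 * t \<le> exp t - exp (- t)" if "0 \<le> t" for t :: real
  proof -
    have "(\<lambda>t. exp t - exp (- t) - 2 * t) 0 \<le> (\<lambda>t. exp t - exp (- t) - 2 * t) t"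
    proof (rule DERIV_nonneg_imp_nondecreasing[OF that])
      fix u :: real
      have "2 \<le> exp u + exp (- u)"
        using arith_geo_mean_sqrt[of "exp u" "exp (- u)"] by (simp add: exp_add[symmetric])
      then show "\<exists>y. ((\<lambda>t. exp t - exp (- t) - 2 * t) has_real_derivative y) (at u) \<and> 0 \<le> y"
        by (intro exI[of _ "exp u + exp (- u) - 2"]) (auto intro!: derivative_eq_intros)
    qed
    then show ?thesis by simp
  qed
  have "\<bar>x\<bar> \<le> \<bar>exp (x / 2) - exp (- (x / 2))\<bar>"
    using *[of "x / 2"] *[of "- (x / 2)"] by (cases "0 \<le> x") auto
  then have "x\<^sup>2 \<le> (exp (x / 2) - exp (- (x / 2)))\<^sup>2" by (rule abs_le_square_iff[THEN iffD1])
  then have "x\<^sup>2 * exp x \<le> (exp (x / 2) - exp (- (x / 2)))\<^sup>2 * (exp (x / 2))\<^sup>2"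
    by (simp add: power2_eq_square[of "exp (x / 2)"] exp_add[symmetric])
  also have "\<dots> = (exp x - 1)\<^sup>2"
    by (simp add: power_mult_distrib[symmetric] left_diff_distrib exp_add[symmetric])
  finally show ?thesis .
qed

text \<open>The squared modulus equals \<open>(exp s - 1)\<^sup>2 + 4 * exp s * (cos ((y - \<theta>)
  / 2))\<^sup>2\<close>: the first term sees the distance in the real direction, the second the
  distance from the angle at which the sum can vanish. With \<open>exp (s / 2)\<close> pulled out,
  the exponentials cancel when two such factors meet \<open>exp (- s)\<close>.\<close>

lemma cmod_exp_add_cis_ge:
  fixes s y \<theta> :: real
  shows "exp (s / 2) * (\<bar>s\<bar> + 2 * \<bar>cos ((y - \<theta>) / 2)\<bar>) / sqrt 2 \<le> cmod (exp (Complex s y) + cis \<theta>)"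
proof -
  define c where "c = \<bar>cos ((y - \<theta>) / 2)\<bar>"
  have "(cmod (exp (Complex s y) + cis \<theta>))\<^sup>2 = (exp s * cos y + cos \<theta>)\<^sup>2 + (exp s * sin y + sin \<theta>)\<^sup>2"
    by (simp add: cmod_power2 Re_exp Im_exp)
  also have "\<dots> = (exp s)\<^sup>2 * ((sin y)\<^sup>2 + (cos y)\<^sup>2) + ((sin \<theta>)\<^sup>2 + (cos \<theta>)\<^sup>2) + 2 * exp s * cos (y - \<theta>)"
    by (simp add: power2_eq_square cos_diff algebra_simps
        del: sin_cos_squared_add sin_cos_squared_add2 sin_cos_squared_add3)
  also have "\<dots> = (exp s)\<^sup>2 + 1 + 2 * exp s * cos (y - \<theta>)" by (simp only: sin_cos_squared_add mult_1_right)
  also have "cos (y - \<theta>) = 2 * c\<^sup>2 - 1"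
    using cos_double_cos[of "(y - \<theta>) / 2"] unfolding c_def by (simp del: right_diff_distrib_numeral)
  also have "(exp s)\<^sup>2 + 1 + 2 * exp s * (2 * c\<^sup>2 - 1) = (exp s - 1)\<^sup>2 + 4 * exp s * c\<^sup>2"
    by (simp add: power2_eq_square algebra_simps)
  also have "\<dots> \<ge> s\<^sup>2 * exp s + 4 * exp s * c\<^sup>2" using sq_times_exp_le[of s] by simp
  also have "s\<^sup>2 * exp s + 4 * exp s * c\<^sup>2 = exp s * (s\<^sup>2 + (2 * c)\<^sup>2)" by (simp add: algebra_simps)
  also have "\<dots> \<ge> exp s * ((\<bar>s\<bar> + 2 * c)\<^sup>2 / 2)"
    using sum_squares_bound[of "\<bar>s\<bar>" "2 * c"] by (intro mult_left_mono) (auto simp: power2_sum)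
  also have "exp s * ((\<bar>s\<bar> + 2 * c)\<^sup>2 / 2) = (exp (s / 2) * (\<bar>s\<bar> + 2 * c) / sqrt 2)\<^sup>2"
    by (simp add: power_mult_distrib power_divide exp_double[symmetric])
  finally show ?thesis unfolding c_def[symmetric] by (rule power2_le_imp_le) auto
qed

text \<open>Up to the factor \<open>2 * \<i> * sin (pi * \<alpha>)\<close>, this is the jump of
  \<open>1 / (t powr \<alpha> + b)\<close> across the negative axis, written in the variable
  \<open>z = \<alpha> * ln \<bar>t\<bar>\<close>. At \<open>z = n * \<tau>\<close> it is the weight
  of the \<open>n\<close>-th summand of \<open>u_sinc\<close>.\<close>

definition bal_weight :: "real \<Rightarrow> real \<Rightarrow> complex \<Rightarrow> complex" where
  "bal_weight \<alpha> b z = 1 / (exp z + of_real (2 * b * cos (pi * \<alpha>)) + of_real (b\<^sup>2) * exp (- z))"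

text \<open>The difference \<open>1 / (\<bar>s\<bar> + \<epsilon>) - 1 / (\<bar>s\<bar> + 1 +
  \<epsilon>)\<close>: it has the singularity of a simple pole at distance \<epsilon>, decays
  quadratically, and is integrable in closed form.\<close>

definition log_kernel :: "real \<Rightarrow> real \<Rightarrow> real" where
  "log_kernel \<epsilon> s = 1 / ((\<bar>s\<bar> + \<epsilon>) * (\<bar>s\<bar> + 1 + \<epsilon>))"

text \<open>After the translation by \<open>ln b\<close> the denominator is \<open>b\<close> times a
  quadratic polynomial in the exponential, divided by the exponential. Its roots put the nearest
  poles of the weight at height \<open>(1 - \<alpha>) * pi\<close>.\<close>

lemma bal_weight_denominator:
  assumes "0 < b"
  shows "exp z + of_real (2 * b * cos (pi * \<alpha>)) + of_real (b\<^sup>2) * exp (- z) =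
    b * exp (- (z - of_real (ln b))) * (exp (z - of_real (ln b)) + cis (pi * \<alpha>)) * (exp (z - of_real (ln b)) + cis (- (pi * \<alpha>)))"
proof -
  let ?w = "z - of_real (ln b)"
  have 1: "exp z = b * exp ?w" using assms by (simp add: exp_diff exp_of_real)
  have 2: "of_real (b\<^sup>2) * exp (- z) = b * exp (- ?w)"
    using assms by (simp add: exp_diff exp_of_real exp_minus power2_eq_square field_simps)
  have 3: "exp (- ?w) * exp ?w = 1" by (simp add: exp_add[symmetric])
  have 4: "cis (pi * \<alpha>) * cis (- (pi * \<alpha>)) = 1" by (simp add: cis_mult)
  have 5: "cis (pi * \<alpha>) + cis (- (pi * \<alpha>)) = 2 * cos (pi * \<alpha>)" by (simp add: complex_eq_iff)
  have "exp (- ?w) * (exp ?w + cis (pi * \<alpha>)) * (exp ?w + cis (- (pi * \<alpha>)))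
      = exp (- ?w) * exp ?w * (exp ?w + (cis (pi * \<alpha>) + cis (- (pi * \<alpha>)))) + exp (- ?w) * (cis (pi * \<alpha>) * cis (- (pi * \<alpha>)))"
    by (simp only: ring_distribs mult.assoc mult.left_commute mult.commute add_ac)
  also have "\<dots> = exp ?w + 2 * cos (pi * \<alpha>) + exp (- ?w)" unfolding 3 4 5 by simp
  finally have "b * (exp (- ?w) * (exp ?w + cis (pi * \<alpha>)) * (exp ?w + cis (- (pi * \<alpha>)))) = b * (exp ?w + 2 * cos (pi * \<alpha>) + exp (- ?w))"
    by (simp only:)
  then show ?thesis unfolding 2 using 1 by (simp add: algebra_simps)
qed

text \<open>Write \<open>s = x - ln b\<close>. One of the two factors vanishes at height
  \<open>(1 - \<alpha>) * pi\<close>, at distance at least \<epsilon> from \<open>y\<close>; the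
  zeros of the other stay at a distance governed by \<open>min \<alpha> (1 - \<alpha>)\<close>. Up
  to constants they contribute \<open>\<bar>s\<bar> + \<epsilon>\<close> and
  \<open>\<bar>s\<bar> + 1 + \<epsilon>\<close>, the two factors of
  \<open>log_kernel\<close>.\<close>

lemma bal_weight_denominator_ge:
  assumes \<alpha>: "0 < \<alpha>" "\<alpha> < 1" and b: "0 < b" and y: "\<bar>y\<bar> \<le> d" "d < (1 - \<alpha>) * pi"
    and \<epsilon>: "\<epsilon> = (1 - \<alpha>) * pi - d"
  shows "b * min \<alpha> (1 - \<alpha>) / 80 / log_kernel \<epsilon> (x - ln b)
      \<le> cmod (exp (Complex x y) + of_real (2 * b * cos (pi * \<alpha>)) + of_real (b\<^sup>2) * exp (- Complex x y))"
proof -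
  define m where "m = min \<alpha> (1 - \<alpha>)"
  define s where "s = x - ln b"
  have m: "0 < m" "m \<le> 1 - \<alpha>" "m \<le> \<alpha>" "m \<le> 1" using \<alpha> by (auto simp: m_def)
  have \<epsilon>4: "0 < \<epsilon>" "\<epsilon> \<le> 4"
  proof -
    have "(1 - \<alpha>) * pi \<le> 1 * pi" using \<alpha> by (intro mult_right_mono) auto
    then show "0 < \<epsilon>" "\<epsilon> \<le> 4" using \<epsilon> y pi_less_4 abs_ge_zero[of y] by linarith+
  qed
  have near: "\<bar>cos ((\<bar>y\<bar> + pi * \<alpha>) / 2)\<bar> \<ge> \<epsilon> / 8"
  proof -
    have "(\<bar>y\<bar> + pi * \<alpha>) / 2 = pi / 2 - (pi - pi * \<alpha> - \<bar>y\<bar>) / 2" by (simp add: field_simps)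
    then have "cos ((\<bar>y\<bar> + pi * \<alpha>) / 2) = sin ((pi - pi * \<alpha> - \<bar>y\<bar>) / 2)" by (simp only: cos_diff) simp
    moreover have "sin ((pi - pi * \<alpha> - \<bar>y\<bar>) / 2) \<ge> (pi - pi * \<alpha> - \<bar>y\<bar>) / 2 / 4"
      using \<alpha> y by (intro sin_ge_quarter) (auto simp: algebra_simps)
    ultimately show ?thesis using y \<epsilon> by (simp add: algebra_simps)
  qed
  \<comment> \<open>This cosine vanishes when \<open>\<bar>y\<bar> - pi * \<alpha>\<close> is plus
    or minus \<open>pi\<close>. The nearer of the two is at distance at least
    \<open>pi * \<alpha>\<close> if \<open>\<bar>y\<bar> \<ge> pi * \<alpha>\<close>, and at least
    \<open>pi * (1 - \<alpha>)\<close> otherwise.\<close>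
  have far: "\<bar>cos ((\<bar>y\<bar> - pi * \<alpha>) / 2)\<bar> \<ge> m / 4"
  proof -
    let ?u = "\<bar>\<bar>y\<bar> - pi * \<alpha>\<bar>"
    have u: "pi - ?u \<ge> pi * m"
    proof (cases "\<bar>y\<bar> \<ge> pi * \<alpha>")
      case True
      then have "pi - ?u = pi - \<bar>y\<bar> + pi * \<alpha>" by simp
      also have "\<dots> \<ge> pi * \<alpha>" using y \<epsilon> mult_pos_pos[OF \<alpha>(1) pi_gt_zero] unfolding left_diff_distrib by linarith
      finally show ?thesis using mult_left_mono[OF m(3), of pi] pi_ge_zero by linarith
    next
      case False
      then have "pi - ?u = pi * (1 - \<alpha>) + \<bar>y\<bar>" by (simp add: algebra_simps)
      also have "\<dots> \<ge> pi * m"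
        using mult_left_mono[OF m(2), of pi] pi_ge_zero abs_ge_zero[of y] by linarith
      finally show ?thesis .
    qed
    have "cos ((\<bar>y\<bar> - pi * \<alpha>) / 2) = cos (?u / 2)" using cos_abs_real[of "(\<bar>y\<bar> - pi * \<alpha>) / 2"] by simp
    also have "?u / 2 = pi / 2 - (pi - ?u) / 2" by (simp add: field_simps)
    also have "cos \<dots> = sin ((pi - ?u) / 2)" by (simp only: cos_diff) simp
    also have "\<dots> \<ge> (pi - ?u) / 2 / 4" 
      using order_trans[OF _ u, of 0] m by (intro sin_ge_quarter) auto
    finally have "cos ((\<bar>y\<bar> - pi * \<alpha>) / 2) \<ge> pi * m / 8" using u by simp
    moreover have "pi * m \<ge> 2 * m" using pi_ge_two m by (intro mult_right_mono) auto
    ultimately show ?thesis by linarith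
  qed
  \<comment> \<open>The sign of \<open>y\<close> decides which of the two factors is the near
    one.\<close>
  have cc: "\<epsilon> / 8 \<le> \<bar>cos ((y + pi * \<alpha>) / 2)\<bar> \<and> m / 4 \<le> \<bar>cos ((y - pi * \<alpha>) / 2)\<bar> \<or>
      \<epsilon> / 8 \<le> \<bar>cos ((y - pi * \<alpha>) / 2)\<bar> \<and> m / 4 \<le> \<bar>cos ((y + pi * \<alpha>) / 2)\<bar>"
  proof (cases "0 \<le> y")
    case True then show ?thesis using near far by simp
  next
    case False
    have "(- y + pi * \<alpha>) / 2 = - ((y - pi * \<alpha>) / 2)" "(- y - pi * \<alpha>) / 2 = - ((y + pi * \<alpha>) / 2)"
      by (simp_all add: field_simps)
    then have "cos ((- y + pi * \<alpha>) / 2) = cos ((y - pi * \<alpha>) / 2)" "cos ((- y - pi * \<alpha>) / 2) = cos ((y + pi * \<alpha>) / 2)"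
      by (simp_all only: cos_minus)
    then show ?thesis using near far False by simp
  qed
  let ?w = "Complex s y"
  have A: "exp (s / 2) * (\<bar>s\<bar> + 2 * \<bar>cos ((y - pi * \<alpha>) / 2)\<bar>) / sqrt 2 \<le> cmod (exp ?w + cis (pi * \<alpha>))"
    and B: "exp (s / 2) * (\<bar>s\<bar> + 2 * \<bar>cos ((y + pi * \<alpha>) / 2)\<bar>) / sqrt 2 \<le> cmod (exp ?w + cis (- (pi * \<alpha>)))"
    using cmod_exp_add_cis_ge[of s y "pi * \<alpha>"] cmod_exp_add_cis_ge[of s y "- (pi * \<alpha>)"] by simp_all
  \<comment> \<open>The bound \<open>\<epsilon> \<le> 4\<close> gives
    \<open>1 + \<epsilon> \<le> 5\<close>, whence the 10.\<close>
  have m10: "m / 10 * (\<bar>s\<bar> + 1 + \<epsilon>) \<le> \<bar>s\<bar> + m / 2"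
  proof -
    have "m / 10 * \<bar>s\<bar> \<le> 1 * \<bar>s\<bar>" "m / 10 * (1 + \<epsilon>) \<le> m / 10 * 5" using m \<epsilon>4 by (intro mult_right_mono mult_left_mono; simp)+
    then show ?thesis by (simp add: algebra_simps)
  qed
  have prod: "1 / 4 * (\<bar>s\<bar> + \<epsilon>) * (m / 10 * (\<bar>s\<bar> + 1 + \<epsilon>)) \<le>
      (\<bar>s\<bar> + 2 * \<bar>cos ((y - pi * \<alpha>) / 2)\<bar>) * (\<bar>s\<bar> + 2 * \<bar>cos ((y + pi * \<alpha>) / 2)\<bar>)"
  proof -
    have "1 / 4 * (\<bar>s\<bar> + \<epsilon>) * (m / 10 * (\<bar>s\<bar> + 1 + \<epsilon>)) \<le> (\<bar>s\<bar> + \<epsilon> / 4) * (\<bar>s\<bar> + m / 2)"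
      using m10 \<epsilon>4 m by (intro mult_mono) auto
    also have "\<dots> \<le> (\<bar>s\<bar> + 2 * \<bar>cos ((y - pi * \<alpha>) / 2)\<bar>) * (\<bar>s\<bar> + 2 * \<bar>cos ((y + pi * \<alpha>) / 2)\<bar>)"
      using cc
    proof
      assume "\<epsilon> / 8 \<le> \<bar>cos ((y + pi * \<alpha>) / 2)\<bar> \<and> m / 4 \<le> \<bar>cos ((y - pi * \<alpha>) / 2)\<bar>"
      then show ?thesis by (subst mult.commute, intro mult_mono) (use \<epsilon>4 m in auto)
    qed (intro mult_mono, use \<epsilon>4 m in auto)
    finally show ?thesis .
  qed
  \<comment> \<open>The constant is 80 = 4 * 10 * 2: 4 from the near factor, 10 from the far one, 2
    from the two square roots.\<close>
  have "b * (m / 80 * ((\<bar>s\<bar> + \<epsilon>) * (\<bar>s\<bar> + 1 + \<epsilon>)))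
      = b * (exp (- s) * (exp (s / 2) * exp (s / 2)) * (1 / 4 * (\<bar>s\<bar> + \<epsilon>) * (m / 10 * (\<bar>s\<bar> + 1 + \<epsilon>))) / (sqrt 2 * sqrt 2))"
    by (simp add: exp_add[symmetric])
  also have "\<dots> \<le> b * (exp (- s) * (exp (s / 2) * exp (s / 2)) * ((\<bar>s\<bar> + 2 * \<bar>cos ((y - pi * \<alpha>) / 2)\<bar>) * (\<bar>s\<bar> + 2 * \<bar>cos ((y + pi * \<alpha>) / 2)\<bar>)) / (sqrt 2 * sqrt 2))"
    using prod b by (intro mult_left_mono divide_right_mono) auto
  also have "\<dots> = b * exp (- s) * ((exp (s / 2) * (\<bar>s\<bar> + 2 * \<bar>cos ((y - pi * \<alpha>) / 2)\<bar>) / sqrt 2) * (exp (s / 2) * (\<bar>s\<bar> + 2 * \<bar>cos ((y + pi * \<alpha>) / 2)\<bar>) / sqrt 2))"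
    by (simp add: field_simps)
  also have "\<dots> \<le> b * exp (- s) * (cmod (exp ?w + cis (pi * \<alpha>)) * cmod (exp ?w + cis (- (pi * \<alpha>))))"
    using A B b by (intro mult_left_mono mult_mono) auto
  also have "\<dots> = cmod (exp (Complex x y) + of_real (2 * b * cos (pi * \<alpha>)) + of_real (b\<^sup>2) * exp (- Complex x y))"
  proof -
    have "Complex x y - of_real (ln b) = ?w" by (simp add: s_def complex_eq_iff)
    then show ?thesis
      using b unfolding bal_weight_denominator[OF b, of "Complex x y" \<alpha>] by (simp add: norm_mult)
  qed
  finally show ?thesis by (simp add: log_kernel_def m_def s_def)
qed

lemma log_kernel_pos: "0 < \<epsilon> \<Longrightarrow> 0 < log_kernel \<epsilon> s"
  by (auto simp: log_kernel_def)

lemma bal_weight_bound: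
  assumes \<alpha>: "0 < \<alpha>" "\<alpha> < 1" and b: "0 < b" and y: "\<bar>y\<bar> \<le> d" "d < (1 - \<alpha>) * pi"
  shows "cmod (bal_weight \<alpha> b (Complex x y)) \<le> 80 / (min \<alpha> (1 - \<alpha>) * b) * log_kernel ((1 - \<alpha>) * pi - d) (x - ln b)"
    and "exp (Complex x y) + of_real (2 * b * cos (pi * \<alpha>)) + of_real (b\<^sup>2) * exp (- Complex x y) \<noteq> 0"
proof -
  let ?D = "exp (Complex x y) + of_real (2 * b * cos (pi * \<alpha>)) + of_real (b\<^sup>2) * exp (- Complex x y)"
  let ?l = "log_kernel ((1 - \<alpha>) * pi - d) (x - ln b)"
  have l: "?l > 0" using y by (intro log_kernel_pos) simp
  have ge: "b * min \<alpha> (1 - \<alpha>) / 80 / ?l \<le> cmod ?D"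
    using bal_weight_denominator_ge[OF \<alpha> b y refl] .
  moreover have pos: "b * min \<alpha> (1 - \<alpha>) / 80 / ?l > 0" using b \<alpha> l by (intro divide_pos_pos mult_pos_pos) auto
  ultimately show "?D \<noteq> 0" by auto
  have "cmod (bal_weight \<alpha> b (Complex x y)) = 1 / cmod ?D" by (simp add: bal_weight_def norm_divide)
  also have "\<dots> \<le> 1 / (b * min \<alpha> (1 - \<alpha>) / 80 / ?l)" using ge pos by (intro divide_left_mono mult_pos_pos) auto
  finally show "cmod (bal_weight \<alpha> b (Complex x y)) \<le> 80 / (min \<alpha> (1 - \<alpha>) * b) * ?l" by (simp add: mult.commute)
qed

text \<open>On the half-line the partial fractions have the primitive \<open>?F\<close>, which
  vanishes at infinity; evenness doubles the value.\<close>

lemma log_kernel_has_integral: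
  assumes "0 < \<epsilon>"
  shows "has_bochner_integral lborel (log_kernel \<epsilon>) (2 * ln (1 + 1 / \<epsilon>))"
proof -
  let ?f = "\<lambda>s. 1 / ((s + \<epsilon>) * (s + 1 + \<epsilon>))"
  let ?F = "\<lambda>s. ln (s + \<epsilon>) - ln (s + 1 + \<epsilon>)"
  have meas: "?f \<in> borel_measurable borel" by measurable
  have "(\<integral>\<^sup>+x. ennreal (?f x) * indicator {0..} x \<partial>lborel) = 0 - ?F 0"
  proof (rule nn_integral_FTC_atLeast[OF meas])
    show "(?F has_real_derivative ?f x) (at x)" if "0 \<le> x" for x
      using that assms by (auto intro!: derivative_eq_intros simp: field_simps)
    show "0 \<le> ?f x" if "0 \<le> x" for x using that assms by simp
    show "(?F \<longlongrightarrow> 0) at_top" using assms by real_asymp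
  qed
  also have "(\<integral>\<^sup>+x. ennreal (?f x) * indicator {0..} x \<partial>lborel) = (\<integral>\<^sup>+x. ennreal (indicator {0..} x *\<^sub>R log_kernel \<epsilon> x) \<partial>lborel)"
    by (intro nn_integral_cong) (auto simp: log_kernel_def indicator_def)
  also have "0 - ?F 0 = ln (1 + 1 / \<epsilon>)"
  proof -
    have "1 + 1 / \<epsilon> = (1 + \<epsilon>) / \<epsilon>" using assms by (simp add: field_simps)
    then show ?thesis using assms by (simp add: ln_div)
  qed
  finally have "has_bochner_integral lborel (\<lambda>x. indicator {0..} x *\<^sub>R log_kernel \<epsilon> x) (ln (1 + 1 / \<epsilon>))"
    using assms by (intro has_bochner_integral_nn_integral) (auto simp: log_kernel_def)
  from has_bochner_integral_even_function[OF this] show ?thesis by (simp add: log_kernel_def[abs_def])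
qed

lemma divide_product_mono:
  fixes p q A B n :: real
  shows "0 < p \<Longrightarrow> p \<le> A \<Longrightarrow> 0 < q \<Longrightarrow> q \<le> B \<Longrightarrow> 0 \<le> n \<Longrightarrow> n / (A * B) \<le> n / (p * q)"
  by (intro divide_left_mono mult_mono mult_pos_pos) auto

section \<open>The Balakrishnan formula for a number off the slit\<close>

text \<open>Off the slit, \<open>- l\<close> has a positive distance \<delta> from the half-line of
  nonnegative \<open>t\<close>, and for large \<open>t\<close> the modulus grows like
  \<open>t\<close>.\<close>

lemma cmod_add_nonneg_lower_bound:
  fixes l :: complex
  assumes "l \<notin> \<real>\<^sub>\<le>\<^sub>0"
  obtains c where "0 < c" "\<And>t::real. 0 \<le> t \<Longrightarrow> c * (t + 1) \<le> cmod (of_real t + l)"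
proof -
  obtain \<delta> where \<delta>: "0 < \<delta>" "\<And>t::real. 0 \<le> t \<Longrightarrow> \<delta> \<le> cmod (of_real t + l)"
  proof (cases "Im l = 0")
    case True
    then have "0 < Re l" using assms by (simp add: complex_nonpos_Reals_iff)
    moreover have "Re l \<le> cmod (of_real t + l)" if "0 \<le> t" for t :: real
      using complex_Re_le_cmod[of "of_real t + l"] that by simp
    ultimately show ?thesis using that by blast
  next
    case False
    moreover have "\<bar>Im l\<bar> \<le> cmod (of_real t + l)" for t :: real
      using abs_Im_le_cmod[of "of_real t + l"] by simp
    ultimately show ?thesis using that[of "\<bar>Im l\<bar>"] by auto
  qed
  \<comment> \<open>From \<open>t + 1 = (t - cmod l) + (cmod l + 1)\<close>: the first summand is at
    most \<open>cmod (t + l)\<close>, the second at most \<open>(cmod l + 1) / \<delta>\<close>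
    times it.\<close>
  define q where "q = 1 + (cmod l + 1) / \<delta>"
  have q: "q > 0" using \<delta>(1) by (auto simp: q_def intro!: add_pos_nonneg)
  have "1 / q * (t + 1) \<le> cmod (of_real t + l)" if t: "0 \<le> t" for t :: real
  proof -
    have "t - cmod l \<le> cmod (of_real t + l)"
      using norm_diff_ineq[of "complex_of_real t" l] t by simp
    moreover have "cmod l + 1 \<le> cmod (of_real t + l) * ((cmod l + 1) / \<delta>)"
      using mult_right_mono[OF \<delta>(2)[OF t], of "(cmod l + 1) / \<delta>"] \<delta>(1) by simp
    ultimately have "t + 1 \<le> cmod (of_real t + l) * q" by (simp add: q_def algebra_simps)
    then show ?thesis using q by (simp add: field_simps)
  qed
  then show ?thesis using q that[of "1 / q"] by auto
qed

text \<open>The quotient is at most \<open>exp (- (\<alpha> * \<bar>x\<bar>))\<close> on both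
  half-lines, and the quadratic Taylor bound of the exponential turns this into
  \<open>log_kernel 1\<close>, whose integrability is known.\<close>

lemma exp_ratio_le_log_kernel:
  assumes \<alpha>: "0 < \<alpha>" "\<alpha> < 1"
  shows "exp x / ((exp x + 1) * (exp (\<alpha> * x) + 1)) \<le> 4 / \<alpha>\<^sup>2 * log_kernel 1 x"
proof -
  let ?t = "\<bar>x\<bar>"
  have "exp x / ((exp x + 1) * (exp (\<alpha> * x) + 1)) \<le> exp (- (\<alpha> * ?t))"
  proof (cases "0 \<le> x")
    case True
    have "exp x / ((exp x + 1) * (exp (\<alpha> * x) + 1)) \<le> exp x / (exp x * exp (\<alpha> * x))"
      by (intro divide_left_mono mult_mono) (auto intro!: mult_pos_pos add_pos_pos)
    then show ?thesis using True by (simp add: exp_minus field_simps)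
  next
    case False
    have "exp x / ((exp x + 1) * (exp (\<alpha> * x) + 1)) \<le> exp x / (1 * 1)"
      by (intro divide_left_mono mult_mono) (auto intro!: mult_pos_pos add_pos_pos)
    also have "exp x \<le> exp (\<alpha> * x)" using False \<alpha> mult_right_mono_neg[of \<alpha> 1 x] by simp
    finally show ?thesis using False by simp
  qed
  also have "exp (- (\<alpha> * ?t)) \<le> 4 / \<alpha>\<^sup>2 * log_kernel 1 x"
  proof -
    have \<alpha>2: "\<alpha>\<^sup>2 \<le> \<alpha>" "\<alpha>\<^sup>2 \<le> 1" using \<alpha> by (auto simp: power2_eq_square mult_le_one)
    have "\<alpha>\<^sup>2 / 4 * ((?t + 1) * (?t + 2)) = \<alpha>\<^sup>2 * (?t * ?t) / 4 + \<alpha>\<^sup>2 * (3 * ?t) / 4 + \<alpha>\<^sup>2 / 2"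
      by (simp add: algebra_simps)
    also have "\<dots> \<le> \<alpha>\<^sup>2 * (?t * ?t) / 2 + \<alpha> * ?t + 1"
    proof -
      have "\<alpha>\<^sup>2 * ?t \<le> \<alpha> * ?t" "0 \<le> \<alpha> * ?t" using mult_right_mono[OF \<alpha>2(1), of "?t"] \<alpha> by simp_all
      then have "\<alpha>\<^sup>2 * (3 * ?t) / 4 \<le> \<alpha> * ?t" by linarith
      moreover have "0 \<le> \<alpha>\<^sup>2 * (?t * ?t)" by simp
      ultimately show ?thesis using \<alpha>2 by linarith
    qed
    also have "\<dots> = 1 + \<alpha> * ?t + (\<alpha> * ?t)\<^sup>2 / 2" by (simp add: power2_eq_square)
    also have "\<dots> \<le> exp (\<alpha> * ?t)" using \<alpha> by (intro exp_lower_Taylor_quadratic) auto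
    finally have "\<alpha>\<^sup>2 / 4 * ((?t + 1) * (?t + 2)) \<le> exp (\<alpha> * ?t)" .
    moreover have "0 < \<alpha>\<^sup>2 / 4 * ((?t + 1) * (?t + 2))" using \<alpha> by auto
    ultimately have "1 / exp (\<alpha> * ?t) \<le> 1 / (\<alpha>\<^sup>2 / 4 * ((?t + 1) * (?t + 2)))"
      by (intro divide_left_mono mult_pos_pos) auto
    then show ?thesis by (simp add: log_kernel_def exp_minus inverse_eq_divide add.commute)
  qed
  finally show ?thesis .
qed

text \<open>Solutions differ by multiples of \<open>2 * pi * \<i>\<close>. Off the slit
  \<open>\<bar>Im (Ln l)\<bar> < pi\<close>, so the strip allowed here is wider than
  \<open>pi\<close> and leaves room for contours along \<open>\<bar>Im z\<bar> = pi\<close>.\<close>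

lemma exp_eq_slit_imp:
  fixes z l :: complex
  assumes "exp z = l" "l \<notin> \<real>\<^sub>\<le>\<^sub>0" "\<bar>Im z\<bar> < 2 * pi - \<bar>Im (Ln l)\<bar>"
  shows "z = Ln l"
proof -
  have l: "l \<noteq> 0" using assms by auto
  have "exp z = exp (Ln l)" using assms l by simp
  then obtain n :: int where n: "z = Ln l + (of_int (2 * n) * pi) * \<i>"
    by (auto simp: exp_eq)
  have "n = 0"
  proof (rule ccontr)
    assume "n \<noteq> 0"
    then have "2 * pi * 1 \<le> 2 * pi * \<bar>real_of_int n\<bar>" by (intro mult_left_mono) auto
    also have "\<dots> = \<bar>2 * real_of_int n * pi\<bar>" by (simp add: abs_mult)
    also have "\<dots> = \<bar>Im z - Im (Ln l)\<bar>" using n by simp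
    also have "\<dots> \<le> \<bar>Im z\<bar> + \<bar>Im (Ln l)\<bar>" by linarith
    finally show False using assms(3) by linarith
  qed
  then show ?thesis using n by simp
qed

lemma abs_Im_Ln_slit: "(l :: complex) \<notin> \<real>\<^sub>\<le>\<^sub>0 \<Longrightarrow> \<bar>Im (Ln l)\<bar> < pi"
  using mpi_less_Im_Ln[of l] Im_Ln_le_pi[of l] Im_Ln_eq_pi[of l]
  by (cases "l = 0"; cases "Im (Ln l) = pi") (auto simp: complex_nonpos_Reals_iff abs_less_iff)

lemma exp_eq_neg_imp:
  fixes z :: complex
  assumes "exp z = - complex_of_real b" "0 < b"
  shows "pi \<le> \<bar>Im z\<bar>"
proof (rule ccontr)
  assume "\<not> pi \<le> \<bar>Im z\<bar>"
  then have "Ln (exp z) = z" by (intro Ln_exp) auto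
  moreover have "Im (Ln (- complex_of_real b)) = pi" using assms(2) by (simp add: Im_Ln_eq_pi)
  ultimately show False using assms(1) \<open>\<not> pi \<le> \<bar>Im z\<bar>\<close> by auto
qed

text \<open>The argument of the power is \<alpha> times that of \<open>z\<close>, hence below
  \<open>pi\<close> in modulus, so the power is not a negative real.\<close>

lemma powr_slit_ne_neg:
  fixes z :: complex
  assumes "0 < \<alpha>" "\<alpha> < 1" "0 < b" "z \<notin> \<real>\<^sub>\<le>\<^sub>0"
  shows "z powr of_real \<alpha> + of_real b \<noteq> 0"
proof
  assume "z powr of_real \<alpha> + of_real b = 0"
  then have "exp (of_real \<alpha> * Ln z) = - of_real b" using assms by (auto simp: powr_def add_eq_0_iff2 split: if_splits)
  then have "pi \<le> \<bar>\<alpha> * Im (Ln z)\<bar>" using exp_eq_neg_imp[OF _ assms(3)] by fastforce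
  also have "\<dots> = \<alpha> * \<bar>Im (Ln z)\<bar>" using assms by (simp add: abs_mult)
  also have "\<dots> \<le> 1 * \<bar>Im (Ln z)\<bar>" using assms by (intro mult_right_mono) auto
  finally show False using abs_Im_Ln_slit[OF assms(4)] by simp
qed

text \<open>With \<open>t = exp z\<close>, the strip \<open>\<bar>Im z\<bar> \<le> pi\<close> is the
  \<open>t\<close>-plane cut along the negative axis, and \<open>F\<close> is the integrand of the
  Cauchy formula for \<open>1 / (t powr \<alpha> + b)\<close> at \<open>l\<close>. The two edges of
  the strip are the two sides of the cut, so the difference of the edge integrals is the integral of
  the jump.\<close>

theorem balakrishnan_kernel:
  fixes l :: complex
  assumes \<alpha>: "0 < \<alpha>" "\<alpha> < 1" and b: "0 < b" and l: "l \<notin> \<real>\<^sub>\<le>\<^sub>0"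
  shows "1 / (l powr of_real \<alpha> + of_real b) =
    of_real (sin (pi * \<alpha>) / (\<alpha> * pi)) *
      (LINT y|lborel. of_real (exp (y / \<alpha>)) / (of_real (exp (y / \<alpha>)) + l) * bal_weight \<alpha> b (of_real y))"
proof -
  define F where "F z = exp z / ((exp z - l) * (exp (of_real \<alpha> * z) + of_real b))" for z
  \<comment> \<open>The zeros of \<open>exp z - l\<close> other than \<open>Ln l\<close>, and those
    of the second factor, which lie at height \<open>pi / \<alpha>\<close> or more, stay outside
    this strip.\<close>
  define D where "D = min (2 * pi - \<bar>Im (Ln l)\<bar>) (pi / \<alpha>)"
  have D: "pi < D" using abs_Im_Ln_slit[OF l] \<alpha> by (simp add: D_def field_simps)
  have l0: "l \<noteq> 0" using l by auto
  have ne1: "exp z - l \<noteq> 0" if "\<bar>Im z\<bar> < D" "z \<noteq> Ln l" for z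
    using exp_eq_slit_imp[OF _ l] that by (auto simp: D_def)
  have ne2: "exp (of_real \<alpha> * z) + of_real b \<noteq> 0" if "\<bar>Im z\<bar> < D" for z
  proof
    assume "exp (of_real \<alpha> * z) + of_real b = 0"
    then have "pi \<le> \<bar>Im (of_real \<alpha> * z)\<bar>" by (intro exp_eq_neg_imp[OF _ b]) (simp add: add_eq_0_iff2)
    moreover have "\<alpha> * \<bar>Im z\<bar> < \<alpha> * (pi / \<alpha>)" using that \<alpha> by (intro mult_strict_left_mono) (auto simp: D_def)
    ultimately show False using \<alpha> by (simp add: abs_mult)
  qed
  have holo: "F holomorphic_on {z. \<bar>Im z\<bar> < D} - {Ln l}"
    unfolding F_def using ne1 ne2 by (intro holomorphic_intros) auto
  have res: "residue F (Ln l) = 1 / (l powr of_real \<alpha> + of_real b)"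
  proof (rule residue_simple'[OF open_strip _ holo])
    show "Ln l \<in> {z. \<bar>Im z\<bar> < D}" using abs_Im_Ln_slit[OF l] D by simp
    have "(exp has_field_derivative exp (Ln l)) (at (Ln l))" by (rule DERIV_exp)
    then have "((\<lambda>z. (exp z - l) / (z - Ln l)) \<longlongrightarrow> l) (at (Ln l))"
      using l0 unfolding has_field_derivative_iff by simp
    then have "((\<lambda>z. inverse ((exp z - l) / (z - Ln l)) * (exp z / (exp (of_real \<alpha> * z) + of_real b))) \<longlongrightarrow>
        inverse l * (exp (Ln l) / (exp (of_real \<alpha> * Ln l) + of_real b))) (at (Ln l))"
      using l0 ne2[of "Ln l"] abs_Im_Ln_slit[OF l] D by (intro tendsto_intros) auto
    moreover have "inverse ((exp z - l) / (z - Ln l)) * (exp z / (exp (of_real \<alpha> * z) + of_real b)) = F z * (z - Ln l)" for z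
      unfolding F_def by (simp add: field_simps)
    ultimately show "((\<lambda>z. F z * (z - Ln l)) \<longlongrightarrow> 1 / (l powr of_real \<alpha> + of_real b)) (at (Ln l))"
      using l0 by (simp add: powr_def)
  qed
  have line: "integrable lborel (\<lambda>x. F (Complex x c))" "F (Complex x c) =
      of_real (exp x) / (of_real (exp x) + l) * (1 / (of_real (exp (\<alpha> * x)) * cis (\<alpha> * c) + of_real b))"
    if c: "\<bar>c\<bar> = pi" for c x
  proof -
    let ?u = "of_real b * cis (- (\<alpha> * c))"
    have e1: "exp (Complex x c) = - of_real (exp x)" for x
    proof -
      from c have "c = pi \<or> c = - pi" by (auto simp: abs_if split: if_splits)
      then show ?thesis by (auto simp: complex_eq_iff Re_exp Im_exp)
    qed
    have e2: "exp (of_real \<alpha> * Complex x c) = of_real (exp (\<alpha> * x)) * cis (\<alpha> * c)" for x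
      by (simp add: complex_eq_iff Re_exp Im_exp)
    have eq: "F (Complex x c) = of_real (exp x) / (of_real (exp x) + l) * (1 / (of_real (exp (\<alpha> * x)) * cis (\<alpha> * c) + of_real b))" for x
    proof -
      have "- of_real (exp x) / ((- of_real (exp x) - l) * Q) = of_real (exp x) / (of_real (exp x) + l) * (1 / Q)" for Q
      proof -
        have "- of_real (exp x) - l = - (of_real (exp x) + l)" by simp
        then show ?thesis by (simp only: mult_minus_left minus_divide_divide times_divide_times_eq mult_1_right)
      qed
      then show ?thesis unfolding F_def e1 e2 .
    qed
    then show "F (Complex x c) = of_real (exp x) / (of_real (exp x) + l) * (1 / (of_real (exp (\<alpha> * x)) * cis (\<alpha> * c) + of_real b))" .
    have "?u \<notin> \<real>\<^sub>\<le>\<^sub>0"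
    proof
      assume "?u \<in> \<real>\<^sub>\<le>\<^sub>0"
      then have "sin (\<alpha> * c) = 0" using b by (simp add: complex_nonpos_Reals_iff)
      moreover have "sin (\<alpha> * \<bar>c\<bar>) > 0" unfolding c using \<alpha> by (intro sin_gt_zero) auto
      ultimately show False by (auto simp: abs_if split: if_splits)
    qed
    from cmod_add_nonneg_lower_bound[OF this] obtain q
      where q: "0 < q" "\<And>t::real. 0 \<le> t \<Longrightarrow> q * (t + 1) \<le> cmod (of_real t + ?u)" by metis
    from cmod_add_nonneg_lower_bound[OF l] obtain p
      where p: "0 < p" "\<And>t::real. 0 \<le> t \<Longrightarrow> p * (t + 1) \<le> cmod (of_real t + l)" by metis
    have bd: "cmod (F (Complex x c)) \<le> 1 / (p * q) * (4 / \<alpha>\<^sup>2 * log_kernel 1 x)" for x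
    proof -
      have "of_real (exp (\<alpha> * x)) * cis (\<alpha> * c) + of_real b = cis (\<alpha> * c) * (of_real (exp (\<alpha> * x)) + ?u)"
        by (simp add: algebra_simps cis_mult)
      then have "cmod (F (Complex x c)) = exp x / (cmod (of_real (exp x) + l) * cmod (of_real (exp (\<alpha> * x)) + ?u))"
        unfolding eq by (simp add: norm_mult norm_divide)
      also have "\<dots> \<le> exp x / ((p * (exp x + 1)) * (q * (exp (\<alpha> * x) + 1)))"
      proof -
        have pos: "0 < p * (exp x + 1)" "0 < q * (exp (\<alpha> * x) + 1)" using p(1) q(1) by (auto intro!: mult_pos_pos add_pos_pos)
        then show ?thesis using p(2)[of "exp x"] q(2)[of "exp (\<alpha> * x)"]
          by (intro divide_product_mono) auto
      qed
      also have "\<dots> = 1 / (p * q) * (exp x / ((exp x + 1) * (exp (\<alpha> * x) + 1)))"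
        by (simp add: field_simps)
      also have "\<dots> \<le> 1 / (p * q) * (4 / \<alpha>\<^sup>2 * log_kernel 1 x)"
        using p(1) q(1) by (intro mult_left_mono exp_ratio_le_log_kernel[OF \<alpha>]) auto
      finally show ?thesis .
    qed
    have "integrable lborel (\<lambda>x. 1 / (p * q) * (4 / \<alpha>\<^sup>2 * log_kernel 1 x))"
      using log_kernel_has_integral[of 1] by (auto simp: has_bochner_integral_iff)
    moreover have "(\<lambda>x. F (Complex x c)) \<in> borel_measurable lborel"
      unfolding eq by measurable
    ultimately show "integrable lborel (\<lambda>x. F (Complex x c))"
      by (rule Bochner_Integration.integrable_bound)
         (unfold real_norm_def, intro AE_I2 order_trans[OF bd abs_ge_self])
  qed
  have "\<forall>\<^sub>F R in at_top. 2 * cmod l \<le> exp R \<and> exp (- R) \<le> cmod l / 2 \<and> 2 * b \<le> exp (\<alpha> * R) \<and> exp (- (\<alpha> * R)) \<le> b / 2"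
    using l0 \<alpha> b zero_less_norm_iff[of l] by (intro eventually_conj; real_asymp)
  \<comment> \<open>Far out each factor of the denominator is at least half its dominant term:
    \<open>exp R\<close> and \<open>exp (\<alpha> * R)\<close> on the right, \<open>cmod l\<close>
    and \<open>b\<close> on the left.\<close>
  then obtain R0 where R0: "\<And>R. R \<ge> R0 \<Longrightarrow> 2 * cmod l \<le> exp R \<and> exp (- R) \<le> cmod l / 2 \<and> 2 * b \<le> exp (\<alpha> * R) \<and> exp (- (\<alpha> * R)) \<le> b / 2"
    by (auto simp: eventually_at_top_linorder)
  \<comment> \<open>The real part of \<open>Ln l\<close> is included so that every rectangle
    contains the pole.\<close>
  define R where "R n = max R0 0 + \<bar>Re (Ln l)\<bar> + 1 + real n" for n :: nat
  have R: "R n \<ge> R0" "R n > \<bar>Re (Ln l)\<bar>" "R n > 0" for n by (auto simp: R_def)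
  have Rlim: "filterlim (\<lambda>n. - R n) at_bot sequentially" "filterlim R at_top sequentially"
    unfolding R_def by real_asymp+
  have right: "cmod (F (Complex (R n) y)) \<le> 4 * exp (- (\<alpha> * R n))" for n y
  proof -
    have 1: "exp (R n) / 2 \<le> cmod (exp (Complex (R n) y) - l)"
      using norm_triangle_ineq2[of "exp (Complex (R n) y)" l] R0[OF R(1), of n] by simp
    have 2: "exp (\<alpha> * R n) / 2 \<le> cmod (exp (of_real \<alpha> * Complex (R n) y) + of_real b)"
      using norm_diff_ineq[of "exp (of_real \<alpha> * Complex (R n) y)" "of_real b"] R0[OF R(1), of n] b by simp
    have "cmod (F (Complex (R n) y)) \<le> exp (R n) / (exp (R n) / 2 * (exp (\<alpha> * R n) / 2))"
      unfolding F_def norm_divide norm_mult using divide_product_mono[OF _ 1 _ 2, of "exp (R n)"] by simp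
    then show ?thesis by (simp add: exp_minus field_simps)
  qed
  have left: "cmod (F (Complex (- R n) y)) \<le> 4 / (cmod l * b) * exp (- R n)" for n y
  proof -
    have 1: "cmod l / 2 \<le> cmod (exp (Complex (- R n) y) - l)"
      using norm_triangle_ineq3[of "exp (Complex (- R n) y)" l] R0[OF R(1), of n]
      unfolding norm_exp_eq_Re complex.sel by linarith
    have 2: "b / 2 \<le> cmod (exp (of_real \<alpha> * Complex (- R n) y) + of_real b)"
      using norm_diff_ineq[of "of_real b" "exp (of_real \<alpha> * Complex (- R n) y)"] R0[OF R(1), of n] b by (simp add: add.commute)
    have "cmod (F (Complex (- R n) y)) \<le> exp (- R n) / (cmod l / 2 * (b / 2))"
      unfolding F_def norm_divide norm_mult using divide_product_mono[OF _ 1 _ 2, of "exp (- R n)"] l0 b by simp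
    then show ?thesis by (simp add: mult.commute)
  qed
  have "(\<lambda>n::nat. 2 * pi * \<i> * (\<Sum>p\<in>{Ln l}. residue F p)) \<longlonglongrightarrow>
      (LINT x|lborel. F (Complex x (- pi))) - (LINT x|lborel. F (Complex x pi))"
  proof (rule strip_residues[OF Rlim, where S = "\<lambda>_. {z. \<bar>Im z\<bar> < D}"
        and M = "\<lambda>n. 4 * exp (- (\<alpha> * R n)) + 4 / (cmod l * b) * exp (- R n)"])
    show "(\<lambda>n. 4 * exp (- (\<alpha> * R n)) + 4 / (cmod l * b) * exp (- R n)) \<longlonglongrightarrow> 0"
      unfolding R_def using \<alpha> by real_asymp
    show "cmod (F (Complex (- R n) y)) \<le> 4 * exp (- (\<alpha> * R n)) + 4 / (cmod l * b) * exp (- R n)"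
      "cmod (F (Complex (R n) y)) \<le> 4 * exp (- (\<alpha> * R n)) + 4 / (cmod l * b) * exp (- R n)" for n y
      using left[of n y] right[of n y] b by (auto intro: add_increasing add_increasing2)
    show "- R n < R n" for n using R(3)[of n] by simp
    show "cbox (Complex (- R n) (- pi)) (Complex (R n) pi) \<subseteq> {z. \<bar>Im z\<bar> < D}" for n
      using D by (auto simp: in_cbox_complex_iff)
    show "{Ln l} \<subseteq> box (Complex (- R n) (- pi)) (Complex (R n) pi)" for n
      using R(2)[of n] abs_Im_Ln_slit[OF l] by (auto simp: in_box_complex_iff)
  qed (use holo line(1) open_strip convex_strip in auto)
  then have "2 * pi * \<i> / (l powr of_real \<alpha> + of_real b) =
      (LINT x|lborel. F (Complex x (- pi))) - (LINT x|lborel. F (Complex x pi))"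
    by (simp add: LIMSEQ_const_iff res)
  also have "\<dots> = (LINT x|lborel. F (Complex x (- pi)) - F (Complex x pi))"
    using line(1) by (subst Bochner_Integration.integral_diff) auto
  also have "(\<lambda>x. F (Complex x (- pi)) - F (Complex x pi)) =
     (\<lambda>x. 2 * \<i> * sin (pi * \<alpha>) * (of_real (exp x) / (of_real (exp x) + l) * bal_weight \<alpha> b (of_real (\<alpha> * x))))"
  proof
    fix x
    let ?A = "complex_of_real (exp (\<alpha> * x))" and ?c = "cis (pi * \<alpha>)" and ?d = "cis (- (pi * \<alpha>))"
    have ne: "?A * ?d + of_real b \<noteq> 0" "?A * ?c + of_real b \<noteq> 0"
      using ne2[of "Complex x (- pi)"] ne2[of "Complex x pi"] D
      by (simp_all add: exp_eq_polar mult.commute)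
    have cd: "?c * ?d = 1" by (simp add: cis_mult)
    have sum: "?c + ?d = of_real (2 * cos (pi * \<alpha>))" and diff: "?c - ?d = 2 * \<i> * sin (pi * \<alpha>)" by (simp_all add: complex_eq_iff)
    \<comment> \<open>The jump across the cut. The two denominators are complex conjugates, and
      their product is \<open>?A\<close> times the denominator of \<open>bal_weight\<close>.\<close>
    have "1 / (?A * ?d + of_real b) - 1 / (?A * ?c + of_real b) = ?A * (?c - ?d) / ((?A * ?d + of_real b) * (?A * ?c + of_real b))"
      using ne by (simp add: divide_simps) (simp add: algebra_simps)
    also have "(?A * ?d + of_real b) * (?A * ?c + of_real b) = ?A * ?A * (?c * ?d) + of_real b * ?A * (?c + ?d) + of_real b * of_real b"
      by (simp add: algebra_simps)
    also have "\<dots> = ?A * (?A + of_real (2 * b * cos (pi * \<alpha>)) + of_real (b\<^sup>2) * exp (- of_real (\<alpha> * x)))"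
      unfolding cd sum by (simp add: algebra_simps exp_of_real[symmetric] power2_eq_square exp_minus)
    also have "?A * (?c - ?d) / \<dots> = 2 * \<i> * sin (pi * \<alpha>) * bal_weight \<alpha> b (of_real (\<alpha> * x))"
      unfolding diff bal_weight_def using exp_of_real[of "\<alpha> * x", where 'a = complex] by simp
    finally have "1 / (?A * ?d + of_real b) - 1 / (?A * ?c + of_real b) = 2 * \<i> * sin (pi * \<alpha>) * bal_weight \<alpha> b (of_real (\<alpha> * x))" .
    moreover have "F (Complex x (- pi)) - F (Complex x pi) = of_real (exp x) / (of_real (exp x) + l) *
       (1 / (?A * ?d + of_real b) - 1 / (?A * ?c + of_real b))"
      using line(2)[of "- pi" x] line(2)[of pi x] by (simp add: mult.commute right_diff_distrib)
    ultimately show "F (Complex x (- pi)) - F (Complex x pi) =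
       2 * \<i> * sin (pi * \<alpha>) * (of_real (exp x) / (of_real (exp x) + l) * bal_weight \<alpha> b (of_real (\<alpha> * x)))"
      by simp
  qed
  also have "(LINT x|lborel. 2 * \<i> * sin (pi * \<alpha>) * (of_real (exp x) / (of_real (exp x) + l) * bal_weight \<alpha> b (of_real (\<alpha> * x))))
      = 2 * \<i> * sin (pi * \<alpha>) * (LINT x|lborel. of_real (exp x) / (of_real (exp x) + l) * bal_weight \<alpha> b (of_real (\<alpha> * x)))"
    by (rule Bochner_Integration.integral_mult_right_zero)
  \<comment> \<open>The substitution \<open>y = \<alpha> * x\<close> produces the
    \<open>1 / \<alpha>\<close> of the prefactor.\<close>
  also have "(LINT x|lborel. of_real (exp x) / (of_real (exp x) + l) * bal_weight \<alpha> b (of_real (\<alpha> * x)))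
     = (1 / \<alpha>) *\<^sub>R (LINT y|lborel. of_real (exp (y / \<alpha>)) / (of_real (exp (y / \<alpha>)) + l) * bal_weight \<alpha> b (of_real y))"
    using \<alpha> lborel_integral_real_affine[of \<alpha> "\<lambda>y. of_real (exp (y / \<alpha>)) / (of_real (exp (y / \<alpha>)) + l) * bal_weight \<alpha> b (of_real y)" 0]
    by simp
  finally have "2 * pi * \<i> * (1 / (l powr of_real \<alpha> + of_real b)) = 2 * pi * \<i> * (of_real (sin (pi * \<alpha>) / (\<alpha> * pi)) *
      (LINT y|lborel. of_real (exp (y / \<alpha>)) / (of_real (exp (y / \<alpha>)) + l) * bal_weight \<alpha> b (of_real y)))"
    using \<alpha> by (simp add: scaleR_conv_of_real mult_ac)
  then show ?thesis by (subst (asm) mult_left_cancel) auto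
qed

section \<open>Accretive operators on finite-dimensional function spaces\<close>

text \<open>Gaussian elimination by induction on the equations: a pivot unknown with nonzero
  coefficient in equation \<open>i\<close> is eliminated from the others.\<close>

lemma nontrivial_kernel_vector:
  fixes M :: "'k \<Rightarrow> 'i \<Rightarrow> 'c :: field"
  assumes "finite I" "finite K" "card I < card K"
  shows "\<exists>c. (\<exists>k\<in>K. c k \<noteq> 0) \<and> (\<forall>i\<in>I. (\<Sum>k\<in>K. c k * M k i) = 0)"
  using assms
proof (induction I arbitrary: K M rule: finite_induct)
  case empty
  then obtain k where "k \<in> K" by fastforce
  then show ?case by (intro exI[of _ "\<lambda>_. 1"]) auto
next
  case (insert i I)
  show ?case
  proof (cases "\<forall>k\<in>K. M k i = 0")
    case True
    then show ?thesis using insert.IH[of K M] insert by (auto simp: card_insert_if)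
  next
    case False
    then obtain k0 where k0: "k0 \<in> K" "M k0 i \<noteq> 0" by blast
    let ?r = "\<lambda>k. M k i / M k0 i"
    have "card I < card (K - {k0})" using insert k0 by (simp add: card_Diff_singleton)
    then have "\<exists>c. (\<exists>k\<in>K - {k0}. c k \<noteq> 0) \<and> (\<forall>j\<in>I. (\<Sum>k\<in>K - {k0}. c k * (M k j - ?r k * M k0 j)) = 0)"
      by (intro insert.IH) (use insert.prems in auto)
    then obtain c where c: "\<exists>k\<in>K - {k0}. c k \<noteq> 0"
      "\<And>j. j \<in> I \<Longrightarrow> (\<Sum>k\<in>K - {k0}. c k * (M k j - ?r k * M k0 j)) = 0"
      by blast
    \<comment> \<open>The pivot unknown is determined by equation \<open>i\<close>.\<close>
    let ?c = "c(k0 := - (\<Sum>k\<in>K - {k0}. c k * ?r k))"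
    have "(\<Sum>k\<in>K. ?c k * M k j) = (\<Sum>k\<in>K - {k0}. c k * (M k j - ?r k * M k0 j))" for j
      using insert k0 by (simp add: sum.remove[of K k0] sum_distrib_left sum_distrib_right sum_subtractf algebra_simps)
    then have "\<forall>j\<in>insert i I. (\<Sum>k\<in>K. ?c k * M k j) = 0" using c(2) k0 by simp
    moreover have "\<exists>k\<in>K. ?c k \<noteq> 0" using c(1) by auto
    ultimately show ?thesis by blast
  qed
qed

text \<open>Subspaces are sets and not types, since the finite element space depends on the domain
  and the mesh, which are variables of the final statement.\<close>

locale function_subspace =
  fixes W :: "('a \<Rightarrow> complex) set"
  assumes zero_mem: "(\<lambda>x. 0) \<in> W"
    and lincomb_mem: "\<And>u v a b. u \<in> W \<Longrightarrow> v \<in> W \<Longrightarrow> (\<lambda>x. a * u x + b * v x) \<in> W"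
begin

lemma add_mem: "u \<in> W \<Longrightarrow> v \<in> W \<Longrightarrow> (\<lambda>x. u x + v x) \<in> W"
  using lincomb_mem[of u v 1 1] by simp

lemma diff_mem: "u \<in> W \<Longrightarrow> v \<in> W \<Longrightarrow> (\<lambda>x. u x - v x) \<in> W"
  using lincomb_mem[of u v 1 "- 1"] by simp

lemma scale_mem: "u \<in> W \<Longrightarrow> (\<lambda>x. c * u x) \<in> W"
  using lincomb_mem[of u u c 0] by simp

lemma sum_mem: "finite K \<Longrightarrow> (\<And>k. k \<in> K \<Longrightarrow> u k \<in> W) \<Longrightarrow> (\<lambda>x. \<Sum>k\<in>K. c k * u k x) \<in> W"
  by (induction K rule: finite_induct) (auto intro!: zero_mem add_mem scale_mem)

end

text \<open>Positivity on all nonzero functions fails on \<open>V_space\<close>, where functions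
  equal almost everywhere are not identified; continuity and extension by zero provide it on the
  finite element space.\<close>

locale inner_product_functions = function_subspace +
  fixes ip :: "('a \<Rightarrow> complex) \<Rightarrow> ('a \<Rightarrow> complex) \<Rightarrow> complex"
  assumes ip_lincomb: "\<And>u v w a b. u \<in> W \<Longrightarrow> v \<in> W \<Longrightarrow> w \<in> W \<Longrightarrow>
      ip (\<lambda>x. a * u x + b * v x) w = a * ip u w + b * ip v w"
    and ip_cnj: "\<And>u v. u \<in> W \<Longrightarrow> v \<in> W \<Longrightarrow> ip v u = cnj (ip u v)"
    and ip_pos: "\<And>u. u \<in> W \<Longrightarrow> u \<noteq> (\<lambda>x. 0) \<Longrightarrow> 0 < Re (ip u u)"
begin

lemma ip_add: "u \<in> W \<Longrightarrow> v \<in> W \<Longrightarrow> w \<in> W \<Longrightarrow> ip (\<lambda>x. u x + v x) w = ip u w + ip v w"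
  using ip_lincomb[of u v w 1 1] by simp

lemma ip_diff: "u \<in> W \<Longrightarrow> v \<in> W \<Longrightarrow> w \<in> W \<Longrightarrow> ip (\<lambda>x. u x - v x) w = ip u w - ip v w"
  using ip_lincomb[of u v w 1 "- 1"] by simp

lemma ip_scale: "u \<in> W \<Longrightarrow> w \<in> W \<Longrightarrow> ip (\<lambda>x. c * u x) w = c * ip u w"
  using ip_lincomb[of u u w c 0] by simp

lemma ip_zero: "w \<in> W \<Longrightarrow> ip (\<lambda>x. 0) w = 0"
  using ip_scale[of w w 0] by simp

lemma ip_lincomb_right:
  "u \<in> W \<Longrightarrow> v \<in> W \<Longrightarrow> w \<in> W \<Longrightarrow> ip w (\<lambda>x. a * u x + b * v x) = cnj a * ip w u + cnj b * ip w v"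
  using ip_cnj[of "\<lambda>x. a * u x + b * v x" w] ip_lincomb[of u v w a b] ip_cnj[of u w] ip_cnj[of v w]
    lincomb_mem[of u v a b] by simp

lemma ip_sum: "finite K \<Longrightarrow> (\<And>k. k \<in> K \<Longrightarrow> u k \<in> W) \<Longrightarrow> w \<in> W \<Longrightarrow>
    ip (\<lambda>x. \<Sum>k\<in>K. c k * u k x) w = (\<Sum>k\<in>K. c k * ip (u k) w)"
  by (induction K rule: finite_induct) (auto simp: ip_zero ip_add ip_scale scale_mem sum_mem)

lemma ip_self_real: "u \<in> W \<Longrightarrow> ip u u = of_real (Re (ip u u))"
  using ip_cnj[of u u] by (simp add: complex_eq_iff)

lemma ip_self_nonneg: "u \<in> W \<Longrightarrow> 0 \<le> Re (ip u u)"
  using ip_pos[of u] by (cases "u = (\<lambda>x. 0)") (auto simp: ip_zero zero_mem)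

definition nrm :: "('a \<Rightarrow> complex) \<Rightarrow> real" where
  "nrm u = sqrt (Re (ip u u))"

lemma nrm_power2: "u \<in> W \<Longrightarrow> (nrm u)\<^sup>2 = Re (ip u u)"
  by (simp add: nrm_def ip_self_nonneg)

lemma ip_self: "u \<in> W \<Longrightarrow> ip u u = of_real ((nrm u)\<^sup>2)"
  by (simp add: nrm_power2 ip_self_real[symmetric] del: of_real_power)

lemma nrm_nonneg: "u \<in> W \<Longrightarrow> 0 \<le> nrm u"
  by (simp add: nrm_def ip_self_nonneg)

lemma Cauchy_Schwarz:
  assumes "u \<in> W" "v \<in> W"
  shows "cmod (ip u v) \<le> nrm u * nrm v"
proof (cases "v = (\<lambda>x. 0)")
  case True
  have "ip u v = 0" using ip_cnj[of v u] True ip_zero[of u] assms by simp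
  then show ?thesis using assms nrm_nonneg by simp
next
  case False
  define p where "p = Re (ip v v)"
  have p: "0 < p" "ip v v = of_real p" using ip_pos[OF assms(2) False] ip_self_real[OF assms(2)] by (auto simp: p_def)
  let ?t = "ip u v / p"
  let ?w = "\<lambda>x. 1 * u x + (- ?t) * v x"
  have w: "?w \<in> W" using assms by (intro lincomb_mem)
  have "ip ?w v = 0" using assms p by (subst ip_lincomb) auto
  then have "ip v ?w = 0" using ip_cnj[of ?w v] w assms by simp
  moreover have "ip ?w ?w = ip u ?w - ?t * ip v ?w" using assms w by (subst ip_lincomb) auto
  moreover have "ip u ?w = ip u u - cnj ?t * ip u v" using assms by (subst ip_lincomb_right) auto
  moreover have "cnj ?t * ip u v = of_real ((cmod (ip u v))\<^sup>2 / p)"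
    unfolding of_real_divide complex_norm_square by simp
  ultimately have "ip ?w ?w = ip u u - of_real ((cmod (ip u v))\<^sup>2 / p)"
    by (simp only: mult_zero_right diff_zero)
  then have "0 \<le> Re (ip u u) - (cmod (ip u v))\<^sup>2 / p" using ip_self_nonneg[OF w] by simp
  then have "(cmod (ip u v))\<^sup>2 \<le> (nrm u * nrm v)\<^sup>2"
    using p assms by (simp add: power_mult_distrib nrm_power2 p_def[symmetric] field_simps)
  then show ?thesis by (rule power2_le_imp_le) (simp add: assms nrm_nonneg)
qed

lemma ip_eq_imp_eq:
  assumes "u \<in> W" "v \<in> W" "\<And>w. w \<in> W \<Longrightarrow> ip u w = ip v w"
  shows "u = v"
proof -
  let ?d = "\<lambda>x. u x - v x"
  have d: "?d \<in> W" using assms by (intro diff_mem)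
  have "ip ?d ?d = 0" using assms d by (simp add: ip_diff)
  then have "?d = (\<lambda>x. 0)" using ip_pos[OF d] by force
  then show ?thesis by (auto simp: fun_eq_iff)
qed

end

text \<open>Induction on the spanning functions. They may lie outside \<open>X\<close>, so the
  smaller space \<open>Y\<close> is cut out of \<open>X\<close> by dropping \<open>e i\<close>. The
  induction hypothesis is used twice, for \<open>\<phi>\<close> and for the functional
  \<open>ip w\<close>; the second use supplies a direction orthogonal to \<open>Y\<close>.\<close>

lemma (in inner_product_functions) Riesz_representation_aux:
  assumes "finite I"
  shows "X \<subseteq> W \<Longrightarrow> function_subspace X \<Longrightarrow> (\<And>v. v \<in> X \<Longrightarrow> \<exists>c. v = (\<lambda>x. \<Sum>i\<in>I. c i * e i x)) \<Longrightarrow>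
     (\<And>u v a b. u \<in> X \<Longrightarrow> v \<in> X \<Longrightarrow> \<phi> (\<lambda>x. a * u x + b * v x) = cnj a * \<phi> u + cnj b * \<phi> v) \<Longrightarrow>
     \<exists>u\<in>X. \<forall>v\<in>X. ip u v = \<phi> v"
  using assms
proof (induction I arbitrary: X \<phi> rule: finite_induct)
  case (empty X \<phi>)
  interpret X: function_subspace X by (rule empty.prems(2))
  have "v = (\<lambda>x. 0)" if "v \<in> X" for v using empty(3)[OF that] by auto
  moreover have "\<phi> (\<lambda>x. 0) = 0" using empty(4)[OF X.zero_mem X.zero_mem, of 0 0] by simp
  ultimately have "ip (\<lambda>x. 0) v = \<phi> v" if "v \<in> X" for v using that ip_zero[OF zero_mem] by metis
  then show ?case using X.zero_mem by blast
next
  case (insert i I X \<phi>)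
  interpret X: function_subspace X by (rule insert.prems(2))
  define Y where "Y = {v \<in> X. \<exists>c. v = (\<lambda>x. \<Sum>j\<in>I. c j * e j x)}"
  have Y: "function_subspace Y"
  proof
    show "(\<lambda>x. 0) \<in> Y" using X.zero_mem by (auto simp: Y_def intro!: exI[of _ "\<lambda>_. 0"])
    show "(\<lambda>x. a * u x + b * v x) \<in> Y" if "u \<in> Y" "v \<in> Y" for u v a b
    proof -
      from that obtain c d where cd: "u = (\<lambda>x. \<Sum>j\<in>I. c j * e j x)" "v = (\<lambda>x. \<Sum>j\<in>I. d j * e j x)" by (auto simp: Y_def)
      have "(\<lambda>x. a * u x + b * v x) = (\<lambda>x. \<Sum>j\<in>I. (a * c j + b * d j) * e j x)"
        unfolding cd by (simp only: sum_distrib_left sum.distrib distrib_right mult.assoc)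
      then show ?thesis using that X.lincomb_mem[of u v a b] by (auto simp: Y_def intro!: exI[of _ "\<lambda>j. a * c j + b * d j"])
    qed
  qed
  interpret Y: function_subspace Y by (rule Y)
  have YX: "Y \<subseteq> X" by (auto simp: Y_def)
  have repr: "\<exists>u\<in>Y. \<forall>v\<in>Y. ip u v = \<psi> v"
    if "\<And>u v a b. u \<in> Y \<Longrightarrow> v \<in> Y \<Longrightarrow> \<psi> (\<lambda>x. a * u x + b * v x) = cnj a * \<psi> u + cnj b * \<psi> v" for \<psi>
    using insert.prems(1) YX Y that by (intro insert.IH) (auto simp: Y_def)
  have "\<exists>u\<in>Y. \<forall>v\<in>Y. ip u v = \<phi> v"
    using YX by (intro repr insert.prems(4)) auto
  then obtain u where u: "u \<in> Y" "\<And>v. v \<in> Y \<Longrightarrow> ip u v = \<phi> v" by blast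
  show ?case
  proof (cases "X \<subseteq> Y")
    case True
    then show ?thesis using u YX by auto
  next
    case False
    then obtain w where w: "w \<in> X" "w \<notin> Y" by auto
    obtain c where c: "w = (\<lambda>x. \<Sum>j\<in>insert i I. c j * e j x)" using insert.prems(3)[OF w(1)] by auto
    have ci: "c i \<noteq> 0"
    proof
      assume "c i = 0"
      then have "w \<in> Y" using w(1) c insert.hyps by (auto simp: Y_def)
      then show False using w by simp
    qed
    have wW: "w \<in> W" using w insert.prems(1) by auto
    \<comment> \<open>The representer of \<open>ip w\<close> on \<open>Y\<close> is the orthogonal
      projection of \<open>w\<close>.\<close>
    have "\<exists>p\<in>Y. \<forall>v\<in>Y. ip p v = ip w v"
      using wW insert.prems(1) YX by (intro repr ip_lincomb_right) auto
    then obtain p where p: "p \<in> Y" "\<And>v. v \<in> Y \<Longrightarrow> ip p v = ip w v" by blast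
    define q where "q = (\<lambda>x. w x - p x)"
    have q: "q \<in> X" "q \<in> W" unfolding q_def using X.diff_mem[OF w(1)] p(1) YX insert.prems(1) by auto
    have "q \<noteq> (\<lambda>x. 0)"
    proof
      assume "q = (\<lambda>x. 0)"
      then have "w = p" unfolding q_def by (metis (no_types) eq_iff_diff_eq_0 ext)
      then show False using w p by simp
    qed
    then have qq: "ip q q \<noteq> 0" using ip_pos[OF q(2)] by force
    have orth: "ip q v = 0" if "v \<in> Y" for v
      using that p wW YX insert.prems(1) unfolding q_def by (subst ip_diff) auto
    have decomp: "\<exists>t. \<exists>v'\<in>Y. v = (\<lambda>x. 1 * v' x + t * q x)" if v: "v \<in> X" for v
    proof -
      obtain d where d: "v = (\<lambda>x. \<Sum>j\<in>insert i I. d j * e j x)" using insert.prems(3)[OF v] by auto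
      \<comment> \<open>Chosen to cancel the component of \<open>v\<close> along \<open>e i\<close>,
        so that \<open>v - t * w\<close> falls into \<open>Y\<close>.\<close>
      define t where "t = d i / c i"
      have "(\<lambda>x. v x - t * w x) = (\<lambda>x. \<Sum>j\<in>insert i I. (d j - t * c j) * e j x)"
        unfolding c d by (simp only: sum_distrib_left sum_subtractf left_diff_distrib mult.assoc)
      also have "\<dots> = (\<lambda>x. \<Sum>j\<in>I. (d j - t * c j) * e j x)"
        using ci insert.hyps by (simp add: t_def)
      finally have "(\<lambda>x. v x - t * w x) = (\<lambda>x. \<Sum>j\<in>I. (d j - t * c j) * e j x)" .
      moreover have "(\<lambda>x. v x - t * w x) \<in> X" using v w by (intro X.diff_mem X.scale_mem)
      ultimately have "(\<lambda>x. v x - t * w x) \<in> Y" by (auto simp: Y_def intro!: exI[of _ "\<lambda>j. d j - t * c j"])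
      then have "(\<lambda>x. 1 * (v x - t * w x) + t * p x) \<in> Y" using p by (intro Y.lincomb_mem)
      then show ?thesis by (intro exI[of _ t] bexI[rotated]) (auto simp: q_def algebra_simps)
    qed
    \<comment> \<open>A multiple of \<open>q\<close> leaves the values on \<open>Y\<close> unchanged
      and corrects the value at \<open>q\<close>.\<close>
    let ?u = "\<lambda>x. 1 * u x + \<phi> q / ip q q * q x"
    have "ip ?u v = \<phi> v" if v: "v \<in> X" for v
    proof -
      obtain t v' where t: "v' \<in> Y" "v = (\<lambda>x. 1 * v' x + t * q x)" using decomp[OF v] by blast
      have mem: "v' \<in> W" "u \<in> W" "v' \<in> X" using t u YX insert.prems(1) by auto
      have uq: "ip u q = 0" using orth[OF u(1)] ip_cnj[of q u] q mem by simp
      have "ip ?u v = ip u v + \<phi> q / ip q q * ip q v" using mem q v insert.prems(1) by (subst ip_lincomb) auto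
      also have "ip u v = ip u v'" unfolding t(2) using mem q uq by (subst ip_lincomb_right) auto
      also have "ip q v = cnj t * ip q q" unfolding t(2) using mem q orth[OF t(1)] by (subst ip_lincomb_right) auto
      also have "ip u v' + \<phi> q / ip q q * (cnj t * ip q q) = \<phi> v"
        unfolding t(2) using u(2)[OF t(1)] qq insert.prems(4)[OF mem(3) q(1), of 1 t] by simp
      finally show ?thesis .
    qed
    moreover have "?u \<in> X" using u q YX by (intro X.lincomb_mem) auto
    ultimately show ?thesis by blast
  qed
qed

text \<open>The \<open>e i\<close> span \<open>W\<close> from outside if necessary: for finite
  elements they will be affine functions cut off to pieces of the domain, which are in general
  discontinuous.\<close>

locale finite_dim_inner_product = inner_product_functions +
  fixes I :: "'i set" and e :: "'i \<Rightarrow> 'a \<Rightarrow> complex"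
  assumes finite_I: "finite I"
    and spanned: "\<And>v. v \<in> W \<Longrightarrow> \<exists>c. v = (\<lambda>x. \<Sum>i\<in>I. c i * e i x)"
begin

lemma Riesz_representation:
  assumes "\<And>u v a b. u \<in> W \<Longrightarrow> v \<in> W \<Longrightarrow> \<phi> (\<lambda>x. a * u x + b * v x) = cnj a * \<phi> u + cnj b * \<phi> v"
  shows "\<exists>!u. u \<in> W \<and> (\<forall>v\<in>W. ip u v = \<phi> v)"
proof -
  have "\<exists>u\<in>W. \<forall>v\<in>W. ip u v = \<phi> v"
    by (rule Riesz_representation_aux[OF finite_I order_refl function_subspace_axioms spanned assms])
  then show ?thesis using ip_eq_imp_eq by metis
qed

lemma linear_dependence:
  assumes "finite K" "card I < card K" "\<And>k. k \<in> K \<Longrightarrow> u k \<in> W"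
  obtains c where "\<exists>k\<in>K. c k \<noteq> 0" "\<And>x. (\<Sum>k\<in>K. c k * u k x) = 0"
proof -
  have "\<forall>k\<in>K. \<exists>m. u k = (\<lambda>x. \<Sum>i\<in>I. m i * e i x)" using assms(3) spanned by blast
  from bchoice[OF this] obtain M where M: "\<And>k. k \<in> K \<Longrightarrow> u k = (\<lambda>x. \<Sum>i\<in>I. M k i * e i x)" by blast
  from nontrivial_kernel_vector[OF finite_I assms(1,2), of M]
  obtain c where c: "\<exists>k\<in>K. c k \<noteq> 0" "\<And>i. i \<in> I \<Longrightarrow> (\<Sum>k\<in>K. c k * M k i) = 0" by blast
  have "(\<Sum>k\<in>K. c k * u k x) = 0" for x
  proof -
    have "(\<Sum>k\<in>K. c k * u k x) = (\<Sum>k\<in>K. \<Sum>i\<in>I. c k * M k i * e i x)"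
      by (simp add: M sum_distrib_left mult.assoc)
    also have "\<dots> = (\<Sum>i\<in>I. (\<Sum>k\<in>K. c k * M k i) * e i x)"
      by (subst sum.swap) (simp add: sum_distrib_right)
    finally show ?thesis using c(2) by simp
  qed
  then show ?thesis using c(1) that by blast
qed

end

section \<open>Eigenvalues, annihilating chains and the resolvent\<close>

text \<open>\<open>c0\<close> enters through its sign only and appears in no bound; the quantitative
  information is the half-angle \<open>arctan \<beta>\<close> of the sector that contains the
  numerical range.\<close>

locale accretive_operator = finite_dim_inner_product W ip I e
  for W :: "('a \<Rightarrow> complex) set" and ip and I :: "'i set" and e :: "'i \<Rightarrow> 'a \<Rightarrow> complex" +
  fixes B :: "('a \<Rightarrow> complex) \<Rightarrow> 'a \<Rightarrow> complex" and \<beta> c0 :: real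
  assumes B_mem: "\<And>v. v \<in> W \<Longrightarrow> B v \<in> W"
    and B_lincomb: "\<And>u v a b. u \<in> W \<Longrightarrow> v \<in> W \<Longrightarrow> B (\<lambda>x. a * u x + b * v x) = (\<lambda>x. a * B u x + b * B v x)"
    and c0_pos: "0 < c0" and coercive: "\<And>v. v \<in> W \<Longrightarrow> c0 * Re (ip v v) \<le> Re (ip (B v) v)"
    and \<beta>_nonneg: "0 \<le> \<beta>"
    and sectorial: "\<And>v. v \<in> W \<Longrightarrow> \<bar>Im (ip (B v) v)\<bar> \<le> \<beta> * Re (ip (B v) v)"
begin

definition shift :: "complex \<Rightarrow> ('a \<Rightarrow> complex) \<Rightarrow> 'a \<Rightarrow> complex" where
  "shift l v = (\<lambda>x. B v x - l * v x)"

text \<open>The product of the operators \<open>B - l\<close>, over the \<open>l\<close> in the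
  list, applied to \<open>v\<close>. A list of eigenvalues with \<open>chain L v\<close> equal to
  zero replaces a Jordan decomposition, one vector at a time; repetitions encode
  multiplicity.\<close>

primrec chain :: "complex list \<Rightarrow> ('a \<Rightarrow> complex) \<Rightarrow> 'a \<Rightarrow> complex" where
  "chain [] v = v"
| "chain (l # L) v = chain L (shift l v)"

definition eigenvalues :: "complex set" where
  "eigenvalues = {l. \<exists>v\<in>W. v \<noteq> (\<lambda>x. 0) \<and> B v = (\<lambda>x. l * v x)}"

lemma B_add: "u \<in> W \<Longrightarrow> v \<in> W \<Longrightarrow> B (\<lambda>x. u x + v x) = (\<lambda>x. B u x + B v x)"
  using B_lincomb[of u v 1 1] by simp

lemma B_scale: "u \<in> W \<Longrightarrow> B (\<lambda>x. c * u x) = (\<lambda>x. c * B u x)"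
  using B_lincomb[of u u c 0] by simp

lemma B_zero: "B (\<lambda>x. 0) = (\<lambda>x. 0)"
  using B_scale[OF zero_mem, of 0] by simp

lemma shift_mem: "v \<in> W \<Longrightarrow> shift l v \<in> W"
  unfolding shift_def by (intro diff_mem B_mem scale_mem)

lemma chain_mem: "v \<in> W \<Longrightarrow> chain L v \<in> W"
  by (induction L arbitrary: v) (auto simp: shift_mem)

lemma shift_apply: "shift l v x = B v x - l * v x"
  by (simp add: shift_def)

lemma shift_eq_0_imp: "v \<in> W \<Longrightarrow> l \<notin> eigenvalues \<Longrightarrow> shift l v = (\<lambda>x. 0) \<Longrightarrow> v = (\<lambda>x. 0)"
  by (auto simp: eigenvalues_def shift_def fun_eq_iff)

lemma B_sum: "finite K \<Longrightarrow> (\<And>k. k \<in> K \<Longrightarrow> u k \<in> W) \<Longrightarrow>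
    B (\<lambda>x. \<Sum>k\<in>K. c k * u k x) = (\<lambda>x. \<Sum>k\<in>K. c k * B (u k) x)"
  by (induction K rule: finite_induct) (auto simp: B_zero B_add B_scale scale_mem sum_mem)

lemma eigenvalue_sector:
  assumes "l \<in> eigenvalues"
  shows "0 < Re l" "\<bar>Im l\<bar> \<le> \<beta> * Re l"
proof -
  obtain v where v: "v \<in> W" "v \<noteq> (\<lambda>x. 0)" "B v = (\<lambda>x. l * v x)" using assms by (auto simp: eigenvalues_def)
  have "ip (B v) v = l * of_real (Re (ip v v))" unfolding v(3) ip_self_real[OF v(1), symmetric] using v by (simp add: ip_scale)
  then have eq: "Re (ip (B v) v) = Re l * Re (ip v v)" "Im (ip (B v) v) = Im l * Re (ip v v)" by simp_all
  have pos: "0 < Re (ip v v)" by (rule ip_pos[OF v(1,2)])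
  have "0 < c0 * Re (ip v v)" using pos c0_pos by simp
  also have "\<dots> \<le> Re l * Re (ip v v)" using coercive[OF v(1)] eq by simp
  finally show "0 < Re l" using pos by (simp add: zero_less_mult_iff)
  have "\<bar>Im l\<bar> * Re (ip v v) \<le> (\<beta> * Re l) * Re (ip v v)" using sectorial[OF v(1)] eq pos by (simp add: abs_mult)
  then show "\<bar>Im l\<bar> \<le> \<beta> * Re l" using pos by simp
qed

lemma eigenvalue_not_nonpos: "l \<in> eigenvalues \<Longrightarrow> l \<notin> \<real>\<^sub>\<le>\<^sub>0"
  using eigenvalue_sector(1)[of l] by (auto simp: complex_nonpos_Reals_iff)

text \<open>Applying \<open>B - m\<close> removes the term of \<open>m\<close> and multiplies the
  others by \<open>l - m\<close>, which is nonzero.\<close>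

lemma eigenvectors_independent:
  assumes "finite \<Lambda>" "\<And>l. l \<in> \<Lambda> \<Longrightarrow> v l \<in> W" "\<And>l. l \<in> \<Lambda> \<Longrightarrow> B (v l) = (\<lambda>x. l * v l x)"
    "\<And>x. (\<Sum>l\<in>\<Lambda>. c l * v l x) = 0" "l \<in> \<Lambda>"
  shows "c l * v l x = 0"
  using assms
proof (induction \<Lambda> arbitrary: c l x rule: finite_induct)
  case (insert m \<Lambda> c l x)
  have "B (\<lambda>x. \<Sum>l\<in>insert m \<Lambda>. c l * v l x) = (\<lambda>x. \<Sum>l\<in>insert m \<Lambda>. c l * B (v l) x)"
    using insert by (intro B_sum) auto
  then have "(\<Sum>l\<in>insert m \<Lambda>. c l * (l * v l x)) = 0" for x
    using insert.prems(2,3) B_zero by (simp add: fun_eq_iff)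
  then have "(\<Sum>l\<in>insert m \<Lambda>. c l * (l * v l x)) - m * (\<Sum>l\<in>insert m \<Lambda>. c l * v l x) = 0" for x
    using insert.prems(3) by simp
  then have "(\<Sum>l\<in>\<Lambda>. (c l * (l - m)) * v l x) = 0" for x
    unfolding sum_distrib_left sum_subtractf[symmetric] using insert.hyps by (simp add: algebra_simps)
  then have "(c l * (l - m)) * v l x = 0" if "l \<in> \<Lambda>" for l x
    using insert.IH[of "\<lambda>l. c l * (l - m)" l x] that insert.prems by auto
  then have 0: "c l * v l x = 0" if "l \<in> \<Lambda>" for l x using that insert.hyps by force
  then have "(\<Sum>l\<in>\<Lambda>. c l * v l x) = 0" for x by (intro sum.neutral) auto
  then have "c m * v m x = 0" for x using insert.prems(3)[of x] insert.hyps by simp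
  then show ?case using 0 insert.prems(4) by blast
qed simp

lemma finite_eigenvalues: "finite eigenvalues"
proof (rule ccontr)
  assume "infinite eigenvalues"
  then obtain \<Lambda> where \<Lambda>: "\<Lambda> \<subseteq> eigenvalues" "finite \<Lambda>" "card \<Lambda> = Suc (card I)"
    using infinite_arbitrarily_large by blast
  have "\<forall>l\<in>\<Lambda>. \<exists>v. v \<in> W \<and> v \<noteq> (\<lambda>x. 0) \<and> B v = (\<lambda>x. l * v x)"
    using \<Lambda>(1) by (auto simp: eigenvalues_def)
  from bchoice[OF this] obtain v
    where v: "\<And>l. l \<in> \<Lambda> \<Longrightarrow> v l \<in> W \<and> v l \<noteq> (\<lambda>x. 0) \<and> B (v l) = (\<lambda>x. l * v l x)" by blast
  obtain c where c: "\<exists>l\<in>\<Lambda>. c l \<noteq> 0" "\<And>x. (\<Sum>l\<in>\<Lambda>. c l * v l x) = 0"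
    using linear_dependence[of \<Lambda> v] \<Lambda> v by auto
  then obtain l where l: "l \<in> \<Lambda>" "c l \<noteq> 0" by blast
  have "c l * v l x = 0" for x
    by (rule eigenvectors_independent[where v = v and c = c, OF \<Lambda>(2) _ _ c(2) l(1)]) (use v in auto)
  then show False using l v[OF l(1)] by (auto simp: fun_eq_iff)
qed

definition poly_action :: "complex poly \<Rightarrow> ('a \<Rightarrow> complex) \<Rightarrow> 'a \<Rightarrow> complex" where
  "poly_action p v = (\<lambda>x. \<Sum>i\<le>degree p. coeff p i * (B ^^ i) v x)"

lemma Bpow_mem: "v \<in> W \<Longrightarrow> (B ^^ i) v \<in> W"
  by (induction i) (auto simp: B_mem)

lemma poly_action_mem: "v \<in> W \<Longrightarrow> poly_action p v \<in> W"
  unfolding poly_action_def by (intro sum_mem) (auto simp: Bpow_mem)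

lemma poly_action_bound: "degree p \<le> n \<Longrightarrow> poly_action p v x = (\<Sum>i\<le>n. coeff p i * (B ^^ i) v x)"
  unfolding poly_action_def by (intro sum.mono_neutral_left) (auto simp: coeff_eq_0)

lemma Bpow_shift: "v \<in> W \<Longrightarrow> (B ^^ i) (shift l v) = (\<lambda>x. (B ^^ Suc i) v x - l * (B ^^ i) v x)"
proof (induction i)
  case (Suc i)
  have "(B ^^ Suc i) (shift l v) = B (\<lambda>x. 1 * (B ^^ Suc i) v x + (- l) * (B ^^ i) v x)" using Suc by simp
  then show ?case using Suc(2) by (subst (asm) B_lincomb) (auto intro: Bpow_mem[of v "Suc i", simplified] Bpow_mem)
qed (simp add: shift_def)

lemma shift_poly_action: "v \<in> W \<Longrightarrow> shift l (poly_action p v) = poly_action p (shift l v)"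
proof -
  assume v: "v \<in> W"
  have "B (poly_action p v) = (\<lambda>x. \<Sum>i\<le>degree p. coeff p i * B ((B ^^ i) v) x)"
    unfolding poly_action_def using v by (intro B_sum) (auto simp: Bpow_mem)
  then show ?thesis
    unfolding poly_action_def[of p "shift l v"] Bpow_shift[OF v]
    by (simp add: shift_def poly_action_def sum_distrib_left sum_subtractf algebra_simps)
qed

lemma poly_action_factor:
  assumes "v \<in> W"
  shows "poly_action ([:- l, 1:] * q) v = poly_action q (shift l v)"
proof
  fix x
  let ?n = "degree q"
  have "[:- l, 1:] * q = pCons 0 q - smult l q" by simp
  moreover have "degree ([:- l, 1:] * q) \<le> Suc ?n" using degree_mult_le[of "[:- l, 1:]" q] by simp
  ultimately have "poly_action ([:- l, 1:] * q) v x = (\<Sum>i\<le>Suc ?n. (coeff (pCons 0 q) i - l * coeff q i) * (B ^^ i) v x)"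
    by (simp add: poly_action_bound)
  also have "\<dots> = (\<Sum>i\<le>Suc ?n. coeff (pCons 0 q) i * (B ^^ i) v x) - l * (\<Sum>i\<le>Suc ?n. coeff q i * (B ^^ i) v x)"
    by (simp only: left_diff_distrib sum_subtractf sum_distrib_left mult.assoc)
  also have "(\<Sum>i\<le>Suc ?n. coeff (pCons 0 q) i * (B ^^ i) v x) = (\<Sum>i\<le>?n. coeff q i * (B ^^ Suc i) v x)"
    by (subst sum.atMost_Suc_shift) simp
  also have "(\<Sum>i\<le>Suc ?n. coeff q i * (B ^^ i) v x) = (\<Sum>i\<le>?n. coeff q i * (B ^^ i) v x)"
    by (simp add: coeff_eq_0)
  also have "(\<Sum>i\<le>?n. coeff q i * (B ^^ Suc i) v x) - l * (\<Sum>i\<le>?n. coeff q i * (B ^^ i) v x) = poly_action q (shift l v) x"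
    unfolding poly_action_def Bpow_shift[OF assms] by (simp add: sum_distrib_left sum_subtractf algebra_simps)
  finally show "poly_action ([:- l, 1:] * q) v x = poly_action q (shift l v) x" .
qed

text \<open>The \<open>card I + 1\<close> iterates of \<open>B\<close> on \<open>v\<close> are
  linearly dependent.\<close>

lemma annihilating_poly:
  assumes "v \<in> W"
  obtains p where "p \<noteq> 0" "poly_action p v = (\<lambda>x. 0)"
proof -
  let ?n = "card I"
  obtain c where c: "\<exists>k\<in>{..?n}. c k \<noteq> 0" "\<And>x. (\<Sum>k\<le>?n. c k * (B ^^ k) v x) = 0"
    using linear_dependence[of "{..?n}" "\<lambda>k. (B ^^ k) v"] Bpow_mem[OF assms] by auto
  define p where "p = (\<Sum>k\<le>?n. monom (c k) k)"
  have co: "coeff p i = (if i \<le> ?n then c i else 0)" for i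
    by (simp add: p_def coeff_sum)
  have "degree p \<le> ?n" by (rule degree_le) (simp add: co)
  then have "poly_action p v x = 0" for x using c(2)[of x] by (simp add: poly_action_bound co)
  moreover have "p \<noteq> 0" using c(1) co by (metis atMost_iff coeff_0)
  ultimately show ?thesis using that by blast
qed

text \<open>Split off a root \<open>l\<close> of the polynomial. If it is an eigenvalue, it joins
  the list; otherwise \<open>B - l\<close> is injective and commutes with the remaining factor,
  which therefore annihilates \<open>v\<close> already. Keeping only eigenvalues makes the chain
  usable at every point of the resolvent set.\<close>

lemma chain_of_poly:
  assumes "p \<noteq> 0" "v \<in> W" "poly_action p v = (\<lambda>x. 0)"
  shows "\<exists>L. set L \<subseteq> eigenvalues \<and> chain L v = (\<lambda>x. 0)"
  using assms
proof (induction "degree p" arbitrary: p v rule: less_induct)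
  case less
  show ?case
  proof (cases "degree p = 0")
    case True
    then obtain a where "p = [:a:]" by (metis degree_eq_zeroE)
    then have "v = (\<lambda>x. 0)" using less.prems by (auto simp: poly_action_def fun_eq_iff)
    then show ?thesis by (intro exI[of _ "[]"]) auto
  next
    case False
    then obtain l where "poly p l = 0"
      using fundamental_theorem_of_algebra[of p] by (auto simp: constant_degree)
    then obtain q where q: "p = [:- l, 1:] * q" by (metis dvdE poly_eq_0_iff_dvd)
    have q0: "q \<noteq> 0" using less.prems q by auto
    have deg: "degree q < degree p" unfolding q using q0 by (subst degree_mult_eq) auto
    have 0: "poly_action q (shift l v) = (\<lambda>x. 0)" using less.prems poly_action_factor[of v l q] q by simp
    show ?thesis
    proof (cases "l \<in> eigenvalues")
      case True
      obtain L where "set L \<subseteq> eigenvalues" "chain L (shift l v) = (\<lambda>x. 0)"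
        using less.hyps[OF deg q0 shift_mem[OF less.prems(2)] 0] by blast
      then show ?thesis using True by (intro exI[of _ "l # L"]) auto
    next
      case False
      have "poly_action q v = (\<lambda>x. 0)"
        using shift_eq_0_imp[OF poly_action_mem[OF less.prems(2)] False] 0 shift_poly_action[OF less.prems(2)] by simp
      then show ?thesis using less.hyps[OF deg q0 less.prems(2)] by simp
    qed
  qed
qed

lemma chain_exists:
  assumes "v \<in> W"
  obtains L where "set L \<subseteq> eigenvalues" "chain L v = (\<lambda>x. 0)"
  using annihilating_poly[OF assms] chain_of_poly[OF _ assms] by metis

text \<open>Solves \<open>z * u - B u = v\<close> by a finite recursion: from
  \<open>z - B = (z - l) - (B - l)\<close>, the solution for \<open>v\<close> is \<open>v\<close>
  plus the solution for \<open>(B - l) v\<close>, divided by \<open>z - l\<close>. It terminates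
  when the chain vanishes.\<close>

primrec chain_resolvent :: "complex \<Rightarrow> complex list \<Rightarrow> ('a \<Rightarrow> complex) \<Rightarrow> 'a \<Rightarrow> complex" where
  "chain_resolvent z [] v = (\<lambda>x. 0)"
| "chain_resolvent z (l # L) v = (\<lambda>x. (v x + chain_resolvent z L (shift l v) x) / (z - l))"

lemma chain_resolvent_solves:
  assumes "v \<in> W" "chain L v = (\<lambda>x. 0)" "z \<notin> set L"
  shows "chain_resolvent z L v \<in> W \<and> (\<lambda>x. z * chain_resolvent z L v x - B (chain_resolvent z L v) x) = v"
  using assms
proof (induction L arbitrary: v)
  case Nil
  then show ?case by (simp add: zero_mem B_zero)
next
  case (Cons l L v)
  let ?r = "chain_resolvent z L (shift l v)"
  have "?r \<in> W \<and> (\<lambda>x. z * ?r x - B ?r x) = shift l v"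
    using Cons.prems by (intro Cons.IH) (auto simp: shift_mem)
  then have IH: "?r \<in> W" "\<And>x. z * ?r x - B ?r x = B v x - l * v x"
    by (auto dest: fun_cong simp only: shift_apply)
  have zl: "z - l \<noteq> 0" using Cons.prems by auto
  have eq: "chain_resolvent z (l # L) v = (\<lambda>x. (1 / (z - l)) * v x + (1 / (z - l)) * ?r x)" by (simp add: add_divide_distrib)
  have "z * chain_resolvent z (l # L) v x - B (chain_resolvent z (l # L) v) x = v x" for x
  proof -
    have "z * chain_resolvent z (l # L) v x - B (chain_resolvent z (l # L) v) x =
        1 / (z - l) * (z * v x + (z * ?r x - B ?r x) - B v x)"
      unfolding eq using Cons.prems IH by (subst B_lincomb) (auto simp: algebra_simps)
    also have "\<dots> = 1 / (z - l) * ((z - l) * v x)" unfolding IH by (simp add: algebra_simps)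
    finally show ?thesis using zl by simp
  qed
  moreover have "chain_resolvent z (l # L) v \<in> W" unfolding eq using Cons.prems IH by (intro lincomb_mem)
  ultimately show ?case by blast
qed

lemma resolvent_inj:
  assumes "u \<in> W" "v \<in> W" "z \<notin> eigenvalues" "(\<lambda>x. z * u x - B u x) = (\<lambda>x. z * v x - B v x)"
  shows "u = v"
proof -
  let ?d = "\<lambda>x. 1 * u x + (- 1) * v x"
  have "shift z ?d = (\<lambda>x. 0)"
    unfolding shift_def B_lincomb[OF assms(1,2)] using assms(4) by (auto simp: fun_eq_iff algebra_simps)
  then have "?d = (\<lambda>x. 0)" by (rule shift_eq_0_imp[OF lincomb_mem[OF assms(1,2)] assms(3)])
  then show ?thesis by (auto simp: fun_eq_iff)
qed

lemma resolvent_inj_on: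
  assumes "z \<notin> eigenvalues"
  shows "inj_on (\<lambda>u x. z * u x - B u x) W"
proof (rule inj_onI)
  fix u v assume uv: "u \<in> W" "v \<in> W" "(\<lambda>x. z * u x - B u x) = (\<lambda>x. z * v x - B v x)"
  show "u = v" by (rule resolvent_inj[OF uv(1,2) assms uv(3)])
qed

text \<open>Off the eigenvalues injectivity is immediate, and surjectivity is the explicit solution
  along a chain.\<close>

lemma spectrum_eq: "op_spectrum W B = eigenvalues"
proof -
  have "bij_betw (\<lambda>u x. z * u x - B u x) W W" if z: "z \<notin> eigenvalues" for z
    unfolding bij_betw_def
  proof
    show "inj_on (\<lambda>u x. z * u x - B u x) W" by (rule resolvent_inj_on[OF z])
    show "(\<lambda>u x. z * u x - B u x) ` W = W"
    proof
      show "(\<lambda>u x. z * u x - B u x) ` W \<subseteq> W" by (auto intro!: diff_mem scale_mem B_mem)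
      show "W \<subseteq> (\<lambda>u x. z * u x - B u x) ` W"
      proof
        fix v assume v: "v \<in> W"
        obtain L where L: "set L \<subseteq> eigenvalues" "chain L v = (\<lambda>x. 0)" by (rule chain_exists[OF v])
        have "z \<notin> set L" using z L(1) by blast
        note solves = chain_resolvent_solves[OF v L(2) this]
        show "v \<in> (\<lambda>u x. z * u x - B u x) ` W"
        proof (rule image_eqI)
          show "chain_resolvent z L v \<in> W" by (rule conjunct1[OF solves])
          show "v = (\<lambda>x. z * chain_resolvent z L v x - B (chain_resolvent z L v) x)" by (rule conjunct2[OF solves, symmetric])
        qed
      qed
    qed
  qed
  moreover have "\<not> bij_betw (\<lambda>u x. z * u x - B u x) W W" if z: "z \<in> eigenvalues" for z
  proof
    assume bij: "bij_betw (\<lambda>u x. z * u x - B u x) W W"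
    obtain v where v: "v \<in> W" "v \<noteq> (\<lambda>x. 0)" "B v = (\<lambda>x. z * v x)"
      using z unfolding eigenvalues_def by blast
    have "(\<lambda>u x. z * u x - B u x) v = (\<lambda>u x. z * u x - B u x) (\<lambda>x. 0)"
      using v(3) fun_cong[OF B_zero] by simp
    from inj_onD[OF bij_betw_imp_inj_on[OF bij] this v(1) zero_mem] show False using v(2) by simp
  qed
  ultimately show ?thesis by (auto simp: op_spectrum_def)
qed

lemma op_resolvent_eq_chain_resolvent:
  assumes "v \<in> W" "set L \<subseteq> eigenvalues" "chain L v = (\<lambda>x. 0)" "z \<notin> eigenvalues"
  shows "op_resolvent W B z v = chain_resolvent z L v"
proof -
  have "z \<notin> set L" using assms(2,4) by blast
  note solves = chain_resolvent_solves[OF assms(1,3) this]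
  have "inj_on (\<lambda>u x. z * u x - B u x) W"
    by (rule resolvent_inj_on[OF assms(4)])
  then show ?thesis unfolding op_resolvent_def
    by (rule inv_into_f_eq[OF _ conjunct1[OF solves]]) (rule conjunct2[OF solves])
qed

end

section \<open>Dunford calculus\<close>

text \<open>The first divided difference of \<open>f\<close> at \<open>l\<close> and
  \<open>z\<close>. The derivative as value at \<open>z = l\<close> removes the singularity, so the
  result is again holomorphic and the operation can be iterated.\<close>

definition slope :: "complex \<Rightarrow> (complex \<Rightarrow> complex) \<Rightarrow> complex \<Rightarrow> complex" where
  "slope l f = (\<lambda>z. if z = l then deriv f l else (f z - f l) / (z - l))"

lemma open_slit: "open (- \<real>\<^sub>\<le>\<^sub>0 :: complex set)"
  by (simp add: open_Compl closed_nonpos_Reals_complex)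

lemma slope_holomorphic: "f holomorphic_on - \<real>\<^sub>\<le>\<^sub>0 \<Longrightarrow> slope l f holomorphic_on - \<real>\<^sub>\<le>\<^sub>0"
  unfolding slope_def using pole_lemma_open[OF _ open_slit] .

text \<open>The contour runs in the slit plane, which is simply connected and does not contain
  \<open>w\<close>.\<close>

lemma dunford_contour_winding_slit:
  assumes "dunford_contour S \<gamma>" "w \<in> \<real>\<^sub>\<le>\<^sub>0"
  shows "winding_number \<gamma> w = 0"
proof (rule simply_connected_imp_winding_number_zero)
  have eq: "- \<real>\<^sub>\<le>\<^sub>0 = - (complex_of_real ` {..0})"
    by (auto simp: complex_nonpos_Reals_iff complex_eq_iff image_iff intro: bexI[of _ "Re _"])
  show "simply_connected (- \<real>\<^sub>\<le>\<^sub>0 :: complex set)"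
    unfolding eq by (rule simply_connected_slotted_complex_plane_left)
qed (use assms in \<open>auto simp: dunford_contour_def valid_path_imp_path\<close>)

lemma dunford_Cauchy:
  assumes "dunford_contour S \<gamma>" "f holomorphic_on - \<real>\<^sub>\<le>\<^sub>0"
  shows "contour_integral \<gamma> f = 0"
proof (rule contour_integral_unique, rule Cauchy_theorem_global[OF open_slit assms(2)])
  show "path_image \<gamma> \<subseteq> - \<real>\<^sub>\<le>\<^sub>0" using assms(1) by (auto simp: dunford_contour_def)
qed (use assms in \<open>auto simp: dunford_contour_winding_slit dunford_contour_def\<close>)

lemma dunford_simple_pole:
  assumes "dunford_contour S \<gamma>" "l \<in> S" "l \<notin> \<real>\<^sub>\<le>\<^sub>0"
  shows "contour_integral \<gamma> (\<lambda>z. 1 / (z - l)) = 2 * pi * \<i>"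
proof -
  have "((\<lambda>w. 1 / (w - l)) has_contour_integral (2 * pi * \<i> * winding_number \<gamma> l * 1)) \<gamma>"
  proof (rule Cauchy_integral_formula_global[OF open_slit])
    show "path_image \<gamma> \<subseteq> - \<real>\<^sub>\<le>\<^sub>0 - {l}" using assms by (auto simp: dunford_contour_def)
  qed (use assms in \<open>auto simp: dunford_contour_winding_slit dunford_contour_def\<close>)
  then show ?thesis using assms by (simp add: contour_integral_unique dunford_contour_def)
qed

text \<open>Partial fractions reduce several distinct nodes to fewer; a single multiple node has a primitive.\<close>

lemma dunford_multiple_poles:
  assumes \<gamma>: "dunford_contour S \<gamma>" and S: "finite S" "S \<inter> \<real>\<^sub>\<le>\<^sub>0 = {}"
  shows "set_mset M \<subseteq> S \<Longrightarrow> M \<noteq> {#} \<Longrightarrow>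
    contour_integral \<gamma> (\<lambda>z. \<Prod>l\<in>#M. 1 / (z - l)) = (if size M = 1 then 2 * pi * \<i> else 0)"
proof (induction "size M" arbitrary: M rule: less_induct)
  case less
  obtain l M' where M: "M = add_mset l M'" using less.prems by (metis multiset_cases)
  have l: "l \<in> S" "l \<notin> \<real>\<^sub>\<le>\<^sub>0" using M less.prems S by auto
  have \<gamma>': "valid_path \<gamma>" "pathfinish \<gamma> = pathstart \<gamma>" "path_image \<gamma> \<subseteq> - S"
    using \<gamma> by (auto simp: dunford_contour_def)
  have op: "open (- S)" using S by (simp add: finite_imp_closed open_Compl)
  have integrable: "(\<lambda>z. \<Prod>l\<in>#N. 1 / (z - l)) contour_integrable_on \<gamma>" if "set_mset N \<subseteq> S" for N
  proof -
    have "(\<lambda>z. \<Prod>l\<in>#N. 1 / (z - l)) holomorphic_on - S"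
      using that by (induction N) (auto intro!: holomorphic_intros)
    then show ?thesis by (rule contour_integrable_holomorphic_simple[OF _ op \<gamma>'(1,3)])
  qed
  consider "M' = {#}" | m N where "M' = add_mset m N" "m \<noteq> l" | n where "M' = replicate_mset (Suc n) l"
  proof (cases "\<exists>m\<in>#M'. m \<noteq> l")
    case True
    then show ?thesis using that(2) by (metis insert_DiffM)
  next
    case False
    then have "M' = replicate_mset (size M') l" by (metis set_mset_subset_singletonD singletonI subsetI)
    then show ?thesis using that(1,3) by (cases "size M'") auto
  qed
  then show ?case
  proof cases
    case 1
    then show ?thesis using dunford_simple_pole[OF \<gamma> l] M by simp
  next
    case (2 m N)
    have sub: "set_mset (add_mset l N) \<subseteq> S" "set_mset (add_mset m N) \<subseteq> S" using less.prems M 2 by auto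
    \<comment> \<open>Both multisets have the same size, so their integrals agree and cancel in the
      partial fraction; for size 1 both are \<open>2 * pi * \<i>\<close>.\<close>
    have IH: "contour_integral \<gamma> (\<lambda>z. \<Prod>i\<in>#add_mset l N. 1 / (z - i)) = contour_integral \<gamma> (\<lambda>z. \<Prod>i\<in>#add_mset m N. 1 / (z - i))"
      using less.hyps[of "add_mset l N"] less.hyps[of "add_mset m N"] M 2 sub by simp
    have "contour_integral \<gamma> (\<lambda>z. \<Prod>i\<in>#M. 1 / (z - i)) =
       contour_integral \<gamma> (\<lambda>z. 1 / (l - m) * ((\<Prod>i\<in>#add_mset l N. 1 / (z - i)) - (\<Prod>i\<in>#add_mset m N. 1 / (z - i))))"
    proof (rule contour_integral_cong[OF refl])
      fix z assume "z \<in> path_image \<gamma>"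
      then have "z \<noteq> l" "z \<noteq> m" using \<gamma>'(3) l sub by auto
      then have "1 / (z - l) * (1 / (z - m)) = 1 / (l - m) * (1 / (z - l) - 1 / (z - m))"
        using 2(2) by (simp add: divide_simps)
      then show "(\<Prod>i\<in>#M. 1 / (z - i)) = 1 / (l - m) * ((\<Prod>i\<in>#add_mset l N. 1 / (z - i)) - (\<Prod>i\<in>#add_mset m N. 1 / (z - i)))"
        unfolding M 2(1) by (simp only: image_mset_add_mset prod_mset.add_mset left_diff_distrib[symmetric] mult.assoc[symmetric])
    qed
    also have "\<dots> = 1 / (l - m) * (contour_integral \<gamma> (\<lambda>z. \<Prod>i\<in>#add_mset l N. 1 / (z - i)) - contour_integral \<gamma> (\<lambda>z. \<Prod>i\<in>#add_mset m N. 1 / (z - i)))"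
      using integrable[OF sub(1)] integrable[OF sub(2)]
      by (subst contour_integral_lmul) (auto intro: contour_integrable_diff simp: contour_integral_diff)
    finally show ?thesis using IH M 2 by simp
  next
    case (3 n)
    have "((\<lambda>z. \<Prod>i\<in>#M. 1 / (z - i)) has_contour_integral 0) \<gamma>"
    proof (rule Cauchy_theorem_primitive[of "- {l}" "\<lambda>z. - (1 / of_nat (Suc n)) * (1 / (z - l)) ^ Suc n"])
      fix z assume "z \<in> - {l}"
      then have zl: "z - l \<noteq> 0" by auto
      have "((\<lambda>z. - (1 / of_nat (Suc n)) * (1 / (z - l)) ^ Suc n) has_field_derivative
          - (1 / of_nat (Suc n)) * (of_nat (Suc n) * (1 / (z - l)) ^ n * (- 1 / (z - l)\<^sup>2))) (at z within - {l})"
        using zl by (auto intro!: derivative_eq_intros simp: power2_eq_square simp del: power_Suc of_nat_Suc)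
      also have "- (1 / of_nat (Suc n)) * (of_nat (Suc n) * (1 / (z - l)) ^ n * (- 1 / (z - l)\<^sup>2)) = (1 / (z - l)) ^ n * (1 / (z - l)) ^ 2"
        by (simp add: power_divide del: of_nat_Suc)
      also have "\<dots> = (\<Prod>i\<in>#M. 1 / (z - i))"
        unfolding M 3 by (simp add: power2_eq_square)
      finally show "((\<lambda>z. - (1 / of_nat (Suc n)) * (1 / (z - l)) ^ Suc n) has_field_derivative
          (\<Prod>i\<in>#M. 1 / (z - i))) (at z within - {l})" .
    qed (use \<gamma>' l in auto)
    then show ?thesis using M 3 by (simp add: contour_integral_unique)
  qed
qed

section \<open>The functional calculus on chains\<close>

context accretive_operator
begin

text \<open>The coefficient of the \<open>k\<close>-th Newton term has \<open>k + 1\<close> poles.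
  It is a product over a multiset because its contour integral depends only on the poles and their
  multiplicities.\<close>

definition chain_coeff :: "complex list \<Rightarrow> nat \<Rightarrow> complex \<Rightarrow> complex" where
  "chain_coeff L k z = (\<Prod>l\<in>#mset (take (Suc k) L). 1 / (z - l))"

lemma chain_resolvent_explicit: "chain_resolvent z L v x = (\<Sum>k<length L. chain_coeff L k z * chain (take k L) v x)"
proof (induction L arbitrary: v)
  case (Cons l L)
  have "chain_coeff (l # L) (Suc k) z = 1 / (z - l) * chain_coeff L k z" for k by (simp add: chain_coeff_def)
  moreover have "chain_coeff (l # L) 0 z = 1 / (z - l)" by (simp add: chain_coeff_def)
  ultimately show ?case
    by (simp add: Cons sum.lessThan_Suc_shift sum_divide_distrib add_divide_distrib del: sum.lessThan_Suc)
qed simp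

lemma chain_coeff_holomorphic: "chain_coeff L k holomorphic_on - set L"
proof -
  have "(\<lambda>z. \<Prod>l\<in>#N. 1 / (z - l)) holomorphic_on - S" if "set_mset N \<subseteq> S" for N S
    using that by (induction N) (auto intro!: holomorphic_intros)
  moreover have "set_mset (mset (take (Suc k) L)) \<subseteq> set L" by (simp add: set_take_subset)
  ultimately show ?thesis unfolding chain_coeff_def .
qed

lemma eigenvalues_slit: "eigenvalues \<inter> \<real>\<^sub>\<le>\<^sub>0 = {}"
  using eigenvalue_not_nonpos by auto

text \<open>The finitely many eigenvalues have real part at least some \<open>c > 0\<close>, so a
  large enough circle inside the right half-plane surrounds them.\<close>

lemma dunford_contour_exists: "\<exists>\<gamma>. dunford_contour eigenvalues \<gamma>"
proof -
  obtain c M where c: "0 < c" "\<And>l. l \<in> eigenvalues \<Longrightarrow> c \<le> Re l" and M: "\<And>l. l \<in> eigenvalues \<Longrightarrow> cmod l \<le> M"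
  proof -
    define c where "c = Min (insert 1 (Re ` eigenvalues))"
    have "0 < c" unfolding c_def using finite_eigenvalues eigenvalue_sector(1) by (subst Min_gr_iff) auto
    moreover have "c \<le> Re l" if "l \<in> eigenvalues" for l unfolding c_def using that finite_eigenvalues by (intro Min_le) auto
    moreover obtain M where "\<forall>l\<in>eigenvalues. cmod l \<le> M"
      using finite_imp_bounded[OF finite_eigenvalues] by (auto simp: bounded_iff)
    ultimately show ?thesis using that by blast
  qed
  \<comment> \<open>Solves \<open>c * r = M\<^sup>2 + 1 + c * c\<close>, which gives the slack in
    \<open>inside\<close>.\<close>
  define r where "r = (M\<^sup>2 + 1) / c + c"
  have r: "c < r" "0 < r" using c(1) by (auto simp: r_def intro!: divide_pos_pos add_pos_pos add_nonneg_pos)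
  \<comment> \<open>The leftmost point of the circle is \<open>c / 4\<close>: right of the slit and
    left of every eigenvalue.\<close>
  define R where "R = r + c / 4"
  let ?\<gamma> = "circlepath (complex_of_real R) r"
  have inside: "dist (of_real R) l < r" if l: "l \<in> eigenvalues" for l
  proof -
    have "(dist (of_real R) l)\<^sup>2 = (R - Re l)\<^sup>2 + (Im l)\<^sup>2" by (simp add: dist_norm cmod_power2)
    also have "\<dots> = R\<^sup>2 - 2 * R * Re l + (cmod l)\<^sup>2" unfolding cmod_power2 by (simp add: power2_eq_square algebra_simps)
    also have "\<dots> \<le> R\<^sup>2 - 2 * R * c + M\<^sup>2"
      using c l M[OF l] r by (intro add_mono diff_mono mult_left_mono power_mono) (auto simp: R_def)
    also have "\<dots> < r\<^sup>2"
    proof -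
      have "M\<^sup>2 = c * r - 1 - c * c" using c(1) by (simp add: r_def field_simps)
      moreover have "R\<^sup>2 - 2 * R * c = r\<^sup>2 - 3 / 2 * (c * r) - 7 / 16 * (c * c)"
        by (simp add: R_def power2_eq_square algebra_simps)
      moreover have "0 < c * r" "0 < c * c" using c(1) r(2) by simp_all
      ultimately show ?thesis by linarith
    qed
    finally show ?thesis using r by (intro power2_less_imp_less[of _ r]) auto
  qed
  have "dunford_contour eigenvalues ?\<gamma>"
    unfolding dunford_contour_def
  proof (intro conjI ballI)
    have "z \<notin> eigenvalues \<union> \<real>\<^sub>\<le>\<^sub>0" if z: "dist (of_real R) z = r" for z
    proof
      assume "z \<in> eigenvalues \<union> \<real>\<^sub>\<le>\<^sub>0"
      then show False
      proof
        assume "z \<in> eigenvalues" then show False using inside z by fastforce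
      next
        assume "z \<in> \<real>\<^sub>\<le>\<^sub>0"
        then have "R \<le> Re (of_real R - z)" by (auto simp: complex_nonpos_Reals_iff)
        also have "\<dots> \<le> r" using complex_Re_le_cmod[of "of_real R - z"] z by (simp add: dist_norm)
        finally show False using c by (simp add: R_def)
      qed
    qed
    then show "path_image ?\<gamma> \<inter> (eigenvalues \<union> \<real>\<^sub>\<le>\<^sub>0) = {}" using r by (auto simp: path_image_circlepath)
    show "winding_number ?\<gamma> l = 1" if "l \<in> eigenvalues" for l
      using inside[OF that] by (intro winding_number_circlepath) (simp only: dist_norm[symmetric] dist_commute)
  qed auto
  then show ?thesis by blast
qed

text \<open>The function \<open>f\<close> of the operator \<open>B\<close>. The contour is a
  parameter because \<open>fractional_power\<close> selects its contour by \<open>SOME\<close>, so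
  that only \<open>dunford_contour\<close> is known of it.\<close>

definition Phi :: "(real \<Rightarrow> complex) \<Rightarrow> (complex \<Rightarrow> complex) \<Rightarrow> ('a \<Rightarrow> complex) \<Rightarrow> 'a \<Rightarrow> complex" where
  "Phi \<gamma> f v = (\<lambda>x. 1 / (2 * of_real pi * \<i>) * contour_integral \<gamma> (\<lambda>z. f z * op_resolvent W B z v x))"

lemma op_resolvent_mem: "v \<in> W \<Longrightarrow> z \<notin> eigenvalues \<Longrightarrow> op_resolvent W B z v \<in> W"
  and op_resolvent_solves: "v \<in> W \<Longrightarrow> z \<notin> eigenvalues \<Longrightarrow>
    (\<lambda>x. z * op_resolvent W B z v x - B (op_resolvent W B z v) x) = v"
proof -
  assume v: "v \<in> W" and z: "z \<notin> eigenvalues"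
  obtain L where L: "set L \<subseteq> eigenvalues" "chain L v = (\<lambda>x. 0)" by (rule chain_exists[OF v])
  have "z \<notin> set L" using L z by blast
  note solves = chain_resolvent_solves[OF v L(2) this, folded op_resolvent_eq_chain_resolvent[OF v L z]]
  show "op_resolvent W B z v \<in> W" by (rule conjunct1[OF solves])
  show "(\<lambda>x. z * op_resolvent W B z v x - B (op_resolvent W B z v) x) = v" by (rule conjunct2[OF solves])
qed

lemma op_resolvent_lincomb:
  assumes "u \<in> W" "v \<in> W" "z \<notin> eigenvalues"
  shows "op_resolvent W B z (\<lambda>x. a * u x + b * v x) = (\<lambda>x. a * op_resolvent W B z u x + b * op_resolvent W B z v x)"
proof (rule resolvent_inj[OF _ _ assms(3)])
  let ?u = "op_resolvent W B z u" and ?v = "op_resolvent W B z v"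
  have m: "?u \<in> W" "?v \<in> W" using assms by (auto intro: op_resolvent_mem)
  show "op_resolvent W B z (\<lambda>x. a * u x + b * v x) \<in> W" "(\<lambda>x. a * ?u x + b * ?v x) \<in> W"
    using assms m by (auto intro!: op_resolvent_mem lincomb_mem)
  have "(\<lambda>x. z * (a * ?u x + b * ?v x) - (a * B ?u x + b * B ?v x)) = (\<lambda>x. a * (z * ?u x - B ?u x) + b * (z * ?v x - B ?v x))"
    by (simp add: algebra_simps)
  also have "\<dots> = (\<lambda>x. a * u x + b * v x)"
    using fun_cong[OF op_resolvent_solves[OF assms(1,3)]] fun_cong[OF op_resolvent_solves[OF assms(2,3)]] by simp
  finally show "(\<lambda>x. z * op_resolvent W B z (\<lambda>x. a * u x + b * v x) x - B (op_resolvent W B z (\<lambda>x. a * u x + b * v x)) x) =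
    (\<lambda>x. z * (a * ?u x + b * ?v x) - B (\<lambda>x. a * ?u x + b * ?v x) x)"
    unfolding B_lincomb[OF m] op_resolvent_solves[OF lincomb_mem[OF assms(1,2)] assms(3)] by simp
qed

lemma op_resolvent_holomorphic:
  assumes "v \<in> W"
  shows "(\<lambda>z. op_resolvent W B z v x) holomorphic_on - eigenvalues"
proof -
  obtain L where L: "set L \<subseteq> eigenvalues" "chain L v = (\<lambda>x. 0)" by (rule chain_exists[OF assms])
  have "(\<lambda>z. chain_resolvent z L v x) holomorphic_on - eigenvalues"
    unfolding chain_resolvent_explicit using L(1)
    by (intro holomorphic_intros holomorphic_on_subset[OF chain_coeff_holomorphic]) auto
  then show ?thesis
    by (rule holomorphic_transform) (simp add: op_resolvent_eq_chain_resolvent[OF assms L])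
qed

lemma dunford_integrable:
  assumes "dunford_contour eigenvalues \<gamma>" "f holomorphic_on - \<real>\<^sub>\<le>\<^sub>0" "v \<in> W"
  shows "(\<lambda>z. f z * op_resolvent W B z v x) contour_integrable_on \<gamma>"
proof (rule contour_integrable_holomorphic_simple)
  show "(\<lambda>z. f z * op_resolvent W B z v x) holomorphic_on - \<real>\<^sub>\<le>\<^sub>0 - eigenvalues"
    by (intro holomorphic_intros holomorphic_on_subset[OF assms(2)] holomorphic_on_subset[OF op_resolvent_holomorphic[OF assms(3)]]) auto
  show "open (- \<real>\<^sub>\<le>\<^sub>0 - eigenvalues)" using open_slit finite_eigenvalues by (simp add: open_Diff finite_imp_closed)
qed (use assms(1) in \<open>auto simp: dunford_contour_def\<close>)

text \<open>In the Newton expansion of the resolvent only the term \<open>k = 0\<close> has a simple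
  pole in total, and it carries \<open>v\<close> itself; all the others integrate to 0.\<close>

lemma Phi_one:
  assumes \<gamma>: "dunford_contour eigenvalues \<gamma>" and v: "v \<in> W"
  shows "Phi \<gamma> (\<lambda>z. 1) v = v"
proof
  fix x
  obtain L where L: "set L \<subseteq> eigenvalues" "chain L v = (\<lambda>x. 0)" by (rule chain_exists[OF v])
  have sub: "set_mset (mset (take (Suc k) L)) \<subseteq> eigenvalues" for k using L(1) set_take_subset[of "Suc k" L] by auto
  have int: "chain_coeff L k contour_integrable_on \<gamma>" for k
  proof (rule contour_integrable_holomorphic_simple[OF chain_coeff_holomorphic])
    show "open (- set L)" by (simp add: finite_imp_closed open_Compl)
    show "path_image \<gamma> \<subseteq> - set L" using \<gamma> L(1) by (auto simp: dunford_contour_def)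
  qed (use \<gamma> in \<open>auto simp: dunford_contour_def\<close>)
  have "contour_integral \<gamma> (\<lambda>z. 1 * op_resolvent W B z v x) = contour_integral \<gamma> (\<lambda>z. \<Sum>k<length L. chain_coeff L k z * chain (take k L) v x)"
  proof (rule contour_integral_cong[OF refl])
    fix z assume "z \<in> path_image \<gamma>"
    then have "z \<notin> eigenvalues" using \<gamma> by (auto simp: dunford_contour_def)
    then show "1 * op_resolvent W B z v x = (\<Sum>k<length L. chain_coeff L k z * chain (take k L) v x)"
      by (simp add: op_resolvent_eq_chain_resolvent[OF v L] chain_resolvent_explicit)
  qed
  also have "\<dots> = (\<Sum>k<length L. contour_integral \<gamma> (chain_coeff L k) * chain (take k L) v x)"
    using int by (subst contour_integral_sum) (auto intro: contour_integrable_rmul simp: contour_integral_rmul)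
  also have "\<dots> = (\<Sum>k<length L. if k = 0 then 2 * pi * \<i> * v x else 0)"
  proof (rule sum.cong[OF refl])
    fix k assume k: "k \<in> {..<length L}"
    then have "contour_integral \<gamma> (chain_coeff L k) = (if size (mset (take (Suc k) L)) = 1 then 2 * pi * \<i> else 0)"
      unfolding chain_coeff_def[abs_def] by (intro dunford_multiple_poles[OF \<gamma> finite_eigenvalues eigenvalues_slit sub]) auto
    then show "contour_integral \<gamma> (chain_coeff L k) * chain (take k L) v x = (if k = 0 then 2 * pi * \<i> * v x else 0)"
      using k by auto
  qed
  also have "\<dots> = 2 * pi * \<i> * v x"
    using L(2) by (cases L) (auto simp: fun_eq_iff sum.delta)
  finally show "Phi \<gamma> (\<lambda>z. 1) v x = v x" by (simp add: Phi_def)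
qed

lemma Phi_lincomb:
  assumes \<gamma>: "dunford_contour eigenvalues \<gamma>" and f: "f holomorphic_on - \<real>\<^sub>\<le>\<^sub>0" and uv: "u \<in> W" "v \<in> W"
  shows "Phi \<gamma> f (\<lambda>x. a * u x + b * v x) = (\<lambda>x. a * Phi \<gamma> f u x + b * Phi \<gamma> f v x)"
proof
  fix x
  have "contour_integral \<gamma> (\<lambda>z. f z * op_resolvent W B z (\<lambda>x. a * u x + b * v x) x)
     = contour_integral \<gamma> (\<lambda>z. a * (f z * op_resolvent W B z u x) + b * (f z * op_resolvent W B z v x))"
  proof (rule contour_integral_cong[OF refl])
    fix z assume "z \<in> path_image \<gamma>"
    then have "z \<notin> eigenvalues" using \<gamma> by (auto simp: dunford_contour_def)
    then show "f z * op_resolvent W B z (\<lambda>x. a * u x + b * v x) x = a * (f z * op_resolvent W B z u x) + b * (f z * op_resolvent W B z v x)"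
      by (simp add: op_resolvent_lincomb[OF uv] algebra_simps)
  qed
  also have "\<dots> = a * contour_integral \<gamma> (\<lambda>z. f z * op_resolvent W B z u x) + b * contour_integral \<gamma> (\<lambda>z. f z * op_resolvent W B z v x)"
    using dunford_integrable[OF \<gamma> f uv(1), of x] dunford_integrable[OF \<gamma> f uv(2), of x]
    by (subst contour_integral_add) (auto intro: contour_integrable_lmul simp: contour_integral_lmul)
  finally show "Phi \<gamma> f (\<lambda>x. a * u x + b * v x) x = a * Phi \<gamma> f u x + b * Phi \<gamma> f v x"
    by (simp add: Phi_def algebra_simps add_divide_distrib)
qed

lemma Phi_fun_lincomb:
  assumes \<gamma>: "dunford_contour eigenvalues \<gamma>" and fg: "f holomorphic_on - \<real>\<^sub>\<le>\<^sub>0" "g holomorphic_on - \<real>\<^sub>\<le>\<^sub>0" and v: "v \<in> W"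
  shows "Phi \<gamma> (\<lambda>z. a * f z + b * g z) v = (\<lambda>x. a * Phi \<gamma> f v x + b * Phi \<gamma> g v x)"
proof
  fix x
  have "contour_integral \<gamma> (\<lambda>z. (a * f z + b * g z) * op_resolvent W B z v x)
     = contour_integral \<gamma> (\<lambda>z. a * (f z * op_resolvent W B z v x) + b * (g z * op_resolvent W B z v x))"
    by (simp add: algebra_simps)
  also have "\<dots> = a * contour_integral \<gamma> (\<lambda>z. f z * op_resolvent W B z v x) + b * contour_integral \<gamma> (\<lambda>z. g z * op_resolvent W B z v x)"
    using dunford_integrable[OF \<gamma> fg(1) v, of x] dunford_integrable[OF \<gamma> fg(2) v, of x]
    by (subst contour_integral_add) (auto intro: contour_integrable_lmul simp: contour_integral_lmul)
  finally show "Phi \<gamma> (\<lambda>z. a * f z + b * g z) v x = a * Phi \<gamma> f v x + b * Phi \<gamma> g v x"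
    by (simp add: Phi_def algebra_simps add_divide_distrib)
qed

lemma Phi_cong:
  assumes \<gamma>: "dunford_contour eigenvalues \<gamma>" and "\<And>z. z \<notin> \<real>\<^sub>\<le>\<^sub>0 \<Longrightarrow> f z = g z"
  shows "Phi \<gamma> f v = Phi \<gamma> g v"
proof -
  have "contour_integral \<gamma> (\<lambda>z. f z * op_resolvent W B z v x) = contour_integral \<gamma> (\<lambda>z. g z * op_resolvent W B z v x)" for x
    using \<gamma> assms(2) by (intro contour_integral_cong refl) (auto simp: dunford_contour_def)
  then show ?thesis by (simp add: Phi_def)
qed

text \<open>Newton's interpolation formula for the functional calculus, one node at a time.\<close>

lemma Phi_step:
  assumes \<gamma>: "dunford_contour eigenvalues \<gamma>" and f: "f holomorphic_on - \<real>\<^sub>\<le>\<^sub>0" and v: "v \<in> W" and l: "l \<in> eigenvalues"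
  shows "Phi \<gamma> f v = (\<lambda>x. f l * v x + Phi \<gamma> (slope l f) (shift l v) x)"
proof
  fix x
  let ?R = "\<lambda>z. op_resolvent W B z v x" and ?S = "\<lambda>z. op_resolvent W B z (shift l v) x"
  note holo = slope_holomorphic[OF f]
  have int: "(\<lambda>z. slope l f z * ?S z) contour_integrable_on \<gamma>" "(\<lambda>z. 1 * ?R z) contour_integrable_on \<gamma>"
    using dunford_integrable[OF \<gamma> holo shift_mem[OF v]] dunford_integrable[OF \<gamma> _ v, of "\<lambda>_. 1"] by auto
  have int': "slope l f contour_integrable_on \<gamma>"
    using \<gamma> by (intro contour_integrable_holomorphic_simple[OF holo open_slit]) (auto simp: dunford_contour_def)
  have "contour_integral \<gamma> (\<lambda>z. f z * ?R z) = contour_integral \<gamma> (\<lambda>z. (slope l f z * v x + slope l f z * ?S z) + f l * (1 * ?R z))"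
  proof (rule contour_integral_cong[OF refl])
    fix z assume "z \<in> path_image \<gamma>"
    then have z: "z \<notin> eigenvalues" using \<gamma> by (auto simp: dunford_contour_def)
    then have zl: "z \<noteq> l" using l by auto
    obtain L where L: "set L \<subseteq> eigenvalues" "chain L (shift l v) = (\<lambda>x. 0)" by (rule chain_exists[OF shift_mem[OF v]])
    have "?R z = chain_resolvent z (l # L) v x" using L l z by (subst op_resolvent_eq_chain_resolvent[OF v, of "l # L"]) auto
    also have "\<dots> = (v x + ?S z) / (z - l)" by (simp add: op_resolvent_eq_chain_resolvent[OF shift_mem[OF v] L z])
    finally have R: "(z - l) * ?R z = v x + ?S z" using zl by simp
    have "f z = slope l f z * (z - l) + f l" using zl by (simp add: slope_def)
    then show "f z * ?R z = (slope l f z * v x + slope l f z * ?S z) + f l * (1 * ?R z)"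
      using R by (metis (no_types, lifting) distrib_left distrib_right mult.assoc mult_1)
  qed
  also have "\<dots> = contour_integral \<gamma> (slope l f) * v x + contour_integral \<gamma> (\<lambda>z. slope l f z * ?S z) + f l * contour_integral \<gamma> (\<lambda>z. 1 * ?R z)"
    using int int' by (simp only: contour_integral_add contour_integral_lmul contour_integral_rmul
        contour_integrable_add contour_integrable_lmul contour_integrable_rmul)
  also have "contour_integral \<gamma> (slope l f) = 0" by (rule dunford_Cauchy[OF \<gamma> holo])
  finally have "Phi \<gamma> f v x = Phi \<gamma> (slope l f) (shift l v) x + f l * Phi \<gamma> (\<lambda>z. 1) v x"
    by (simp add: Phi_def algebra_simps add_divide_distrib)
  then show "Phi \<gamma> f v x = f l * v x + Phi \<gamma> (slope l f) (shift l v) x" by (simp add: Phi_one[OF \<gamma> v])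
qed

lemma Phi_zero: "dunford_contour eigenvalues \<gamma> \<Longrightarrow> f holomorphic_on - \<real>\<^sub>\<le>\<^sub>0 \<Longrightarrow> Phi \<gamma> f (\<lambda>x. 0) = (\<lambda>x. 0)"
  using Phi_lincomb[OF _ _ zero_mem zero_mem, of \<gamma> f 0 0] by simp

text \<open>A pointwise contour integral is not visibly an element of \<open>W\<close>; running
  \<open>Phi_step\<close> down a chain exhibits it as a finite combination of elements.\<close>

lemma Phi_mem:
  assumes \<gamma>: "dunford_contour eigenvalues \<gamma>" and f: "f holomorphic_on - \<real>\<^sub>\<le>\<^sub>0" and v: "v \<in> W"
  shows "Phi \<gamma> f v \<in> W"
proof -
  have *: "Phi \<gamma> f v \<in> W" if "f holomorphic_on - \<real>\<^sub>\<le>\<^sub>0" "v \<in> W" "set L \<subseteq> eigenvalues" "chain L v = (\<lambda>x. 0)" for f v L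
    using that
  proof (induction L arbitrary: f v)
    case Nil
    then show ?case using Phi_zero[OF \<gamma>] zero_mem by simp
  next
    case (Cons l L)
    then show ?case
      using Phi_step[OF \<gamma> Cons.prems(1,2), of l] lincomb_mem[of v "Phi \<gamma> (slope l f) (shift l v)" "f l" 1]
      by (simp add: slope_holomorphic shift_mem)
  qed
  obtain L where L: "set L \<subseteq> eigenvalues" "chain L v = (\<lambda>x. 0)" by (rule chain_exists[OF v])
  show ?thesis by (rule *[OF f v L])
qed

text \<open>The Leibniz rule for divided differences; the factor 1 matches the form of
  \<open>Phi_fun_lincomb\<close>.\<close>

lemma slope_mult: "f holomorphic_on - \<real>\<^sub>\<le>\<^sub>0 \<Longrightarrow> h holomorphic_on - \<real>\<^sub>\<le>\<^sub>0 \<Longrightarrow> l \<notin> \<real>\<^sub>\<le>\<^sub>0 \<Longrightarrow>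
    slope l (\<lambda>z. f z * h z) z = h l * slope l f z + 1 * (f z * slope l h z)"
proof -
  assume fh: "f holomorphic_on - \<real>\<^sub>\<le>\<^sub>0" "h holomorphic_on - \<real>\<^sub>\<le>\<^sub>0" and l: "l \<notin> \<real>\<^sub>\<le>\<^sub>0"
  have "f field_differentiable at l" "h field_differentiable at l"
    using fh l open_slit by (auto intro: holomorphic_on_imp_differentiable_at)
  then have "deriv (\<lambda>z. f z * h z) l = f l * deriv h l + deriv f l * h l" by (rule deriv_mult)
  moreover have "(f z * h z - f l * h l) / (z - l) = h l * ((f z - f l) / (z - l)) + f z * ((h z - h l) / (z - l))"
    by (simp add: add_divide_distrib[symmetric]) (simp add: algebra_simps)
  ultimately show ?thesis by (simp add: slope_def)
qed

text \<open>Induction along a chain of \<open>v\<close>, with \<open>h\<close> and \<open>v\<close>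
  varying: \<open>Phi_step\<close> for \<open>h\<close> and then for \<open>f\<close> leaves the
  combination of slopes that the Leibniz rule recognises as the slope of the product.\<close>

theorem Phi_mult:
  assumes \<gamma>: "dunford_contour eigenvalues \<gamma>" and f: "f holomorphic_on - \<real>\<^sub>\<le>\<^sub>0" and h: "h holomorphic_on - \<real>\<^sub>\<le>\<^sub>0" and v: "v \<in> W"
  shows "Phi \<gamma> f (Phi \<gamma> h v) = Phi \<gamma> (\<lambda>z. f z * h z) v"
proof -
  have *: "Phi \<gamma> f (Phi \<gamma> h v) = Phi \<gamma> (\<lambda>z. f z * h z) v"
    if "h holomorphic_on - \<real>\<^sub>\<le>\<^sub>0" "v \<in> W" "set L \<subseteq> eigenvalues" "chain L v = (\<lambda>x. 0)" for h v L
    using that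
  proof (induction L arbitrary: h v)
    case Nil
    then show ?case using Phi_zero[OF \<gamma>] f by (simp add: holomorphic_on_mult)
  next
    case (Cons l L)
    note h = Cons.prems(1) and v = Cons.prems(2)
    have l: "l \<in> eigenvalues" "l \<notin> \<real>\<^sub>\<le>\<^sub>0" using Cons.prems eigenvalue_not_nonpos by auto
    note sh = slope_holomorphic[OF h, of l] and sf = slope_holomorphic[OF f, of l]
    let ?v = "shift l v"
    have IH: "Phi \<gamma> f (Phi \<gamma> (slope l h) ?v) = Phi \<gamma> (\<lambda>z. f z * slope l h z) ?v"
      using Cons.prems by (intro Cons.IH sh) (auto simp: shift_mem)
    have "Phi \<gamma> f (Phi \<gamma> h v) = Phi \<gamma> f (\<lambda>x. h l * v x + 1 * Phi \<gamma> (slope l h) ?v x)"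
      by (simp add: Phi_step[OF \<gamma> h v l(1)])
    also have "\<dots> = (\<lambda>x. h l * Phi \<gamma> f v x + 1 * Phi \<gamma> (\<lambda>z. f z * slope l h z) ?v x)"
      unfolding Phi_lincomb[OF \<gamma> f v Phi_mem[OF \<gamma> sh shift_mem[OF v]]] IH ..
    also have "\<dots> = (\<lambda>x. f l * h l * v x + (h l * Phi \<gamma> (slope l f) ?v x + 1 * Phi \<gamma> (\<lambda>z. f z * slope l h z) ?v x))"
      by (simp add: Phi_step[OF \<gamma> f v l(1)] algebra_simps)
    also have "\<dots> = (\<lambda>x. f l * h l * v x + Phi \<gamma> (\<lambda>z. h l * slope l f z + 1 * (f z * slope l h z)) ?v x)"
      by (subst Phi_fun_lincomb[OF \<gamma> sf holomorphic_on_mult[OF f sh] shift_mem[OF v]]) simp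
    also have "(\<lambda>z. h l * slope l f z + 1 * (f z * slope l h z)) = slope l (\<lambda>z. f z * h z)"
      using slope_mult[OF f h l(2)] by auto
    also have "(\<lambda>x. f l * h l * v x + Phi \<gamma> (slope l (\<lambda>z. f z * h z)) ?v x) = Phi \<gamma> (\<lambda>z. f z * h z) v"
      by (rule Phi_step[OF \<gamma> holomorphic_on_mult[OF f h] v l(1), symmetric])
    finally show ?case .
  qed
  obtain L where L: "set L \<subseteq> eigenvalues" "chain L v = (\<lambda>x. 0)" by (rule chain_exists[OF v])
  show ?thesis by (rule *[OF h v L])
qed

end

section \<open>Operator kernels and the sinc approximation\<close>

text \<open>Both bounds come from \<open>c * (\<zeta> + 1) \<le> cmod (\<zeta> + z)\<close>. The
  second one says that \<open>\<kappa> / (\<zeta> + z)\<close> satisfies the hypothesis on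
  \<open>\<kappa>\<close> again, which lets the representation be iterated along a chain.\<close>

lemma kernel_integrable:
  fixes \<zeta> :: "real \<Rightarrow> real" and \<kappa> :: "real \<Rightarrow> complex" and z :: complex
  assumes meas: "\<zeta> \<in> borel_measurable borel" "\<kappa> \<in> borel_measurable borel"
    and \<zeta>: "\<And>y. 0 < \<zeta> y" and int: "integrable lborel (\<lambda>y. \<kappa> y / \<zeta> y)" and z: "z \<notin> \<real>\<^sub>\<le>\<^sub>0"
  shows "integrable lborel (\<lambda>y. \<kappa> y / (\<zeta> y + z))" "integrable lborel (\<lambda>y. \<kappa> y / (\<zeta> y + z) / \<zeta> y)"
proof -
  obtain c where c: "0 < c" "\<And>t::real. 0 \<le> t \<Longrightarrow> c * (t + 1) \<le> cmod (of_real t + z)"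
    using cmod_add_nonneg_lower_bound[OF z] by metis
  have int': "integrable lborel (\<lambda>y. 1 / c * cmod (\<kappa> y / \<zeta> y))"
    using int by (intro integrable_mult_right integrable_norm)
  have ge: "c * (\<zeta> y + 1) \<le> cmod (\<zeta> y + z)" for y using c(2)[of "\<zeta> y"] \<zeta>[of y] by simp
  have b1: "cmod (\<kappa> y / (\<zeta> y + z)) \<le> 1 / c * cmod (\<kappa> y / \<zeta> y)" for y
  proof -
    have "cmod (\<kappa> y) / cmod (\<zeta> y + z) \<le> cmod (\<kappa> y) / (c * \<zeta> y)"
      using ge[of y] c(1) \<zeta>[of y] by (intro frac_le) (auto simp: algebra_simps)
    then show ?thesis using \<zeta>[of y] by (simp add: norm_divide)
  qed
  have b2: "cmod (\<kappa> y / (\<zeta> y + z) / \<zeta> y) \<le> 1 / c * cmod (\<kappa> y / \<zeta> y)" for y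
  proof -
    have "c * 1 \<le> c * (\<zeta> y + 1)" using c(1) \<zeta>[of y] by (intro mult_left_mono) auto
    then have "cmod (\<kappa> y / \<zeta> y) / cmod (\<zeta> y + z) \<le> cmod (\<kappa> y / \<zeta> y) / c"
      using order_trans[OF _ ge[of y], of c] c(1) by (intro frac_le) auto
    then show ?thesis using \<zeta>[of y] by (simp add: norm_divide norm_mult mult.commute)
  qed
  show "integrable lborel (\<lambda>y. \<kappa> y / (\<zeta> y + z))"
  proof (rule Bochner_Integration.integrable_bound[OF int'])
    show "(\<lambda>y. \<kappa> y / (\<zeta> y + z)) \<in> borel_measurable lborel" using meas by measurable
  qed (unfold real_norm_def, intro AE_I2 order_trans[OF b1 abs_ge_self])
  show "integrable lborel (\<lambda>y. \<kappa> y / (\<zeta> y + z) / \<zeta> y)"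
  proof (rule Bochner_Integration.integrable_bound[OF int'])
    show "(\<lambda>y. \<kappa> y / (\<zeta> y + z) / \<zeta> y) \<in> borel_measurable lborel" using meas by measurable
  qed (unfold real_norm_def, intro AE_I2 order_trans[OF b2 abs_ge_self])
qed

text \<open>The divided difference of \<open>1 / (\<zeta> + z)\<close> is
  \<open>- 1 / ((\<zeta> + l) * (\<zeta> + z))\<close>, so functions given by such integrals are
  closed under \<open>slope\<close>. At \<open>z = l\<close> the formula follows by continuity of
  both sides.\<close>

lemma slope_kernel:
  fixes \<zeta> :: "real \<Rightarrow> real" and \<kappa> h :: "_ \<Rightarrow> complex" and l z :: complex
  assumes meas: "\<zeta> \<in> borel_measurable borel" "\<kappa> \<in> borel_measurable borel"
    and \<zeta>: "\<And>y. 0 < \<zeta> y" and int: "integrable lborel (\<lambda>y. \<kappa> y / \<zeta> y)"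
    and h: "h holomorphic_on - \<real>\<^sub>\<le>\<^sub>0" "\<And>z :: complex. z \<notin> \<real>\<^sub>\<le>\<^sub>0 \<Longrightarrow> h z = (LINT y|lborel. \<kappa> y / (\<zeta> y + z))"
    and l: "l \<notin> \<real>\<^sub>\<le>\<^sub>0" and z: "z \<notin> \<real>\<^sub>\<le>\<^sub>0"
  shows "slope l h z = (LINT y|lborel. - (\<kappa> y / (\<zeta> y + l)) / (\<zeta> y + z))"
proof -
  let ?k = "\<lambda>y. - (\<kappa> y / (\<zeta> y + l))"
  let ?J = "\<lambda>z :: complex. LINT y|lborel. ?k y / (\<zeta> y + z)"
  have mk: "?k \<in> borel_measurable borel" using meas by measurable
  have intk: "integrable lborel (\<lambda>y. ?k y / \<zeta> y)"
    using kernel_integrable(2)[OF meas \<zeta> int l] by simp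
  note I = kernel_integrable(1)[OF meas \<zeta> int] and Ik = kernel_integrable(1)[OF meas(1) mk \<zeta> intk]
  have ne: "complex_of_real (\<zeta> y) + z \<noteq> 0" if "z \<notin> \<real>\<^sub>\<le>\<^sub>0" for z :: complex and y
  proof
    assume "complex_of_real (\<zeta> y) + z = 0"
    then have "z = - complex_of_real (\<zeta> y)" by (simp add: add_eq_0_iff2 add.commute)
    then show False using that \<zeta>[of y] by (auto simp: complex_nonpos_Reals_iff)
  qed
  have off: "slope l h z = ?J z" if z: "z \<notin> \<real>\<^sub>\<le>\<^sub>0" "z \<noteq> l" for z :: complex
  proof -
    have "slope l h z = (LINT y|lborel. (\<kappa> y / (\<zeta> y + z) - \<kappa> y / (\<zeta> y + l)) / (z - l))"
      using z I[OF z(1)] I[OF l] by (simp add: slope_def h(2) l)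
    also have "\<dots> = ?J z"
      using z ne[OF z(1)] ne[OF l] by (intro Bochner_Integration.integral_cong refl) (simp add: divide_simps, simp add: algebra_simps)
    finally show ?thesis .
  qed
  show ?thesis
  proof (cases "z = l")
    case False
    then show ?thesis using off z by simp
  next
    case True
    obtain c where c: "0 < c" "\<And>t::real. 0 \<le> t \<Longrightarrow> c * (t + 1) \<le> cmod (of_real t + l)"
      using cmod_add_nonneg_lower_bound[OF l] by metis
    let ?K = "LINT y|lborel. cmod (?k y / (\<zeta> y + l))"
    \<comment> \<open>A Lipschitz estimate at \<open>l\<close> takes the place of differentiation
      under the integral; within distance \<open>c / 2\<close> the denominator at \<open>w\<close>
      stays at least \<open>c / 2\<close>.\<close>
    have bound: "cmod (?J w - ?J l) \<le> 2 / c * ?K * cmod (w - l)" if w: "w \<notin> \<real>\<^sub>\<le>\<^sub>0" "cmod (w - l) < c / 2" for w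
    proof -
      have ptw: "cmod (?k y / (\<zeta> y + w) - ?k y / (\<zeta> y + l)) \<le> 2 / c * cmod (w - l) * cmod (?k y / (\<zeta> y + l))" for y
      proof -
        have "c * 1 \<le> c * (\<zeta> y + 1)" using c(1) \<zeta>[of y] by (intro mult_left_mono) auto
        then have "c \<le> cmod (\<zeta> y + l)" using c(2)[of "\<zeta> y"] \<zeta>[of y] by simp
        moreover have "cmod (\<zeta> y + l) - cmod (w - l) \<le> cmod (\<zeta> y + w)"
          using norm_diff_ineq[of "\<zeta> y + l" "w - l"] by (simp add: algebra_simps)
        ultimately have ge: "c / 2 \<le> cmod (\<zeta> y + w)" using w(2) by linarith
        have "?k y / (\<zeta> y + w) - ?k y / (\<zeta> y + l) = ?k y / (\<zeta> y + l) * ((l - w) / (\<zeta> y + w))"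
        proof -
          have "k / (s + w) - k / (s + l) = k / (s + l) * ((l - w) / (s + w))"
            if "s + w \<noteq> 0" "s + l \<noteq> 0" for k s :: complex
            using that by (simp add: divide_simps) (simp add: algebra_simps)
          from this[OF ne[OF w(1)] ne[OF l]] show ?thesis .
        qed
        then have "cmod (?k y / (\<zeta> y + w) - ?k y / (\<zeta> y + l)) = cmod (?k y / (\<zeta> y + l)) * (cmod (w - l) / cmod (\<zeta> y + w))"
          by (simp only: norm_mult norm_divide norm_minus_commute[of l w])
        also have "\<dots> \<le> cmod (?k y / (\<zeta> y + l)) * (cmod (w - l) / (c / 2))"
          using c(1) by (intro mult_left_mono frac_le ge order_refl norm_ge_zero) simp
        finally show ?thesis by (simp add: field_simps)
      qed
      have "cmod (?J w - ?J l) = cmod (LINT y|lborel. ?k y / (\<zeta> y + w) - ?k y / (\<zeta> y + l))"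
        using Ik[OF w(1)] Ik[OF l] by simp
      also have "\<dots> \<le> (LINT y|lborel. cmod (?k y / (\<zeta> y + w) - ?k y / (\<zeta> y + l)))" by (rule integral_norm_bound)
      also have "\<dots> \<le> (LINT y|lborel. 2 / c * cmod (w - l) * cmod (?k y / (\<zeta> y + l)))"
        using Ik[OF w(1)] Ik[OF l] ptw
        by (intro integral_mono integrable_norm integrable_mult_right Bochner_Integration.integrable_diff)
      finally show ?thesis by (simp add: mult_ac)
    qed
    have ev: "\<forall>\<^sub>F w in at l. w \<notin> \<real>\<^sub>\<le>\<^sub>0 \<and> w \<noteq> l \<and> cmod (w - l) < c / 2"
    proof (intro eventually_conj)
      show "\<forall>\<^sub>F w in at l. w \<notin> \<real>\<^sub>\<le>\<^sub>0" using eventually_at_in_open'[OF open_slit, of l] l by (auto elim: eventually_mono)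
      show "\<forall>\<^sub>F w in at l. w \<noteq> l" by (rule eventually_neq_at_within)
      show "\<forall>\<^sub>F w in at l. cmod (w - l) < c / 2"
        using c(1) eventually_at_ball[of "c / 2" l UNIV] by (auto elim!: eventually_mono simp: dist_norm norm_minus_commute)
    qed
    have "((\<lambda>w. ?J w - ?J l) \<longlongrightarrow> 0) (at l)"
    proof (rule Lim_null_comparison)
      show "\<forall>\<^sub>F w in at l. cmod (?J w - ?J l) \<le> 2 / c * ?K * cmod (w - l)"
        using ev by eventually_elim (use bound in blast)
      show "((\<lambda>w. 2 / c * ?K * cmod (w - l)) \<longlongrightarrow> 0) (at l)"
        by (rule tendsto_eq_intros refl | simp)+
    qed
    then have "(?J \<longlongrightarrow> ?J l) (at l)" by (rule LIM_zero_cancel)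
    then have "(slope l h \<longlongrightarrow> ?J l) (at l)"
      by (rule Lim_transform_eventually) (use ev in eventually_elim, use off in simp)
    moreover have "(slope l h \<longlongrightarrow> slope l h l) (at l)"
      using holomorphic_on_imp_continuous_on[OF slope_holomorphic[OF h(1)]] l
      unfolding continuous_on_eq_continuous_at[OF open_slit] isCont_def by blast
    ultimately show ?thesis unfolding True by (rule LIM_unique[symmetric])
  qed
qed

lemma nonneg_int_summable_on: "(\<lambda>n::int. 1 / (\<bar>real_of_int n\<bar> + 1)\<^sup>2) summable_on UNIV"
proof -
  let ?f = "\<lambda>n::int. 1 / (\<bar>real_of_int n\<bar> + 1)\<^sup>2"
  have sq: "(\<lambda>n::nat. 1 / (real n + 1)\<^sup>2) summable_on UNIV"
    using inverse_squares_sums by (intro norm_summable_imp_summable_on) (auto simp: sums_iff add.commute)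
  have 1: "bij_betw int UNIV {0..}"
    by (rule bij_betwI[where g = nat]) auto
  \<comment> \<open>The shifted reflection covers the negative integers without counting 0
    twice.\<close>
  have 2: "bij_betw (\<lambda>n. - int n - 1) UNIV {..<0}"
    by (rule bij_betwI[where g = "\<lambda>n. nat (- n - 1)"]) auto
  have "?f summable_on {0..}"
    using summable_on_reindex_bij_betw[OF 1, of ?f] sq by simp
  moreover have "(\<lambda>n::nat. 1 / (\<bar>real_of_int (- int n - 1)\<bar> + 1)\<^sup>2) summable_on UNIV"
    by (rule summable_on_comparison_test[OF sq]) (auto intro!: divide_left_mono power_mono)
  then have "?f summable_on {..<0}"
    using summable_on_reindex_bij_betw[OF 2, of ?f] by simp
  ultimately have "?f summable_on {0..} \<union> {..<0}" by (rule summable_on_union)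
  moreover have "{0..} \<union> {..<0} = (UNIV :: int set)" by auto
  ultimately show ?thesis by simp
qed

text \<open>The points \<open>n * \<tau> - c\<close> grow linearly and the kernel decays
  quadratically; \<open>q\<close> is the constant in \<open>\<bar>n\<bar> + 1 \<le> q * (\<bar>n *
  \<tau> - c\<bar> + \<epsilon>)\<close>.\<close>

lemma log_kernel_summable_on:
  assumes "0 < \<epsilon>" "0 < \<tau>"
  shows "(\<lambda>n::int. log_kernel \<epsilon> (n * \<tau> - c)) summable_on UNIV"
proof -
  define q where "q = 1 / \<tau> + (\<bar>c\<bar> / \<tau> + 1) / \<epsilon>"
  have q: "0 < q" using assms by (auto simp: q_def intro!: add_pos_nonneg)
  have ge: "\<bar>real_of_int n\<bar> + 1 \<le> q * (\<bar>n * \<tau> - c\<bar> + \<epsilon>)" for n :: int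
  proof -
    have "\<bar>real_of_int n\<bar> * \<tau> \<le> \<bar>n * \<tau> - c\<bar> + \<bar>c\<bar>" using assms abs_triangle_ineq4[of "n * \<tau> - c" "- c"] by (simp add: abs_mult)
    then have "\<bar>real_of_int n\<bar> \<le> (\<bar>n * \<tau> - c\<bar> + \<bar>c\<bar>) / \<tau>" using assms by (simp add: field_simps)
    also have "\<dots> = 1 / \<tau> * \<bar>n * \<tau> - c\<bar> + \<bar>c\<bar> / \<tau>" by (simp add: add_divide_distrib)
    also have "\<dots> \<le> 1 / \<tau> * (\<bar>n * \<tau> - c\<bar> + \<epsilon>) + \<bar>c\<bar> / \<tau>" using assms by (intro add_right_mono mult_left_mono) auto
    finally have "\<bar>real_of_int n\<bar> + 1 \<le> 1 / \<tau> * (\<bar>n * \<tau> - c\<bar> + \<epsilon>) + (\<bar>c\<bar> / \<tau> + 1) / \<epsilon> * \<epsilon>" using assms by simp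
    also have "\<dots> \<le> 1 / \<tau> * (\<bar>n * \<tau> - c\<bar> + \<epsilon>) + (\<bar>c\<bar> / \<tau> + 1) / \<epsilon> * (\<bar>n * \<tau> - c\<bar> + \<epsilon>)"
      using assms by (intro add_left_mono mult_left_mono) auto
    finally show ?thesis by (simp only: q_def distrib_right)
  qed
  have "log_kernel \<epsilon> (n * \<tau> - c) \<le> q\<^sup>2 * (1 / (\<bar>real_of_int n\<bar> + 1)\<^sup>2)" for n :: int
  proof -
    let ?t = "\<bar>n * \<tau> - c\<bar> + \<epsilon>"
    have t: "0 < ?t" using assms by (intro add_nonneg_pos) auto
    have "((\<bar>real_of_int n\<bar> + 1) / q)\<^sup>2 \<le> ?t\<^sup>2" using ge[of n] q by (intro power_mono) (auto simp: field_simps)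
    also have "?t\<^sup>2 \<le> ?t * (\<bar>n * \<tau> - c\<bar> + 1 + \<epsilon>)" using t by (simp add: power2_eq_square)
    finally have le: "((\<bar>real_of_int n\<bar> + 1) / q)\<^sup>2 \<le> ?t * (\<bar>n * \<tau> - c\<bar> + 1 + \<epsilon>)" .
    have "log_kernel \<epsilon> (n * \<tau> - c) \<le> 1 / ((\<bar>real_of_int n\<bar> + 1) / q)\<^sup>2"
      unfolding log_kernel_def using le q by (intro frac_le) (auto intro!: zero_less_power divide_pos_pos add_nonneg_pos)
    then show ?thesis by (simp add: power_divide)
  qed
  note le = this
  show ?thesis
  proof (rule summable_on_comparison_test)
    show "(\<lambda>n::int. q\<^sup>2 * (1 / (\<bar>real_of_int n\<bar> + 1)\<^sup>2)) summable_on UNIV"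
      by (intro summable_on_cmult_right nonneg_int_summable_on)
  qed (use le log_kernel_pos[OF assms(1)] in \<open>auto simp: less_imp_le\<close>)
qed

text \<open>\<open>cos (\<bar>\<eta>\<bar> + arctan \<beta>)\<close> is nonnegative and expands to a
  positive multiple of \<open>cos \<eta> - \<beta> * \<bar>sin \<eta>\<bar>\<close>, which times
  \<open>Re p\<close> is a lower bound for the real part.\<close>

lemma rotated_sector_Re_nonneg:
  fixes p :: complex and \<beta> \<eta> :: real
  assumes "0 \<le> \<beta>" "\<bar>Im p\<bar> \<le> \<beta> * Re p" "0 \<le> Re p" "\<bar>\<eta>\<bar> \<le> pi / 2 - arctan \<beta>"
  shows "0 \<le> Re (cis \<eta> * p)"
proof -
  let ?w = "arctan \<beta>"
  have w: "0 \<le> ?w" "?w < pi / 2" using assms(1) arctan_ubound[of \<beta>] by auto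
  have cw: "0 < cos ?w" using w arctan_lbound[of \<beta>] by (intro cos_gt_zero_pi) auto
  have "0 \<le> cos (\<bar>\<eta>\<bar> + ?w)" using assms(4) w abs_ge_zero[of \<eta>] by (intro cos_ge_zero) linarith+
  also have "\<dots> = cos ?w * (cos \<eta> - \<beta> * \<bar>sin \<eta>\<bar>)"
  proof -
    have "sin ?w = \<beta> * cos ?w" using tan_arctan[of \<beta>] cw by (simp add: tan_def field_simps)
    moreover have "cos \<bar>\<eta>\<bar> = cos \<eta>" by simp
    moreover have "sin \<bar>\<eta>\<bar> = \<bar>sin \<eta>\<bar>"
    proof -
      have "0 \<le> sin \<bar>\<eta>\<bar>" using assms(4) w pi_gt_zero by (intro sin_ge_zero) linarith+
      then show ?thesis by (cases "0 \<le> \<eta>") auto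
    qed
    ultimately show ?thesis by (simp add: cos_add algebra_simps)
  qed
  finally have "0 \<le> cos \<eta> - \<beta> * \<bar>sin \<eta>\<bar>" using cw by (simp add: zero_le_mult_iff)
  then have "0 \<le> Re p * (cos \<eta> - \<beta> * \<bar>sin \<eta>\<bar>)" using assms(3) by simp
  also have "\<dots> \<le> Re p * cos \<eta> - Im p * sin \<eta>"
  proof -
    have "Im p * sin \<eta> \<le> \<bar>Im p\<bar> * \<bar>sin \<eta>\<bar>" by (metis abs_ge_self abs_mult)
    also have "\<dots> \<le> \<beta> * Re p * \<bar>sin \<eta>\<bar>" using assms(2) by (intro mult_right_mono) auto
    finally show ?thesis by (simp add: algebra_simps)
  qed
  finally show ?thesis by (simp add: mult.commute)
qed

context accretive_operator
begin

text \<open>An integral formula for the scalar function carries over to \<open>B\<close>, with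
  \<open>1 / (\<zeta> + z)\<close> replaced by the solution of \<open>\<zeta> * w + B w = v\<close>;
  this is minus the resolvent at \<open>- \<zeta>\<close>, whence the sign. \<open>Phi_step\<close>
  and the recursion of \<open>chain_resolvent\<close> have the same shape, and
  \<open>slope_kernel\<close> supplies the kernel of the next step.\<close>

lemma Phi_kernel:
  fixes \<zeta> :: "real \<Rightarrow> real" and \<kappa> :: "real \<Rightarrow> complex"
  assumes \<gamma>: "dunford_contour eigenvalues \<gamma>"
    and \<zeta>m: "\<zeta> \<in> borel_measurable borel" and \<zeta>: "\<And>y. 0 < \<zeta> y"
  shows "\<kappa> \<in> borel_measurable borel \<Longrightarrow> integrable lborel (\<lambda>y. \<kappa> y / \<zeta> y) \<Longrightarrow>
    h holomorphic_on - \<real>\<^sub>\<le>\<^sub>0 \<Longrightarrow> (\<And>z :: complex. z \<notin> \<real>\<^sub>\<le>\<^sub>0 \<Longrightarrow> h z = (LINT y|lborel. \<kappa> y / (\<zeta> y + z))) \<Longrightarrow>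
    v \<in> W \<Longrightarrow> set L \<subseteq> eigenvalues \<Longrightarrow> chain L v = (\<lambda>x. 0) \<Longrightarrow>
    integrable lborel (\<lambda>y. \<kappa> y * chain_resolvent (- of_real (\<zeta> y)) L v x) \<and>
    Phi \<gamma> h v x = (LINT y|lborel. \<kappa> y * (- chain_resolvent (- of_real (\<zeta> y)) L v x))"
proof (induction L arbitrary: \<kappa> h v)
  case Nil
  then show ?case using Phi_zero[OF \<gamma>] by simp
next
  case (Cons l L \<kappa> h v)
  have l: "l \<in> eigenvalues" "l \<notin> \<real>\<^sub>\<le>\<^sub>0" using Cons.prems eigenvalue_not_nonpos by auto
  let ?k = "\<lambda>y. - (\<kappa> y / (\<zeta> y + l))"
  note ints = kernel_integrable[OF \<zeta>m Cons.prems(1) \<zeta> Cons.prems(2) l(2)]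
  have IH: "integrable lborel (\<lambda>y. ?k y * chain_resolvent (- of_real (\<zeta> y)) L (shift l v) x) \<and>
    Phi \<gamma> (slope l h) (shift l v) x = (LINT y|lborel. ?k y * (- chain_resolvent (- of_real (\<zeta> y)) L (shift l v) x))"
  proof (rule Cons.IH)
    show "?k \<in> borel_measurable borel" using Cons.prems(1) \<zeta>m by measurable
    show "integrable lborel (\<lambda>y. ?k y / \<zeta> y)" using ints(2) by simp
    show "slope l h z = (LINT y|lborel. ?k y / (\<zeta> y + z))" if "z \<notin> \<real>\<^sub>\<le>\<^sub>0" for z :: complex
      using Cons.prems(4) l(2) that by (rule slope_kernel[OF \<zeta>m Cons.prems(1) \<zeta> Cons.prems(2,3)])
  qed (use Cons.prems in \<open>auto simp: shift_mem slope_holomorphic\<close>)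
  have eq: "\<kappa> y * chain_resolvent (- of_real (\<zeta> y)) (l # L) v x = ?k y * v x + ?k y * chain_resolvent (- of_real (\<zeta> y)) L (shift l v) x" for y
  proof -
    have "- complex_of_real (\<zeta> y) - l = - (\<zeta> y + l)" by simp
    then show ?thesis by (simp only: chain_resolvent.simps divide_minus_right) (simp add: algebra_simps add_divide_distrib)
  qed
  have int1: "integrable lborel (\<lambda>y. ?k y * v x)" by (intro integrable_mult_left integrable_minus ints(1))
  have "integrable lborel (\<lambda>y. \<kappa> y * chain_resolvent (- of_real (\<zeta> y)) (l # L) v x)"
    unfolding eq using IH int1 by (intro Bochner_Integration.integrable_add) auto
  moreover have "Phi \<gamma> h v x = (LINT y|lborel. \<kappa> y * (- chain_resolvent (- of_real (\<zeta> y)) (l # L) v x))"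
  proof -
    have "(LINT y|lborel. \<kappa> y * (- chain_resolvent (- of_real (\<zeta> y)) (l # L) v x)) =
        - (LINT y|lborel. ?k y * v x + ?k y * chain_resolvent (- of_real (\<zeta> y)) L (shift l v) x)"
      by (simp only: mult_minus_right eq Bochner_Integration.integral_minus)
    also have "\<dots> = - (LINT y|lborel. ?k y * v x) - (LINT y|lborel. ?k y * chain_resolvent (- of_real (\<zeta> y)) L (shift l v) x)"
      by (simp only: Bochner_Integration.integral_add[OF int1 conjunct1[OF IH]] minus_add_distrib diff_conv_add_uminus)
    also have "(LINT y|lborel. ?k y * v x) = - h l * v x"
      by (simp only: Bochner_Integration.integral_mult_left_zero Bochner_Integration.integral_minus Cons.prems(4)[OF l(2)])
    also have "- (- h l * v x) - (LINT y|lborel. ?k y * chain_resolvent (- of_real (\<zeta> y)) L (shift l v) x) = h l * v x + Phi \<gamma> (slope l h) (shift l v) x"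
      unfolding conjunct2[OF IH] by (simp only: mult_minus_right Bochner_Integration.integral_minus) simp
    finally show ?thesis using Phi_step[OF \<gamma> Cons.prems(3,5) l(1)] by simp
  qed
  ultimately show ?case by blast
qed

text \<open>By multiplicativity of \<open>Phi\<close> the two operators are inverse to each other on
  \<open>W\<close>: the left inverse gives the injectivity that \<open>inv_into\<close> relies on,
  the right inverse the value.\<close>

lemma u_exact_eq_Phi:
  assumes \<alpha>: "0 < \<alpha>" "\<alpha> < 1" and b: "0 < b" and g: "g \<in> W"
  obtains \<gamma> where "dunford_contour eigenvalues \<gamma>" "u_exact W B \<alpha> b g = Phi \<gamma> (\<lambda>z. 1 / (z powr of_real \<alpha> + of_real b)) g"
proof -
  define \<gamma> where "\<gamma> = (SOME \<gamma>. dunford_contour (op_spectrum W B) \<gamma>)"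
  have \<gamma>: "dunford_contour eigenvalues \<gamma>"
    unfolding \<gamma>_def spectrum_eq using dunford_contour_exists by (rule someI_ex)
  let ?p = "\<lambda>z. z powr of_real \<alpha> :: complex" and ?h = "\<lambda>z. 1 / (z powr of_real \<alpha> + of_real b) :: complex"
  have p: "?p holomorphic_on - \<real>\<^sub>\<le>\<^sub>0" by (intro holomorphic_intros) auto
  then have q: "(\<lambda>z. 1 * ?p z + of_real b * 1) holomorphic_on - \<real>\<^sub>\<le>\<^sub>0" by (intro holomorphic_intros) auto
  have h: "?h holomorphic_on - \<real>\<^sub>\<le>\<^sub>0" using p powr_slit_ne_neg[OF \<alpha> b] by (intro holomorphic_intros) auto
  have F: "(\<lambda>x. fractional_power W B \<alpha> w x + of_real b * w x) = Phi \<gamma> (\<lambda>z. 1 * ?p z + of_real b * 1) w" if "w \<in> W" for w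
  proof -
    have "fractional_power W B \<alpha> w x = Phi \<gamma> ?p w x" for x
      by (simp add: fractional_power_def Phi_def \<gamma>_def)
    moreover have "(\<lambda>z. 1) holomorphic_on - \<real>\<^sub>\<le>\<^sub>0" by (intro holomorphic_intros)
    ultimately show ?thesis
      using Phi_fun_lincomb[OF \<gamma> p _ that, of "\<lambda>z. 1" 1 "of_real b"] Phi_one[OF \<gamma> that] by simp
  qed
  have right: "Phi \<gamma> (\<lambda>z. 1 * ?p z + of_real b * 1) (Phi \<gamma> ?h w) = w" if "w \<in> W" for w
  proof -
    have "Phi \<gamma> (\<lambda>z. 1 * ?p z + of_real b * 1) (Phi \<gamma> ?h w) = Phi \<gamma> (\<lambda>z. (1 * ?p z + of_real b * 1) * ?h z) w"
      by (rule Phi_mult[OF \<gamma> q h that])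
    also have "\<dots> = Phi \<gamma> (\<lambda>z. 1) w" using powr_slit_ne_neg[OF \<alpha> b] by (intro Phi_cong[OF \<gamma>]) simp
    finally show ?thesis using Phi_one[OF \<gamma> that] by simp
  qed
  have left: "Phi \<gamma> ?h (Phi \<gamma> (\<lambda>z. 1 * ?p z + of_real b * 1) w) = w" if "w \<in> W" for w
  proof -
    have "Phi \<gamma> ?h (Phi \<gamma> (\<lambda>z. 1 * ?p z + of_real b * 1) w) = Phi \<gamma> (\<lambda>z. ?h z * (1 * ?p z + of_real b * 1)) w"
      by (rule Phi_mult[OF \<gamma> h q that])
    also have "\<dots> = Phi \<gamma> (\<lambda>z. 1) w" using powr_slit_ne_neg[OF \<alpha> b] by (intro Phi_cong[OF \<gamma>]) simp
    finally show ?thesis using Phi_one[OF \<gamma> that] by simp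
  qed
  have "u_exact W B \<alpha> b g = Phi \<gamma> ?h g"
    unfolding u_exact_def
  proof (rule inv_into_f_eq)
    show "inj_on (\<lambda>w x. fractional_power W B \<alpha> w x + of_real b * w x) W"
      by (rule inj_on_inverseI[where g = "Phi \<gamma> ?h"]) (simp only: F left)
    show "Phi \<gamma> ?h g \<in> W" by (rule Phi_mem[OF \<gamma> h g])
    then show "(\<lambda>x. fractional_power W B \<alpha> (Phi \<gamma> ?h g) x + of_real b * Phi \<gamma> ?h g x) = g" by (simp only: F right[OF g])
  qed
  then show ?thesis using that \<gamma> by blast
qed

text \<open>One pole factor absorbs \<open>t\<close>, since \<open>cmod (t + l) \<ge> t\<close> for
  \<open>Re l > 0\<close>; every further factor is at most \<open>1 / Re l\<close>. The condition on
  \<open>k\<close> ensures that there is a first factor.\<close>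

lemma chain_coeff_nonneg_bound:
  assumes "set L \<subseteq> eigenvalues" "k < length L"
  obtains K where "\<And>t::real. 0 < t \<Longrightarrow> cmod (- of_real t * chain_coeff L k (- of_real t)) \<le> K"
proof -
  have "\<exists>K. \<forall>t>0. cmod (of_real t * (\<Prod>l\<in>#M. 1 / (- complex_of_real t - l))) \<le> K"
    if "set_mset M \<subseteq> eigenvalues" "M \<noteq> {#}" for M
    using that
  proof (induction M)
    case (add l M)
    have l: "0 < Re l" using eigenvalue_sector add.prems by auto
    have ge: "t \<le> cmod (- of_real t - l)" "Re l \<le> cmod (- of_real t - l)" if "0 < t" for t
      using complex_Re_le_cmod[of "of_real t + l"] l that norm_minus_cancel[of "of_real t + l"] by auto
    show ?case
    proof (cases "M = {#}")
      case True
      have "cmod (of_real t * (\<Prod>l\<in>#add_mset l M. 1 / (- of_real t - l))) \<le> 1" if "0 < t" for t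
        using ge[OF that] that by (simp add: True norm_mult norm_divide divide_le_eq_1)
      then show ?thesis by blast
    next
      case False
      then obtain K where K: "\<And>t. 0 < t \<Longrightarrow> cmod (of_real t * (\<Prod>l\<in>#M. 1 / (- of_real t - l))) \<le> K"
        using add by auto
      have "cmod (of_real t * (\<Prod>l\<in>#add_mset l M. 1 / (- of_real t - l))) \<le> K / Re l" if "0 < t" for t
      proof -
        have "cmod (of_real t * (\<Prod>l\<in>#add_mset l M. 1 / (- of_real t - l))) = cmod (of_real t * (\<Prod>l\<in>#M. 1 / (- of_real t - l))) / cmod (- of_real t - l)"
          by (simp add: norm_mult norm_divide)
        also have "\<dots> \<le> K / Re l" using K[OF that] ge(2)[OF that] l by (intro frac_le) (auto intro: order_trans[OF norm_ge_zero])
        finally show ?thesis .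
      qed
      then show ?thesis by blast
    qed
  qed simp
  moreover have "set_mset (mset (take (Suc k) L)) \<subseteq> eigenvalues" using assms(1) set_take_subset[of "Suc k" L] by auto
  moreover have "mset (take (Suc k) L) \<noteq> {#}" using assms(2) by auto
  ultimately obtain K where "\<And>t. 0 < t \<Longrightarrow> cmod (of_real t * (\<Prod>l\<in>#mset (take (Suc k) L). 1 / (- complex_of_real t - l))) \<le> K" by blast
  then have "cmod (- of_real t * chain_coeff L k (- of_real t)) \<le> K" if "0 < t" for t
    using that by (simp add: chain_coeff_def norm_mult)
  then show ?thesis by (rule that)
qed

text \<open>The equation is tested with \<open>w\<close> and multiplied by
  \<open>cis \<sigma>\<close>. The angle \<open>\<sigma> - \<theta>\<close> is one that the sector
  tolerates, so the operator term has nonnegative real part; \<sigma> itself is at most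
  \<open>pi / 2 - m\<close> in modulus, which leaves \<open>cos \<sigma> \<ge> sin m\<close> in
  front of the norm.\<close>

lemma resolvent_bound:
  assumes "g \<in> W" "w \<in> W" "(\<lambda>x. w x + of_real t * cis (- \<theta>) * B w x) = g" "0 \<le> t"
    and m: "0 < m" "m \<le> pi / 2" "\<bar>\<theta>\<bar> \<le> pi - arctan \<beta> - m"
  shows "sin m * nrm w \<le> nrm g"
proof -
  \<comment> \<open>The excess of \<open>\<bar>\<theta>\<bar>\<close> over
    \<open>pi / 2 - arctan \<beta>\<close>, with the sign of \<theta>: the least rotation that
    serves the operator term.\<close>
  define \<sigma> where "\<sigma> = sgn \<theta> * max 0 (\<bar>\<theta>\<bar> - (pi / 2 - arctan \<beta>))"
  have w: "0 \<le> arctan \<beta>" "arctan \<beta> < pi / 2" using \<beta>_nonneg arctan_ubound[of \<beta>] by auto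
  have \<sigma>: "\<bar>\<sigma>\<bar> \<le> pi / 2 - m" using m by (auto simp: \<sigma>_def abs_mult sgn_if)
  have \<eta>: "\<bar>\<sigma> - \<theta>\<bar> \<le> pi / 2 - arctan \<beta>" using w by (auto simp: \<sigma>_def sgn_if max_def abs_if split: if_splits)
  have "sin m = cos (pi / 2 - m)" by (simp add: cos_diff)
  also have "\<dots> \<le> cos \<bar>\<sigma>\<bar>" using \<sigma> m by (intro cos_monotone_0_pi_le) auto
  finally have cs: "sin m \<le> cos \<sigma>" by simp
  let ?p = "ip (B w) w"
  have Re_p: "0 \<le> Re ?p" using coercive[OF assms(2)] c0_pos ip_self_nonneg[OF assms(2)] by (meson mult_nonneg_nonneg less_imp_le order_trans)
  have "ip g w = ip (\<lambda>x. 1 * w x + (of_real t * cis (- \<theta>)) * B w x) w" unfolding assms(3)[symmetric] by simp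
  also have "\<dots> = ip w w + of_real t * cis (- \<theta>) * ?p" using assms(2) by (subst ip_lincomb) (auto simp: B_mem)
  finally have "cis \<sigma> * ip g w = of_real ((nrm w)\<^sup>2) * cis \<sigma> + of_real t * ((cis \<sigma> * cis (- \<theta>)) * ?p)"
    unfolding ip_self[OF assms(2)] by (simp only: distrib_left mult_ac)
  moreover have "cis \<sigma> * cis (- \<theta>) = cis (\<sigma> - \<theta>)" by (simp add: cis_mult)
  moreover have "Re (complex_of_real a * z) = a * Re z" for a z by simp
  ultimately have "Re (cis \<sigma> * ip g w) = (nrm w)\<^sup>2 * cos \<sigma> + t * Re (cis (\<sigma> - \<theta>) * ?p)"
    by (simp only: plus_complex.sel cis.sel)
  also have "\<dots> \<ge> (nrm w)\<^sup>2 * sin m + 0"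
    using cs assms(4) rotated_sector_Re_nonneg[OF \<beta>_nonneg sectorial[OF assms(2)] Re_p \<eta>]
    by (intro add_mono mult_left_mono mult_nonneg_nonneg) auto
  finally have "(nrm w)\<^sup>2 * sin m \<le> cmod (cis \<sigma> * ip g w)"
    using complex_Re_le_cmod[of "cis \<sigma> * ip g w"] by linarith
  also have "\<dots> \<le> nrm g * nrm w" using Cauchy_Schwarz[OF assms(1,2)] by (simp add: norm_mult)
  finally have "(sin m * nrm w) * nrm w \<le> nrm g * nrm w" by (simp add: power2_eq_square mult_ac)
  then show ?thesis
    using nrm_nonneg[OF assms(2)] nrm_nonneg[OF assms(1)] by (cases "nrm w = 0") auto
qed

end

section \<open>The quadrature error for an accretive operator\<close>

lemma log_kernel_translate:
  assumes "0 < \<epsilon>"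
  shows "integrable lborel (\<lambda>x. log_kernel \<epsilon> (x - c))" "(LINT x|lborel. log_kernel \<epsilon> (x - c)) = 2 * ln (1 + 1 / \<epsilon>)"
    "((\<lambda>x. log_kernel \<epsilon> (x - c)) \<longlongrightarrow> 0) at_top" "((\<lambda>x. log_kernel \<epsilon> (x - c)) \<longlongrightarrow> 0) at_bot"
proof -
  note I = log_kernel_has_integral[OF assms, unfolded has_bochner_integral_iff]
  show "integrable lborel (\<lambda>x. log_kernel \<epsilon> (x - c))"
    using lborel_integrable_real_affine[OF conjunct1[OF I], of 1 "- c"] by simp
  show "(LINT x|lborel. log_kernel \<epsilon> (x - c)) = 2 * ln (1 + 1 / \<epsilon>)"
    using lborel_integral_real_affine[of 1 "log_kernel \<epsilon>" "- c"] conjunct2[OF I] by simp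
  show "((\<lambda>x. log_kernel \<epsilon> (x - c)) \<longlongrightarrow> 0) at_top" "((\<lambda>x. log_kernel \<epsilon> (x - c)) \<longlongrightarrow> 0) at_bot"
    unfolding log_kernel_def using assms by real_asymp+
qed

lemma has_sum_finite_sum:
  fixes f :: "'k \<Rightarrow> 'b \<Rightarrow> 'c :: {comm_monoid_add, topological_comm_monoid_add}"
  assumes "finite K" "\<And>k. k \<in> K \<Longrightarrow> (f k has_sum s k) A"
  shows "((\<lambda>x. \<Sum>k\<in>K. f k x) has_sum (\<Sum>k\<in>K. s k)) A"
  using assms by (induction K rule: finite_induct) (auto intro: has_sum_add)

context accretive_operator
begin

text \<open>A rotation by at most \<open>pi / 2 - arctan \<beta>\<close> keeps every eigenvalue in
  the closed right half-plane but moves \<open>- exp z\<close> into the open left one. With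
  \<open>z / \<alpha>\<close> for \<open>z\<close>, this makes the integrand analytic up to height
  \<open>\<alpha> * (pi - arctan \<beta>)\<close>.\<close>

lemma neg_exp_not_eigenvalue:
  assumes "\<bar>Im z\<bar> < pi - arctan \<beta>"
  shows "- exp z \<notin> eigenvalues"
proof
  assume ev: "- exp z \<in> eigenvalues"
  have w: "0 \<le> arctan \<beta>" "arctan \<beta> < pi / 2" using \<beta>_nonneg arctan_ubound[of \<beta>] by auto
  \<comment> \<open>Turns \<open>exp z\<close> towards the positive axis as far as the sector
    allows; what remains of the angle is below \<open>pi / 2\<close>.\<close>
  define \<eta> where "\<eta> = - sgn (Im z) * min \<bar>Im z\<bar> (pi / 2 - arctan \<beta>)"
  have "\<bar>\<eta>\<bar> \<le> pi / 2 - arctan \<beta>" using w by (auto simp: \<eta>_def abs_mult sgn_if)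
  then have "0 \<le> Re (cis \<eta> * (- exp z))"
    using eigenvalue_sector[OF ev] \<beta>_nonneg by (intro rotated_sector_Re_nonneg) auto
  also have "cis \<eta> * (- exp z) = - (of_real (exp (Re z)) * cis (\<eta> + Im z))"
    by (simp add: exp_eq_polar cis_mult[symmetric] mult_ac)
  finally have "exp (Re z) * cos (\<eta> + Im z) \<le> 0" by simp
  moreover have "0 < cos (\<eta> + Im z)"
  proof (rule cos_gt_zero_pi)
    have "\<bar>\<eta> + Im z\<bar> < pi / 2" using assms w pi_gt_zero by (auto simp: \<eta>_def sgn_if min_def abs_if split: if_splits)
    then show "- (pi / 2) < \<eta> + Im z" "\<eta> + Im z < pi / 2" by linarith+
  qed
  ultimately show False by (simp add: mult_le_0_iff)
qed

text \<open>The factors are the prefactor of the formula, the 2 and the exponential of the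
  quadrature theorem, the 80 of the weight bound, the integral of \<open>log_kernel\<close>, and
  \<open>nrm g / sin m\<close> from the resolvent. The height \<open>d\<close> of the strip stays
  free.\<close>

theorem sinc_approximation_error:
  assumes \<alpha>: "0 < \<alpha>" "\<alpha> < 1" and b: "0 < b" and \<tau>: "0 < \<tau>" and g: "g \<in> W"
    and d: "0 < d" "d < \<alpha> * (pi - arctan \<beta>)" "d < (1 - \<alpha>) * pi"
  defines "u \<equiv> u_exact W B \<alpha> b g" and "u' \<equiv> u_sinc W B \<alpha> b \<tau> g"
    and "m \<equiv> min ((\<alpha> * (pi - arctan \<beta>) - d) / \<alpha>) (pi / 2)" and "\<epsilon> \<equiv> (1 - \<alpha>) * pi - d"
  shows "nrm (\<lambda>x. u x - u' x) \<le>
    sin (pi * \<alpha>) / (\<alpha> * pi) * (2 * (80 / (min \<alpha> (1 - \<alpha>) * b) * (2 * ln (1 + 1 / \<epsilon>)) * (nrm g / sin m)) / (exp (2 * pi * d / \<tau>) - 1))"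
proof -
  define s where "s = sin (pi * \<alpha>) / (\<alpha> * pi)"
  define D where "D = min (\<alpha> * (pi - arctan \<beta>)) ((1 - \<alpha>) * pi)"
  define Z where "Z z = exp (z / of_real \<alpha>)" for z :: complex
  have s: "0 \<le> s" using \<alpha> by (auto simp: s_def intro!: divide_nonneg_nonneg sin_ge_zero)
  have dD: "d < D" using d by (simp add: D_def)
  have \<epsilon>: "0 < \<epsilon>" using d by (simp add: \<epsilon>_def)
  have m: "0 < m" "m \<le> pi / 2" unfolding m_def using d \<alpha> by (simp, intro min.cobounded2)
  have sm: "0 < sin m" using m by (intro sin_gt_zero) auto
  obtain L where L: "set L \<subseteq> eigenvalues" "chain L g = (\<lambda>x. 0)" by (rule chain_exists[OF g])
  define v where "v k = chain (take k L) g" for k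
  have v: "v k \<in> W" for k unfolding v_def by (rule chain_mem[OF g])
  \<comment> \<open>The coefficient of \<open>v k\<close> in the Newton expansion of the integrand.
    The integral and the sum use the same functions, so both \<open>u\<close> and \<open>u'\<close>
    become finite combinations of the \<open>v k\<close>.\<close>
  define C where "C k z = - Z z * chain_coeff L k (- Z z) * bal_weight \<alpha> b z" for k z
  have Zreal: "Z (of_real y) = of_real (exp (y / \<alpha>))" for y
    by (simp add: Z_def flip: exp_of_real)
  have Zev: "- Z z \<notin> eigenvalues" if "\<bar>Im z\<bar> < D" for z
    unfolding Z_def using that \<alpha> by (intro neg_exp_not_eigenvalue) (auto simp: D_def field_simps)
  have wne: "exp z + of_real (2 * b * cos (pi * \<alpha>)) + of_real (b\<^sup>2) * exp (- z) \<noteq> 0" if "\<bar>Im z\<bar> < D" for z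
    using bal_weight_bound(2)[OF \<alpha> b order_refl, of "Im z" "Re z"] that by (simp add: D_def)
  have Cholo: "C k holomorphic_on {z. \<bar>Im z\<bar> < D}" for k
  proof -
    have "(\<lambda>z. chain_coeff L k (- Z z)) holomorphic_on {z. \<bar>Im z\<bar> < D}"
      using Zev L(1) \<alpha> by (intro holomorphic_on_compose_gen[OF _ chain_coeff_holomorphic, unfolded o_def])
        (auto simp: Z_def intro!: holomorphic_intros)
    then show ?thesis
      unfolding C_def[abs_def] bal_weight_def Z_def using wne \<alpha> by (intro holomorphic_intros) auto
  qed
  let ?A = "80 / (min \<alpha> (1 - \<alpha>) * b)"
  have A: "0 \<le> ?A" using \<alpha> b by simp
  have wbound: "cmod (bal_weight \<alpha> b (Complex x y)) \<le> ?A * log_kernel \<epsilon> (x - ln b)" if "\<bar>y\<bar> \<le> d" for x y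
    unfolding \<epsilon>_def by (rule bal_weight_bound(1)[OF \<alpha> b that d(3)])
  \<comment> \<open>This \<open>K\<close> depends on the eigenvalues; it is used for integrability
    and summability and does not reach the estimate.\<close>
  have Cbound: "\<exists>K. \<forall>y. cmod (C k (of_real y)) \<le> K * log_kernel \<epsilon> (y - ln b)" if k: "k < length L" for k
  proof -
    obtain K where K: "\<And>t::real. 0 < t \<Longrightarrow> cmod (- of_real t * chain_coeff L k (- of_real t)) \<le> K"
      by (rule chain_coeff_nonneg_bound[OF L(1) k]) blast
    have "cmod (C k (of_real y)) \<le> K * (?A * log_kernel \<epsilon> (y - ln b))" for y
      unfolding C_def norm_mult[of "_ * _" "bal_weight _ _ _"] Zreal
      using K[of "exp (y / \<alpha>)"] wbound[of 0 y] d A log_kernel_pos[OF \<epsilon>, of "y - ln b"]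
      by (intro mult_mono) (auto simp: complex_of_real_def intro: order_trans[OF norm_ge_zero])
    then show ?thesis by (intro exI[of _ "K * ?A"]) (simp add: mult.assoc)
  qed
  have Cint: "integrable lborel (\<lambda>y. C k (of_real y))" if k: "k < length L" for k
  proof -
    obtain K where K: "\<And>y. cmod (C k (of_real y)) \<le> K * log_kernel \<epsilon> (y - ln b)" using Cbound[OF k] by blast
    have "integrable lborel (\<lambda>x. K * log_kernel \<epsilon> (x - ln b))"
      using log_kernel_translate(1)[OF \<epsilon>] by (intro integrable_mult_right)
    then have "integrable lborel (\<lambda>x. C k (Complex x 0))"
      by (rule holomorphic_line_integrable[OF Cholo, rotated 1]) (use dD d K in \<open>simp_all add: complex_of_real_def\<close>)
    then show ?thesis by (simp add: complex_of_real_def)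
  qed
  have Csum: "(\<lambda>n::int. C k (of_real (n * \<tau>))) summable_on UNIV" if k: "k < length L" for k
  proof -
    obtain K where K: "\<And>y. cmod (C k (of_real y)) \<le> K * log_kernel \<epsilon> (y - ln b)" using Cbound[OF k] by blast
    have "(\<lambda>n::int. K * log_kernel \<epsilon> (n * \<tau> - ln b)) summable_on UNIV"
      by (intro summable_on_cmult_right log_kernel_summable_on \<epsilon> \<tau>)
    then have "(\<lambda>n::int. cmod (C k (of_real (n * \<tau>)))) summable_on UNIV"
      by (rule summable_on_comparison_test) (rule K, rule norm_ge_zero)
    then show ?thesis by (rule abs_summable_summable)
  qed
  \<comment> \<open>As long as \<open>- Z z\<close> avoids \<open>L\<close>, the function
    \<open>- Z z * chain_resolvent (- Z z) L g\<close> solves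
    \<open>w + exp (- z / \<alpha>) * B w = g\<close>, the equation behind the summands of
    \<open>u_sinc\<close>.\<close>
  have rzC: "- Z z * chain_resolvent (- Z z) L g x * bal_weight \<alpha> b z = (\<Sum>k<length L. C k z * v k x)" for z x
    by (simp add: chain_resolvent_explicit C_def v_def sum_distrib_left sum_distrib_right mult_ac sum_negf)
  define I where "I k = (LINT y|lborel. C k (of_real y))" for k
  define S where "S k = (\<Sum>\<^sub>\<infinity>n::int. C k (of_real (n * \<tau>)))" for k
  have Chas: "((\<lambda>n::int. \<Sum>k<length L. C k (of_real (n * \<tau>)) * a k) has_sum (\<Sum>k<length L. S k * a k)) UNIV" for a
    unfolding S_def by (intro has_sum_finite_sum has_sum_cmult_left has_sum_infsum Csum) auto
  have u_eq: "u x = s * (\<Sum>k<length L. I k * v k x)" for x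
  proof -
    obtain \<gamma> where \<gamma>: "dunford_contour eigenvalues \<gamma>" "u = Phi \<gamma> (\<lambda>z. 1 / (z powr of_real \<alpha> + of_real b)) g"
      unfolding u_def by (rule u_exact_eq_Phi[OF \<alpha> b g])
    let ?\<zeta> = "\<lambda>y. exp (y / \<alpha>)" and ?\<kappa> = "\<lambda>y. of_real s * (of_real (exp (y / \<alpha>)) * bal_weight \<alpha> b (of_real y))"
    have bm: "(\<lambda>y. bal_weight \<alpha> b (of_real y)) \<in> borel_measurable borel" unfolding bal_weight_def by measurable
    have bi: "integrable lborel (\<lambda>y. bal_weight \<alpha> b (of_real y))"
    proof (rule Bochner_Integration.integrable_bound)
      show "integrable lborel (\<lambda>x. ?A * log_kernel \<epsilon> (x - ln b))"
        using log_kernel_translate(1)[OF \<epsilon>] by (intro integrable_mult_right)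
      show "AE y in lborel. norm (bal_weight \<alpha> b (of_real y)) \<le> norm (?A * log_kernel \<epsilon> (y - ln b))"
        unfolding real_norm_def using wbound[of 0] d
        by (intro AE_I2 order_trans[OF _ abs_ge_self]) (auto simp: complex_of_real_def)
    qed (use bm in simp)
    have "integrable lborel (\<lambda>y. ?\<kappa> y * chain_resolvent (- of_real (?\<zeta> y)) L g x) \<and>
        Phi \<gamma> (\<lambda>z. 1 / (z powr of_real \<alpha> + of_real b)) g x = (LINT y|lborel. ?\<kappa> y * (- chain_resolvent (- of_real (?\<zeta> y)) L g x))"
    proof (rule Phi_kernel[OF \<gamma>(1)])
      show "?\<kappa> \<in> borel_measurable borel" using bm by measurable
      show "integrable lborel (\<lambda>y. ?\<kappa> y / of_real (?\<zeta> y))" using bi by simp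
      show "(\<lambda>z. 1 / (z powr of_real \<alpha> + of_real b)) holomorphic_on - \<real>\<^sub>\<le>\<^sub>0"
        using powr_slit_ne_neg[OF \<alpha> b] by (intro holomorphic_intros) auto
      show "1 / (z powr of_real \<alpha> + of_real b) = (LINT y|lborel. ?\<kappa> y / (of_real (?\<zeta> y) + z))" if "z \<notin> \<real>\<^sub>\<le>\<^sub>0" for z
      proof -
        have "?\<kappa> y / (of_real (?\<zeta> y) + z) = of_real s * (of_real (exp (y / \<alpha>)) / (of_real (exp (y / \<alpha>)) + z) * bal_weight \<alpha> b (of_real y))" for y
          by simp
        then show ?thesis unfolding balakrishnan_kernel[OF \<alpha> b that] s_def[symmetric]
          by (simp only: Bochner_Integration.integral_mult_right_zero)
      qed
    qed (use g L in auto)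
    then have "u x = (LINT y|lborel. ?\<kappa> y * (- chain_resolvent (- of_real (?\<zeta> y)) L g x))" using \<gamma>(2) by simp
    also have "\<dots> = (LINT y|lborel. of_real s * (\<Sum>k<length L. C k (of_real y) * v k x))"
    proof (rule Bochner_Integration.integral_cong[OF refl])
      fix y
      show "?\<kappa> y * (- chain_resolvent (- of_real (?\<zeta> y)) L g x) = of_real s * (\<Sum>k<length L. C k (of_real y) * v k x)"
        unfolding rzC[of "of_real y" x, symmetric] Zreal by simp
    qed
    also have "\<dots> = of_real s * (\<Sum>k<length L. LINT y|lborel. C k (of_real y) * v k x)"
      using Cint by (subst Bochner_Integration.integral_mult_right_zero) (subst Bochner_Integration.integral_sum, auto)
    finally show ?thesis unfolding I_def by simp
  qed
  have u'_eq: "u' x = s * \<tau> * (\<Sum>k<length L. S k * v k x)" for x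
  proof -
    have summand: "inv_into W (\<lambda>w y. w y + of_real (exp (- (of_int n * \<tau>) / \<alpha>)) * B w y) g x /
        of_real (exp (of_int n * \<tau>) + 2 * b * cos (pi * \<alpha>) + b\<^sup>2 * exp (- (of_int n * \<tau>))) = (\<Sum>k<length L. C k (of_real (n * \<tau>)) * v k x)" for n :: int
    proof -
      let ?z = "complex_of_real (n * \<tau>)"
      let ?r = "chain_resolvent (- Z ?z) L g" and ?t = "complex_of_real (exp (- (of_int n * \<tau>) / \<alpha>))"
      have ev: "- Z ?z \<notin> eigenvalues" using Zev[of ?z] dD d by simp
      then have "- Z ?z \<notin> set L" using L(1) by blast
      note r = chain_resolvent_solves[OF g L(2) this]
      have tZ: "?t * Z ?z = 1" unfolding Zreal by (simp add: exp_minus flip: of_real_mult)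
      have Z0: "Z ?z \<noteq> 0" by (simp add: Z_def)
      have shift_eq: "?t * (Z ?z * w y + B w y) = w y + ?t * B w y" for w y
        using tZ by (simp add: distrib_left mult.assoc[symmetric])
      have "inv_into W (\<lambda>w y. w y + ?t * B w y) g = (\<lambda>y. - Z ?z * ?r y)"
      proof (rule inv_into_f_eq)
        show "inj_on (\<lambda>w y. w y + ?t * B w y) W"
        proof (rule inj_onI)
          fix w w' assume ww: "w \<in> W" "w' \<in> W" "(\<lambda>y. w y + ?t * B w y) = (\<lambda>y. w' y + ?t * B w' y)"
          have "Z ?z * w y + B w y = Z ?z * w' y + B w' y" for y
          proof -
            have "?t * (Z ?z * w y + B w y) = ?t * (Z ?z * w' y + B w' y)" unfolding shift_eq using fun_cong[OF ww(3), of y] .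
            then show ?thesis by simp
          qed
          then have "- Z ?z * w y - B w y = - Z ?z * w' y - B w' y" for y
            by (metis minus_add_distrib diff_conv_add_uminus mult_minus_left)
          then show "w = w'" by (intro resolvent_inj[OF ww(1,2) ev] ext)
        qed
        show "(\<lambda>y. - Z ?z * ?r y) \<in> W" by (intro scale_mem conjunct1[OF r])
        show "(\<lambda>y. - Z ?z * ?r y + ?t * B (\<lambda>y. - Z ?z * ?r y) y) = g"
        proof
          fix y
          have "- Z ?z * ?r y + ?t * B (\<lambda>y. - Z ?z * ?r y) y = - Z ?z * ?r y - (?t * Z ?z) * B ?r y"
            by (subst B_scale[OF conjunct1[OF r]]) (simp add: mult.assoc)
          also have "\<dots> = - Z ?z * ?r y - B ?r y" unfolding tZ by simp
          also have "\<dots> = g y" using fun_cong[OF conjunct2[OF r], of y] .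
          finally show "- Z ?z * ?r y + ?t * B (\<lambda>y. - Z ?z * ?r y) y = g y" .
        qed
      qed
      note a = this
      have w: "1 / of_real (exp (of_int n * \<tau>) + 2 * b * cos (pi * \<alpha>) + b\<^sup>2 * exp (- (of_int n * \<tau>))) = bal_weight \<alpha> b ?z"
        unfolding bal_weight_def of_real_minus[symmetric] exp_of_real by (simp only: of_real_add of_real_mult)
      show ?thesis
        by (simp only: a rzC[symmetric] w[symmetric] times_divide_eq_right mult_1_right)
    qed
    have "(\<Sum>\<^sub>\<infinity>n::int. \<Sum>k<length L. C k (of_real (n * \<tau>)) * v k x) = (\<Sum>k<length L. S k * v k x)"
      by (rule infsumI[OF Chas])
    then show ?thesis unfolding u'_def u_sinc_def summand s_def by simp
  qed
  define e where "e = (\<lambda>x. u x - u' x)"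
  have e_eq: "e = (\<lambda>x. \<Sum>k<length L. (of_real s * (I k - of_real \<tau> * S k)) * v k x)"
    unfolding e_def u_eq u'_eq by (simp add: sum_distrib_left sum_subtractf algebra_simps)
  have e: "e \<in> W" unfolding e_eq by (intro sum_mem v) auto
  \<comment> \<open>The dependence on \<open>z\<close> sits in the first, linear argument of
    \<open>ip\<close>, so the tested function is holomorphic.\<close>
  define F where "F z = (\<Sum>k<length L. C k z * ip (v k) e)" for z
  have Fip: "F z = bal_weight \<alpha> b z * ip (\<lambda>x. - Z z * chain_resolvent (- Z z) L g x) e" for z
  proof -
    have "(\<lambda>x. - Z z * chain_resolvent (- Z z) L g x) = (\<lambda>x. \<Sum>k<length L. (- Z z * chain_coeff L k (- Z z)) * v k x)"
      by (simp add: chain_resolvent_explicit v_def sum_distrib_left mult.assoc sum_negf)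
    then have "ip (\<lambda>x. - Z z * chain_resolvent (- Z z) L g x) e = (\<Sum>k<length L. (- Z z * chain_coeff L k (- Z z)) * ip (v k) e)"
      by (simp only: ip_sum[OF finite_lessThan v e])
    then show ?thesis by (simp add: F_def C_def sum_distrib_left mult_ac sum_negf)
  qed
  \<comment> \<open>The factor \<open>nrm e\<close> from Cauchy-Schwarz stays in the majorant and is
    cancelled against \<open>(nrm e)\<^sup>2\<close> at the end.\<close>
  let ?M = "nrm g / sin m * nrm e"
  have M: "0 \<le> ?M" using nrm_nonneg[OF g] nrm_nonneg[OF e] sm by simp
  let ?\<phi> = "\<lambda>x. ?A * log_kernel \<epsilon> (x - ln b) * ?M"
  have Fbound: "cmod (F (Complex x y)) \<le> ?\<phi> x" if y: "\<bar>y\<bar> \<le> d" for x y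
  proof -
    let ?z = "Complex x y"
    let ?r = "chain_resolvent (- Z ?z) L g" and ?t = "exp (- (x / \<alpha>))"
    let ?w = "\<lambda>x. - Z ?z * ?r x"
    have "- Z ?z \<notin> set L" using Zev[of ?z] dD y L(1) by fastforce
    note r = chain_resolvent_solves[OF g L(2) this]
    have w: "?w \<in> W" by (intro scale_mem conjunct1[OF r])
    have "?z / of_real \<alpha> = Complex (x / \<alpha>) (y / \<alpha>)" using \<alpha> by (simp add: complex_eq_iff)
    then have "Z ?z = of_real (exp (x / \<alpha>)) * cis (y / \<alpha>)" by (simp add: Z_def exp_eq_polar)
    then have tZ: "(of_real ?t * cis (- (y / \<alpha>))) * Z ?z = 1"
      by (simp add: exp_minus cis_mult mult.assoc mult.left_commute[of "cis _"] flip: of_real_mult)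
    \<comment> \<open>At \<open>z = x + \<i> * y\<close> the operator is
      \<open>1 + t * cis (- \<theta>) * B\<close> with \<open>t = exp (- x / \<alpha>)\<close> and
      \<open>\<theta> = y / \<alpha>\<close>.\<close>
    have "sin m * nrm ?w \<le> nrm g"
    proof (rule resolvent_bound[OF g w])
      show "(\<lambda>x. ?w x + of_real ?t * cis (- (y / \<alpha>)) * B ?w x) = g"
      proof
        fix x'
        have "?w x' + of_real ?t * cis (- (y / \<alpha>)) * B ?w x' = - Z ?z * ?r x' - ((of_real ?t * cis (- (y / \<alpha>))) * Z ?z) * B ?r x'"
          by (subst B_scale[OF conjunct1[OF r]]) (simp add: mult.assoc)
        also have "\<dots> = - Z ?z * ?r x' - B ?r x'" unfolding tZ by simp
        also have "\<dots> = g x'" using fun_cong[OF conjunct2[OF r], of x'] .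
        finally show "?w x' + of_real ?t * cis (- (y / \<alpha>)) * B ?w x' = g x'" .
      qed
      have "\<bar>y / \<alpha>\<bar> \<le> d / \<alpha>" using y \<alpha> by (simp add: abs_div divide_right_mono)
      moreover have "m \<le> pi - arctan \<beta> - d / \<alpha>" using \<alpha> by (simp add: m_def diff_divide_distrib)
      ultimately show "\<bar>y / \<alpha>\<bar> \<le> pi - arctan \<beta> - m" by linarith
    qed (use m in auto)
    then have nw: "nrm ?w \<le> nrm g / sin m" using sm by (simp add: field_simps)
    have "cmod (ip ?w e) \<le> nrm ?w * nrm e" by (rule Cauchy_Schwarz[OF w e])
    also have "\<dots> \<le> ?M" using nw nrm_nonneg[OF e] by (intro mult_right_mono)
    finally have ipb: "cmod (ip ?w e) \<le> ?M" .
    show ?thesis unfolding Fip norm_mult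
      using wbound[OF y, of x] ipb M A log_kernel_pos[OF \<epsilon>, of "x - ln b"] by (intro mult_mono) auto
  qed
  have Fholo: "F holomorphic_on {z. \<bar>Im z\<bar> < D}"
    unfolding F_def[abs_def] by (intro holomorphic_intros Cholo)
  have Fsum: "(\<lambda>n::int. F (of_real (n * \<tau>))) summable_on UNIV"
    unfolding F_def using Chas[of "\<lambda>k. ip (v k) e"] by (auto simp: summable_on_def)
  have \<phi>int: "integrable lborel ?\<phi>" "(LINT x|lborel. ?\<phi> x) = ?A * (2 * ln (1 + 1 / \<epsilon>)) * ?M"
    using log_kernel_translate[OF \<epsilon>, of "ln b"] by auto
  have \<phi>lim: "(?\<phi> \<longlongrightarrow> 0) at_top" "(?\<phi> \<longlongrightarrow> 0) at_bot"
    by (intro tendsto_mult_left_zero tendsto_mult_right_zero log_kernel_translate(3,4)[OF \<epsilon>])+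
  have "cmod ((LINT x|lborel. F (of_real x)) - \<tau> * (\<Sum>\<^sub>\<infinity>n::int. F (of_real (n * \<tau>))))
     \<le> 2 * (LINT x|lborel. ?\<phi> x) / (exp (2 * pi * d / \<tau>) - 1)"
    by (rule sinc_quadrature_error[OF Fholo d(1) dD \<tau> \<phi>int(1) Fbound \<phi>lim Fsum])
  also have "(LINT x|lborel. F (of_real x)) - \<tau> * (\<Sum>\<^sub>\<infinity>n::int. F (of_real (n * \<tau>))) = (\<Sum>k<length L. (I k - \<tau> * S k) * ip (v k) e)"
  proof -
    have "(LINT x|lborel. F (of_real x)) = (\<Sum>k<length L. I k * ip (v k) e)"
      unfolding F_def I_def using Cint by (subst Bochner_Integration.integral_sum) auto
    moreover have "(\<Sum>\<^sub>\<infinity>n::int. F (of_real (n * \<tau>))) = (\<Sum>k<length L. S k * ip (v k) e)"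
    proof -
      show ?thesis unfolding F_def by (rule infsumI[OF Chas])
    qed
    ultimately show ?thesis by (simp add: sum_distrib_left sum_subtractf algebra_simps)
  qed
  finally have est: "cmod (\<Sum>k<length L. (I k - \<tau> * S k) * ip (v k) e) \<le> 2 * (?A * (2 * ln (1 + 1 / \<epsilon>)) * ?M) / (exp (2 * pi * d / \<tau>) - 1)"
    unfolding \<phi>int(2) .
  have "ip e e = of_real s * (\<Sum>k<length L. (I k - \<tau> * S k) * ip (v k) e)"
  proof -
    have "ip e e = (\<Sum>k<length L. (of_real s * (I k - of_real \<tau> * S k)) * ip (v k) e)"
      by (subst (1) e_eq) (rule ip_sum[OF finite_lessThan v e])
    then show ?thesis by (simp add: sum_distrib_left mult.assoc)
  qed
  then have "(nrm e)\<^sup>2 \<le> s * cmod (\<Sum>k<length L. (I k - \<tau> * S k) * ip (v k) e)"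
    unfolding nrm_power2[OF e] using s complex_Re_le_cmod[of "ip e e"] by (simp add: norm_mult)
  also have "\<dots> \<le> s * (2 * (?A * (2 * ln (1 + 1 / \<epsilon>)) * ?M) / (exp (2 * pi * d / \<tau>) - 1))"
    using est s by (intro mult_left_mono)
  finally have "nrm e * nrm e \<le> s * (2 * (?A * (2 * ln (1 + 1 / \<epsilon>)) * (nrm g / sin m)) / (exp (2 * pi * d / \<tau>) - 1)) * nrm e"
    by (simp add: power2_eq_square mult_ac)
  moreover have "0 \<le> s * (2 * (?A * (2 * ln (1 + 1 / \<epsilon>)) * (nrm g / sin m)) / (exp (2 * pi * d / \<tau>) - 1))"
    using s A \<alpha> b \<epsilon> sm nrm_nonneg[OF g] d \<tau> by (intro mult_nonneg_nonneg divide_nonneg_nonneg) auto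
  moreover have "x \<le> K" if "x * x \<le> K * x" "0 \<le> K" "0 \<le> x" for x K :: real
    using that by (cases "x = 0") auto
  ultimately have "nrm e \<le> s * (2 * (?A * (2 * ln (1 + 1 / \<epsilon>)) * (nrm g / sin m)) / (exp (2 * pi * d / \<tau>) - 1))"
    using nrm_nonneg[OF e] by blast
  then show ?thesis unfolding e_def s_def .
qed

end

section \<open>Lebesgue spaces on bounded domains\<close>

lemma coord_eq_inner: "coord x i = x \<bullet> unit_vec i"
proof -
  have "x \<bullet> unit_vec i = (\<Sum>k\<in>insert i (Poly_Mapping.keys x). coord x k \<bullet> coord (unit_vec i) k)"
    by (rule inner_poly_mapping_superset) auto
  also have "\<dots> = (\<Sum>k\<in>insert i (Poly_Mapping.keys x). if k = i then coord x i else 0)"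
    by (intro sum.cong refl) (auto simp: lookup_single when_def)
  finally show ?thesis by simp
qed

lemma norm_unit_vec: "norm (unit_vec i) = 1"
  by (simp add: norm_eq_sqrt_inner coord_eq_inner[symmetric])

lemma abs_coord_le_norm: "\<bar>coord x i\<bar> \<le> norm x"
  using Cauchy_Schwarz_ineq2[of x "unit_vec i"] by (simp add: coord_eq_inner norm_unit_vec)

lemma continuous_on_coord [continuous_intros]: "continuous_on S (\<lambda>x. coord x i)"
  unfolding coord_eq_inner by (intro continuous_intros)

lemma single_eq_scaleR: "Poly_Mapping.single i t = t *\<^sub>R unit_vec i"
  by (rule poly_mapping_eqI) (simp add: lookup_single when_def)

lemma sum_single_eq: "(\<Sum>i<d. Poly_Mapping.single i (f i)) = (\<Sum>i<d. f i *\<^sub>R unit_vec i)"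
  by (intro sum.cong refl single_eq_scaleR)

lemma euc_iff: "x \<in> euc d \<longleftrightarrow> (\<forall>i\<ge>d. coord x i = 0)"
  by (auto simp: euc_def in_keys_iff subset_iff not_le[symmetric])

lemma coord_sum_single: "coord (\<Sum>i<d. Poly_Mapping.single i (f i)) k = (if k < d then f k else 0)"
  by (simp add: lookup_sum lookup_single when_def)

lemma sum_single_coord: "x \<in> euc d \<Longrightarrow> (\<Sum>i<d. Poly_Mapping.single i (coord x i)) = x"
  by (rule poly_mapping_eqI) (auto simp: coord_sum_single euc_iff)

lemma sum_single_mem_euc: "(\<Sum>i<d. Poly_Mapping.single i (f i)) \<in> euc d"
  by (simp add: euc_iff coord_sum_single)

lemma add_unit_vec_mem_euc: "x \<in> euc d \<Longrightarrow> i < d \<Longrightarrow> x + t *\<^sub>R unit_vec i \<in> euc d"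
  by (auto simp: euc_iff lookup_add lookup_single)

lemma closed_euc: "closed (euc d)"
proof -
  have "euc d = (\<Inter>i\<in>{d..}. {x. coord x i = 0})" by (auto simp: euc_iff)
  moreover have "closed {x. coord x i = 0}" for i
    by (intro closed_Collect_eq continuous_intros)
  ultimately show ?thesis by auto
qed

text \<open>The type \<open>point\<close> is infinite-dimensional, so closed and bounded is not
  enough; compactness is built up one coordinate at a time, as a continuous image of a product with
  an interval.\<close>

lemma compact_euc_box: "compact {x \<in> euc d. \<forall>i<d. \<bar>coord x i\<bar> \<le> R}"
proof (induction d)
  case 0
  have "{x \<in> euc 0. \<forall>i<0. \<bar>coord x i\<bar> \<le> R} = {0}"
    by (auto simp: euc_iff intro!: poly_mapping_eqI)
  then show ?case by simp
next
  case (Suc d)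
  let ?K = "{x \<in> euc d. \<forall>i<d. \<bar>coord x i\<bar> \<le> R}"
  let ?f = "\<lambda>(x, t). x + t *\<^sub>R unit_vec d"
  have "{x \<in> euc (Suc d). \<forall>i<Suc d. \<bar>coord x i\<bar> \<le> R} = ?f ` (?K \<times> {- R..R})"
  proof (intro equalityI subsetI)
    fix x assume x: "x \<in> {x \<in> euc (Suc d). \<forall>i<Suc d. \<bar>coord x i\<bar> \<le> R}"
    let ?y = "x - coord x d *\<^sub>R unit_vec d"
    have "coord ?y i = (if i = d then 0 else coord x i)" for i by (simp add: lookup_minus lookup_single when_def)
    then have "?y \<in> ?K" using x by (auto simp: euc_iff)
    moreover have "coord x d \<in> {- R..R}" using x by (auto simp: abs_le_iff)
    ultimately show "x \<in> ?f ` (?K \<times> {- R..R})" by (intro image_eqI[of _ _ "(?y, coord x d)"]) auto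
  next
    fix x assume "x \<in> ?f ` (?K \<times> {- R..R})"
    then obtain y t where y: "y \<in> ?K" "t \<in> {- R..R}" "x = y + t *\<^sub>R unit_vec d" by auto
    have "coord x i = (if i = d then t else coord y i)" for i
      using y by (auto simp: lookup_add lookup_single when_def euc_iff)
    then show "x \<in> {x \<in> euc (Suc d). \<forall>i<Suc d. \<bar>coord x i\<bar> \<le> R}"
      using y by (auto simp: euc_iff less_Suc_eq)
  qed
  moreover have "compact (?f ` (?K \<times> {- R..R}))"
    by (intro compact_continuous_image compact_Times Suc compact_Icc) (auto simp: case_prod_unfold intro!: continuous_intros)
  ultimately show ?case by simp
qed

lemma continuous_on_euc_bounded:
  assumes "continuous_on (euc d) \<phi>" "bounded \<Omega>" "\<Omega> \<subseteq> euc d"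
  obtains C where "\<And>x. x \<in> \<Omega> \<Longrightarrow> norm (\<phi> x) \<le> C"
proof -
  obtain R where R: "\<And>x. x \<in> \<Omega> \<Longrightarrow> norm x \<le> R" using assms(2) by (auto simp: bounded_iff)
  let ?K = "{x \<in> euc d. \<forall>i<d. \<bar>coord x i\<bar> \<le> R}"
  have "compact (\<phi> ` ?K)" using assms(1) by (intro compact_continuous_image compact_euc_box) (auto intro: continuous_on_subset)
  from compact_imp_bounded[OF this] obtain C where C: "\<And>y. y \<in> \<phi> ` ?K \<Longrightarrow> norm y \<le> C"
    unfolding bounded_iff by blast
  have "\<Omega> \<subseteq> ?K" using assms(3) R order_trans[OF abs_coord_le_norm] by auto
  then show ?thesis using C that by blast
qed

text \<open>The map is an extension by 0 to all coordinates followed by a map that is continuous for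
  the product topology on sequences, where Borel and product sigma-algebra coincide.\<close>

lemma sum_single_measurable:
  "(\<lambda>f. \<Sum>i<d. Poly_Mapping.single i (f i)) \<in> measurable (Pi\<^sub>M {..<d} (\<lambda>_. lborel)) (borel :: point measure)"
proof -
  let ?T = "\<lambda>f :: nat \<Rightarrow> real. \<Sum>i<d. Poly_Mapping.single i (f i)"
  have "continuous_on UNIV ?T"
    unfolding sum_single_eq
    by (intro continuous_on_sum continuous_on_scaleR continuous_on_const continuous_on_product_coordinates)
  then have T: "?T \<in> measurable (Pi\<^sub>M UNIV (\<lambda>_. borel)) borel"
    by (subst measurable_cong_sets[OF sets_PiM_equal_borel refl]) (rule borel_measurable_continuous_onI)
  have E: "(\<lambda>f i. if i < d then f i else 0) \<in> measurable (Pi\<^sub>M {..<d} (\<lambda>_. lborel)) (Pi\<^sub>M UNIV (\<lambda>_. borel :: real measure))"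
  proof (rule measurable_PiM_single')
    show "(\<lambda>f. if i < d then f i else (0 :: real)) \<in> measurable (Pi\<^sub>M {..<d} (\<lambda>_. lborel)) borel" for i
      using measurable_component_singleton[of i "{..<d}" "\<lambda>_. lborel :: real measure"] by (cases "i < d") auto
  qed auto
  have "(\<lambda>f. ?T (\<lambda>i. if i < d then f i else 0)) \<in> measurable (Pi\<^sub>M {..<d} (\<lambda>_. lborel)) borel"
    using measurable_compose[OF E T] by simp
  then show ?thesis by simp
qed

abbreviation euc_base :: "nat \<Rightarrow> point measure" where
  "euc_base d \<equiv> distr (Pi\<^sub>M {..<d} (\<lambda>_. lborel)) borel (\<lambda>f. \<Sum>i<d. Poly_Mapping.single i (f i))"

lemma space_lebesgue_euc [simp]: "space (lebesgue_euc d) = UNIV"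
  by (simp add: lebesgue_euc_def)

lemma borel_sets_lebesgue_euc: "A \<in> sets borel \<Longrightarrow> A \<in> sets (lebesgue_euc d)"
  unfolding lebesgue_euc_def by (rule sets_completionI_sets) simp

lemma emeasure_lebesgue_euc:
  assumes "A \<in> sets borel"
  shows "emeasure (lebesgue_euc d) A =
    emeasure (Pi\<^sub>M {..<d} (\<lambda>_. lborel)) {f \<in> space (Pi\<^sub>M {..<d} (\<lambda>_. lborel)). (\<Sum>i<d. Poly_Mapping.single i (f i)) \<in> A}"
proof -
  have "emeasure (lebesgue_euc d) A = emeasure (euc_base d) A"
    unfolding lebesgue_euc_def using assms by (subst emeasure_completion) (auto intro: sets_completionI_sets)
  then show ?thesis using emeasure_distr[OF sum_single_measurable assms] by (simp add: vimage_def Int_def conj_commute)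
qed

lemma emeasure_lebesgue_euc_pos:
  assumes "open U" "x \<in> U" "x \<in> euc d"
  shows "0 < emeasure (lebesgue_euc d) (U \<inter> euc d)"
proof -
  interpret product_sigma_finite "\<lambda>_ :: nat. lborel :: real measure" by standard
  obtain r where r: "0 < r" "ball x r \<subseteq> U" using assms(1,2) by (auto simp: open_contains_ball)
  \<comment> \<open>The norm is bounded by the sum of \<open>d\<close> coordinate errors, each at
    most \<delta>; the \<open>+ 1\<close> covers \<open>d = 0\<close> and makes the bound
    strict.\<close>
  define \<delta> where "\<delta> = r / (real d + 1)"
  have \<delta>: "0 < \<delta>" "real d * \<delta> < r" using r(1) by (simp_all add: \<delta>_def field_simps)
  let ?B = "Pi\<^sub>E {..<d} (\<lambda>i. {coord x i - \<delta>..coord x i + \<delta>})"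
  let ?P = "Pi\<^sub>M {..<d} (\<lambda>_. lborel :: real measure)"
  let ?T = "\<lambda>f :: nat \<Rightarrow> real. \<Sum>i<d. Poly_Mapping.single i (f i)"
  have meas: "U \<inter> euc d \<in> sets borel" using assms(1) closed_euc by auto
  have "0 < (\<Prod>i<d. emeasure lborel {coord x i - \<delta>..coord x i + \<delta>})"
    using \<delta>(1) by (simp add: ennreal_power)
  also have "\<dots> = emeasure ?P ?B" by (subst emeasure_PiM) auto
  also have "\<dots> \<le> emeasure ?P {f \<in> space ?P. ?T f \<in> U \<inter> euc d}"
  proof (rule emeasure_mono)
    show "?B \<subseteq> {f \<in> space ?P. ?T f \<in> U \<inter> euc d}"
    proof
      fix f assume f: "f \<in> ?B"
      have "x - ?T f = (\<Sum>i<d. (coord x i - f i) *\<^sub>R unit_vec i)"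
        by (subst sum_single_coord[OF assms(3), symmetric]) (simp add: sum_single_eq sum_subtractf scaleR_diff_left)
      then have "dist x (?T f) \<le> (\<Sum>i<d. \<bar>coord x i - f i\<bar>)"
        unfolding dist_norm by (simp only:) (rule order_trans[OF norm_sum], simp add: norm_unit_vec)
      also have "\<dots> \<le> (\<Sum>i<d. \<delta>)" using f by (intro sum_mono) (auto simp: PiE_def Pi_def abs_le_iff)
      also have "\<dots> < r" using \<delta>(2) by simp
      finally have "?T f \<in> U" using r(2) by auto
      then show "f \<in> {f \<in> space ?P. ?T f \<in> U \<inter> euc d}"
        using f sum_single_mem_euc by (auto simp: space_PiM)
    qed
    show "{f \<in> space ?P. ?T f \<in> U \<inter> euc d} \<in> sets ?P"
      using measurable_sets[OF sum_single_measurable meas] by (simp add: vimage_def Int_def conj_commute)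
  qed
  finally show ?thesis unfolding emeasure_lebesgue_euc[OF meas] .
qed

lemma emeasure_lebesgue_euc_finite:
  assumes "bounded A" "A \<in> sets borel"
  shows "emeasure (lebesgue_euc d) A < \<infinity>"
proof -
  interpret product_sigma_finite "\<lambda>_ :: nat. lborel :: real measure" by standard
  obtain R where R: "\<And>x. x \<in> A \<Longrightarrow> norm x \<le> R" using assms(1) by (auto simp: bounded_iff)
  let ?B = "Pi\<^sub>E {..<d} (\<lambda>i. {- R..R})"
  let ?P = "Pi\<^sub>M {..<d} (\<lambda>_. lborel :: real measure)"
  let ?T = "\<lambda>f :: nat \<Rightarrow> real. \<Sum>i<d. Poly_Mapping.single i (f i)"
  have "emeasure ?P {f \<in> space ?P. ?T f \<in> A} \<le> emeasure ?P ?B"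
  proof (rule emeasure_mono)
    show "{f \<in> space ?P. ?T f \<in> A} \<subseteq> ?B"
    proof
      fix f assume f: "f \<in> {f \<in> space ?P. ?T f \<in> A}"
      have "f i \<in> {- R..R}" if "i < d" for i
        using abs_coord_le_norm[of "?T f" i] R[of "?T f"] f that by (auto simp: coord_sum_single)
      then show "f \<in> ?B" using f by (simp add: space_PiM PiE_def Pi_def)
    qed
    show "?B \<in> sets ?P" by (intro sets_PiM_I_finite) auto
  qed
  also have "\<dots> = (\<Prod>i<d. emeasure lborel {- R..R})" by (subst emeasure_PiM) auto
  also have "\<dots> < \<infinity>" by (cases "0 \<le> R"; cases "d = 0") (auto simp: ennreal_power power_0_left)
  finally show ?thesis unfolding emeasure_lebesgue_euc[OF assms(2)] .
qed

section \<open>Square integrable functions on a bounded domain\<close>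

locale bounded_domain =
  fixes d :: nat and \<Omega> :: "point set"
  assumes open_\<Omega>: "openin (top_of_set (euc d)) \<Omega>" and bounded_\<Omega>: "bounded \<Omega>" and nonempty_\<Omega>: "\<Omega> \<noteq> {}"
begin

lemma \<Omega>_subset: "\<Omega> \<subseteq> euc d"
  using openin_subset[OF open_\<Omega>] by simp

lemma \<Omega>_borel: "\<Omega> \<in> sets borel"
  using open_\<Omega> closed_euc[of d] by (auto simp: openin_open)

lemma \<Omega>_lebesgue: "\<Omega> \<inter> space (lebesgue_euc d) \<in> sets (lebesgue_euc d)"
  using borel_sets_lebesgue_euc[OF \<Omega>_borel] by simp

lemma space_leb_on [simp]: "space (leb_on d \<Omega>) = \<Omega>"
  by (simp add: space_restrict_space)

lemma continuous_measurable_leb_on: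
  fixes \<phi> :: "point \<Rightarrow> complex"
  assumes "continuous_on \<Omega> \<phi>"
  shows "\<phi> \<in> borel_measurable (leb_on d \<Omega>)"
proof -
  have "\<phi> \<in> borel_measurable (restrict_space borel \<Omega>)" by (rule borel_measurable_continuous_on_restrict[OF assms])
  then have "(\<lambda>x. if x \<in> \<Omega> then \<phi> x else 0) \<in> borel_measurable borel"
    using \<Omega>_borel by (subst (asm) measurable_restrict_space_iff[where c = 0]) auto
  then have "(\<lambda>x. if x \<in> \<Omega> then \<phi> x else 0) \<in> borel_measurable (euc_base d)" by simp
  then have "(\<lambda>x. if x \<in> \<Omega> then \<phi> x else 0) \<in> borel_measurable (lebesgue_euc d)"
    unfolding lebesgue_euc_def by (rule measurable_completion)
  then show ?thesis using \<Omega>_lebesgue by (subst measurable_restrict_space_iff[where c = 0]) auto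
qed

lemma finite_measure_leb_on: "finite_measure (leb_on d \<Omega>)"
proof
  have "emeasure (leb_on d \<Omega>) \<Omega> = emeasure (lebesgue_euc d) \<Omega>"
    using \<Omega>_lebesgue by (subst emeasure_restrict_space) auto
  then show "emeasure (leb_on d \<Omega>) (space (leb_on d \<Omega>)) \<noteq> \<infinity>"
    using emeasure_lebesgue_euc_finite[OF bounded_\<Omega> \<Omega>_borel, of d] by simp
qed

lemma continuous_L2:
  assumes "continuous_on (euc d) \<phi>"
  shows "\<phi> \<in> L2 d \<Omega>"
proof -
  interpret finite_measure "leb_on d \<Omega>" by (rule finite_measure_leb_on)
  obtain C where C: "\<And>x. x \<in> \<Omega> \<Longrightarrow> norm (\<phi> x) \<le> C"
    using continuous_on_euc_bounded[OF assms bounded_\<Omega> \<Omega>_subset] by blast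
  have m: "\<phi> \<in> borel_measurable (leb_on d \<Omega>)"
    using assms \<Omega>_subset by (intro continuous_measurable_leb_on) (auto intro: continuous_on_subset)
  have "integrable (leb_on d \<Omega>) (\<lambda>x. (cmod (\<phi> x))\<^sup>2)"
  proof (rule integrable_const_bound[of _ "C\<^sup>2"])
    show "AE x in leb_on d \<Omega>. norm ((cmod (\<phi> x))\<^sup>2) \<le> C\<^sup>2"
      by (rule AE_I2) (auto intro!: power_mono C)
  qed (use m in measurable)
  then show ?thesis using m by (simp add: L2_def)
qed

lemma L2_mult_integrable:
  assumes "u \<in> L2 d \<Omega>" "v \<in> L2 d \<Omega>"
  shows "integrable (leb_on d \<Omega>) (\<lambda>x. u x * v x)"
proof (rule Bochner_Integration.integrable_bound)
  show "integrable (leb_on d \<Omega>) (\<lambda>x. (cmod (u x))\<^sup>2 + (cmod (v x))\<^sup>2)" using assms by (simp add: L2_def)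
  show "(\<lambda>x. u x * v x) \<in> borel_measurable (leb_on d \<Omega>)"
    using assms by (auto simp: L2_def intro!: borel_measurable_times)
  have "a * b \<le> a\<^sup>2 + b\<^sup>2" if "0 \<le> a" "0 \<le> b" for a b :: real
    using sum_squares_bound[of a b] mult_nonneg_nonneg[OF that] by linarith
  then show "AE x in leb_on d \<Omega>. norm (u x * v x) \<le> norm ((cmod (u x))\<^sup>2 + (cmod (v x))\<^sup>2)"
    by (intro AE_I2) (simp add: norm_mult)
qed

lemma L2_cnj: "v \<in> L2 d \<Omega> \<Longrightarrow> (\<lambda>x. cnj (v x)) \<in> L2 d \<Omega>"
  by (simp add: L2_def borel_measurable_continuous_on[OF continuous_on_cnj[OF continuous_on_id]])

lemma cmod_lincomb_sq: "(cmod (a * p + b * q))\<^sup>2 \<le> 2 * (cmod a)\<^sup>2 * (cmod p)\<^sup>2 + 2 * (cmod b)\<^sup>2 * (cmod q)\<^sup>2"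
proof -
  have "(cmod (a * p + b * q))\<^sup>2 \<le> (cmod a * cmod p + cmod b * cmod q)\<^sup>2"
    by (intro power_mono order_trans[OF norm_triangle_ineq]) (auto simp: norm_mult)
  also have "\<dots> \<le> 2 * (cmod a * cmod p)\<^sup>2 + 2 * (cmod b * cmod q)\<^sup>2"
    using sum_squares_bound[of "cmod a * cmod p" "cmod b * cmod q"] by (simp add: power2_sum)
  finally show ?thesis by (simp add: power_mult_distrib)
qed

text \<open>The crude factor 2, from the pointwise inequality for squares, is enough for passing to
  limits.\<close>

lemma L2_lincomb:
  assumes "u \<in> L2 d \<Omega>" "v \<in> L2 d \<Omega>"
  shows "(\<lambda>x. a * u x + b * v x) \<in> L2 d \<Omega>"
    and "(L2_norm d \<Omega> (\<lambda>x. a * u x + b * v x))\<^sup>2 \<le> 2 * (cmod a)\<^sup>2 * (L2_norm d \<Omega> u)\<^sup>2 + 2 * (cmod b)\<^sup>2 * (L2_norm d \<Omega> v)\<^sup>2"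
proof -
  let ?M = "leb_on d \<Omega>" and ?w = "\<lambda>x. a * u x + b * v x"
  let ?h = "\<lambda>x. 2 * (cmod a)\<^sup>2 * (cmod (u x))\<^sup>2 + 2 * (cmod b)\<^sup>2 * (cmod (v x))\<^sup>2"
  have m: "?w \<in> borel_measurable ?M"
    using assms by (auto simp: L2_def intro!: borel_measurable_times borel_measurable_add)
  have h: "integrable ?M ?h" using assms by (simp add: L2_def)
  have w: "integrable ?M (\<lambda>x. (cmod (?w x))\<^sup>2)"
  proof (rule Bochner_Integration.integrable_bound[OF h])
    show "AE x in ?M. norm ((cmod (?w x))\<^sup>2) \<le> norm (?h x)"
      using cmod_lincomb_sq[of a _ b] by (intro AE_I2) simp
  qed (use m in measurable)
  then show "?w \<in> L2 d \<Omega>" using m by (simp add: L2_def)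
  have "(LINT x|?M. (cmod (?w x))\<^sup>2) \<le> (LINT x|?M. ?h x)"
    using w h cmod_lincomb_sq by (intro integral_mono) auto
  also have "\<dots> = 2 * (cmod a)\<^sup>2 * (LINT x|?M. (cmod (u x))\<^sup>2) + 2 * (cmod b)\<^sup>2 * (LINT x|?M. (cmod (v x))\<^sup>2)"
    using assms by (subst Bochner_Integration.integral_add) (auto simp: L2_def)
  finally show "(L2_norm d \<Omega> ?w)\<^sup>2 \<le> 2 * (cmod a)\<^sup>2 * (L2_norm d \<Omega> u)\<^sup>2 + 2 * (cmod b)\<^sup>2 * (L2_norm d \<Omega> v)\<^sup>2"
    by (simp add: L2_norm_def Bochner_Integration.integral_nonneg)
qed

lemma L2_norm_nonneg: "0 \<le> L2_norm d \<Omega> u"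
  by (simp add: L2_norm_def Bochner_Integration.integral_nonneg)

lemma L2_norm_lincomb_tendsto:
  assumes "\<And>n. u n \<in> L2 d \<Omega>" "\<And>n. v n \<in> L2 d \<Omega>"
    "(\<lambda>n. L2_norm d \<Omega> (u n)) \<longlonglongrightarrow> 0" "(\<lambda>n. L2_norm d \<Omega> (v n)) \<longlonglongrightarrow> 0"
  shows "(\<lambda>n. L2_norm d \<Omega> (\<lambda>x. a * u n x + b * v n x)) \<longlonglongrightarrow> 0"
proof -
  let ?h = "\<lambda>n. 2 * (cmod a)\<^sup>2 * (L2_norm d \<Omega> (u n))\<^sup>2 + 2 * (cmod b)\<^sup>2 * (L2_norm d \<Omega> (v n))\<^sup>2"
  have "?h \<longlonglongrightarrow> 2 * (cmod a)\<^sup>2 * 0\<^sup>2 + 2 * (cmod b)\<^sup>2 * 0\<^sup>2"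
    by (intro tendsto_add tendsto_mult tendsto_power tendsto_const assms(3,4))
  then have h: "?h \<longlonglongrightarrow> 0" by simp
  have "norm ((L2_norm d \<Omega> (\<lambda>x. a * u n x + b * v n x))\<^sup>2) \<le> ?h n" for n
    using L2_lincomb(2)[OF assms(1,2), of a n b n] by simp
  then have "(\<lambda>n. (L2_norm d \<Omega> (\<lambda>x. a * u n x + b * v n x))\<^sup>2) \<longlonglongrightarrow> 0"
    by (rule Lim_null_comparison[OF always_eventually[OF allI] h])
  then have "(\<lambda>n. sqrt ((L2_norm d \<Omega> (\<lambda>x. a * u n x + b * v n x))\<^sup>2)) \<longlonglongrightarrow> sqrt 0"
    by (rule tendsto_real_sqrt)
  then show ?thesis using L2_norm_nonneg by simp
qed

lemma L2_inner_lincomb: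
  assumes "u \<in> L2 d \<Omega>" "v \<in> L2 d \<Omega>" "w \<in> L2 d \<Omega>"
  shows "L2_inner d \<Omega> (\<lambda>x. a * u x + b * v x) w = a * L2_inner d \<Omega> u w + b * L2_inner d \<Omega> v w"
proof -
  have eq: "(a * u x + b * v x) * cnj (w x) = a * (u x * cnj (w x)) + b * (v x * cnj (w x))" for x by (simp add: algebra_simps)
  show ?thesis unfolding L2_inner_def eq
    using L2_mult_integrable[OF assms(1) L2_cnj[OF assms(3)]] L2_mult_integrable[OF assms(2) L2_cnj[OF assms(3)]] by simp
qed

lemma L2_inner_cnj: "L2_inner d \<Omega> v u = cnj (L2_inner d \<Omega> u v)"
  unfolding L2_inner_def by (subst Bochner_Integration.integral_cnj[symmetric]) (simp add: mult.commute)

lemma L2_inner_self: "L2_inner d \<Omega> u u = of_real ((L2_norm d \<Omega> u)\<^sup>2)"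
proof -
  have "L2_inner d \<Omega> u u = (LINT x|leb_on d \<Omega>. of_real ((cmod (u x))\<^sup>2))"
    unfolding L2_inner_def by (simp add: complex_norm_square del: of_real_power)
  also have "\<dots> = of_real (LINT x|leb_on d \<Omega>. (cmod (u x))\<^sup>2)" by (rule integral_complex_of_real)
  finally show ?thesis by (simp add: L2_norm_def Bochner_Integration.integral_nonneg)
qed

text \<open>The set where a continuous \<open>v\<close> is nonzero is relatively open in
  \<open>euc d\<close>; if nonempty it has positive measure.\<close>

lemma L2_norm_eq_0_continuous:
  assumes v: "v \<in> L2 d \<Omega>" "continuous_on \<Omega> v" "L2_norm d \<Omega> v = 0" and x: "x \<in> \<Omega>"
  shows "v x = 0"
proof (rule ccontr)
  assume vx: "v x \<noteq> 0"
  have "(LINT x|leb_on d \<Omega>. (cmod (v x))\<^sup>2) = 0" using v(3) by (simp add: L2_norm_def)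
  then have "AE x in leb_on d \<Omega>. (cmod (v x))\<^sup>2 = 0"
    using v(1) by (subst (asm) integral_nonneg_eq_0_iff_AE) (auto simp: L2_def)
  then have ae: "AE x in lebesgue_euc d. x \<in> \<Omega> \<longrightarrow> v x = 0"
    using \<Omega>_lebesgue by (subst (asm) AE_restrict_space_iff) auto
  obtain A where A: "open A" "A \<inter> \<Omega> = v -` (- {0}) \<inter> \<Omega>"
    using v(2) unfolding continuous_on_open_invariant by (meson open_Compl closed_singleton)
  obtain T where T: "open T" "\<Omega> = euc d \<inter> T" using open_\<Omega> by (auto simp: openin_open)
  let ?N = "(A \<inter> T) \<inter> euc d"
  have N: "?N = v -` (- {0}) \<inter> \<Omega>" using A(2) T(2) by blast
  have "?N \<in> sets (lebesgue_euc d)" using A(1) T(1) closed_euc by (intro borel_sets_lebesgue_euc) auto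
  moreover have "AE x in lebesgue_euc d. x \<notin> ?N" using ae unfolding N by eventually_elim auto
  ultimately have "?N \<in> null_sets (lebesgue_euc d)" by (simp add: AE_iff_null_sets)
  moreover have "0 < emeasure (lebesgue_euc d) ?N"
    using x vx N A(1) T(1) by (intro emeasure_lebesgue_euc_pos[of _ x]) auto
  ultimately show False by (auto simp: null_sets_def)
qed

end

section \<open>Traces and the finite element space\<close>

lemma partial_deriv_cong:
  assumes "\<And>x. x \<in> euc d \<Longrightarrow> f x = g x" "x \<in> euc d" "i < d"
  shows "partial_deriv i f x = partial_deriv i g x"
proof -
  have "(\<lambda>t. f (x + t *\<^sub>R unit_vec i)) = (\<lambda>t. g (x + t *\<^sub>R unit_vec i))"
    using assms add_unit_vec_mem_euc by auto
  then show ?thesis by (simp add: partial_deriv_def)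
qed

text \<open>Formulas for derivatives of combinations are available on \<open>euc d\<close> only.
  Equality there suffices, because lines in a direction \<open>i < d\<close> do not leave
  \<open>euc d\<close>.\<close>

lemma continuously_diff_cong:
  "(\<And>x. x \<in> euc d \<Longrightarrow> f x = g x) \<Longrightarrow> continuously_diff d k f \<Longrightarrow> continuously_diff d k g"
proof (induction k arbitrary: f g)
  case 0
  then show ?case using continuous_on_cong[of "euc d" "euc d" f g] by simp
next
  case (Suc k f g)
  have line: "(\<lambda>t. f (x + t *\<^sub>R unit_vec i)) = (\<lambda>t. g (x + t *\<^sub>R unit_vec i))" if "x \<in> euc d" "i < d" for x i
    using Suc.prems(1) add_unit_vec_mem_euc that by auto
  have "continuously_diff d k (partial_deriv i g)" if "i < d" for i
  proof (rule Suc.IH)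
    show "continuously_diff d k (partial_deriv i f)" using Suc.prems(2) that by simp
    show "partial_deriv i f x = partial_deriv i g x" if "x \<in> euc d" for x
      by (rule partial_deriv_cong[OF Suc.prems(1) that \<open>i < d\<close>])
  qed
  moreover have "continuous_on (euc d) g" using Suc.prems continuous_on_cong[of "euc d" "euc d" f g] by simp
  moreover have "(\<lambda>t::real. g (x + t *\<^sub>R unit_vec i)) differentiable (at 0)" if "i < d" "x \<in> euc d" for i x
    using Suc.prems(2) that by (simp add: line[symmetric])
  ultimately show ?case by simp
qed

lemma partial_deriv_lincomb:
  assumes "(\<lambda>t::real. f (x + t *\<^sub>R unit_vec i)) differentiable (at 0)" "(\<lambda>t::real. g (x + t *\<^sub>R unit_vec i)) differentiable (at 0)"
  shows "partial_deriv i (\<lambda>x. a * f x + b * g x) x = a * partial_deriv i f x + b * partial_deriv i g x"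
    and "(\<lambda>t::real. a * f (x + t *\<^sub>R unit_vec i) + b * g (x + t *\<^sub>R unit_vec i)) differentiable (at 0)"
proof -
  have "((\<lambda>t. a * f (x + t *\<^sub>R unit_vec i) + b * g (x + t *\<^sub>R unit_vec i)) has_vector_derivative
      a * partial_deriv i f x + b * partial_deriv i g x) (at 0)"
    using assms unfolding partial_deriv_def vector_derivative_works
    by (intro has_vector_derivative_add has_vector_derivative_mult_right)
  then show "partial_deriv i (\<lambda>x. a * f x + b * g x) x = a * partial_deriv i f x + b * partial_deriv i g x"
    "(\<lambda>t::real. a * f (x + t *\<^sub>R unit_vec i) + b * g (x + t *\<^sub>R unit_vec i)) differentiable (at 0)"
    by (simp_all add: partial_deriv_def vector_derivative_at differentiableI_vector)
qed

lemma continuously_diff_lincomb: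
  "continuously_diff d k f \<Longrightarrow> continuously_diff d k g \<Longrightarrow> continuously_diff d k (\<lambda>x. a * f x + b * g x)"
proof (induction k arbitrary: f g)
  case 0
  then show ?case by (auto intro!: continuous_intros)
next
  case (Suc k f g)
  have "continuously_diff d k (partial_deriv i (\<lambda>x. a * f x + b * g x))" if i: "i < d" for i
  proof (rule continuously_diff_cong)
    show "continuously_diff d k (\<lambda>x. a * partial_deriv i f x + b * partial_deriv i g x)"
      using Suc.prems i by (intro Suc.IH) auto
    show "a * partial_deriv i f x + b * partial_deriv i g x = partial_deriv i (\<lambda>x. a * f x + b * g x) x" if "x \<in> euc d" for x
      using Suc.prems i that by (subst partial_deriv_lincomb) auto
  qed
  moreover have "(\<lambda>t::real. a * f (x + t *\<^sub>R unit_vec i) + b * g (x + t *\<^sub>R unit_vec i)) differentiable (at 0)"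
    if "i < d" "x \<in> euc d" for i x
    using Suc.prems that by (intro partial_deriv_lincomb(2)) auto
  ultimately show ?case using Suc.prems by (auto intro!: continuous_intros)
qed

lemma smooth_lincomb: "smooth d f \<Longrightarrow> smooth d g \<Longrightarrow> smooth d (\<lambda>x. a * f x + b * g x)"
  by (simp add: smooth_def continuously_diff_lincomb)

lemma smooth_partial_deriv:
  assumes "smooth d f" "i < d"
  shows "continuous_on (euc d) (partial_deriv i f)"
    and "\<And>x. x \<in> euc d \<Longrightarrow> (\<lambda>t::real. f (x + t *\<^sub>R unit_vec i)) differentiable (at 0)"
  using assms spec[OF assms(1)[unfolded smooth_def], of "Suc 0"] by simp_all

lemma smooth_continuous: "smooth d f \<Longrightarrow> continuous_on (euc d) f"
  using spec[of "\<lambda>k. continuously_diff d k f" 0] by (simp add: smooth_def)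

lemma partial_deriv_zero: "partial_deriv i (\<lambda>x. 0) = (\<lambda>x. 0)"
  by (simp add: partial_deriv_def fun_eq_iff)

lemma smooth_zero: "smooth d (\<lambda>x. 0)"
proof -
  have "continuously_diff d k (\<lambda>x. 0)" for k by (induction k) (auto simp: partial_deriv_zero)
  then show ?thesis by (simp add: smooth_def)
qed

text \<open>The sigma-algebra of \<open>measure_of\<close> is the generated one, whether or not the
  Hausdorff set function is countably additive.\<close>

lemma sets_surface_measure: "sets (surface_measure d) = sets borel"
proof -
  have "sigma_sets UNIV (sets borel) = sets (borel :: point measure)"
    using sets.sigma_sets_eq[of "borel :: point measure"] by simp
  then show ?thesis by (simp add: hausdorff_measure_def sets_measure_of)
qed

section \<open>Weak gradients, traces and the space \<open>V\<close>\<close>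

context bounded_domain
begin

lemma weak_gradient_lincomb:
  assumes "u \<in> L2 d \<Omega>" "v \<in> L2 d \<Omega>" "is_weak_gradient d \<Omega> u G" "is_weak_gradient d \<Omega> v H"
  shows "is_weak_gradient d \<Omega> (\<lambda>x. a * u x + b * v x) (\<lambda>i x. a * G i x + b * H i x)"
  unfolding is_weak_gradient_def
proof (intro allI impI conjI ballI)
  fix i assume i: "i < d"
  have GH: "G i \<in> L2 d \<Omega>" "H i \<in> L2 d \<Omega>" using assms i by (auto simp: is_weak_gradient_def)
  then show "(\<lambda>x. a * G i x + b * H i x) \<in> L2 d \<Omega>" by (rule L2_lincomb)
  fix \<phi> assume \<phi>: "\<phi> \<in> test_functions d \<Omega>"
  then have sm: "smooth d \<phi>" by (simp add: test_functions_def)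
  have \<phi>2: "\<phi> \<in> L2 d \<Omega>" "partial_deriv i \<phi> \<in> L2 d \<Omega>"
    using continuous_L2 smooth_continuous[OF sm] smooth_partial_deriv(1)[OF sm i] by auto
  have lin: "(LINT x|leb_on d \<Omega>. (a * p x + b * q x) * r x) = a * (LINT x|leb_on d \<Omega>. p x * r x) + b * (LINT x|leb_on d \<Omega>. q x * r x)"
    if "p \<in> L2 d \<Omega>" "q \<in> L2 d \<Omega>" "r \<in> L2 d \<Omega>" for p q r
    using L2_mult_integrable[OF that(1,3)] L2_mult_integrable[OF that(2,3)] by (simp add: distrib_right mult.assoc)
  show "(LINT x|leb_on d \<Omega>. (a * u x + b * v x) * partial_deriv i \<phi> x) = - (LINT x|leb_on d \<Omega>. (a * G i x + b * H i x) * \<phi> x)"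
    unfolding lin[OF assms(1,2) \<phi>2(2)] lin[OF GH \<phi>2(1)] using assms(3,4) i \<phi> by (simp add: is_weak_gradient_def)
qed

lemma H1_lincomb: "u \<in> H1 d \<Omega> \<Longrightarrow> v \<in> H1 d \<Omega> \<Longrightarrow> (\<lambda>x. a * u x + b * v x) \<in> H1 d \<Omega>"
  unfolding H1_def using weak_gradient_lincomb L2_lincomb(1) by blast

text \<open>\<open>\<phi>\<close> is continuous on \<open>euc d\<close> and arbitrary elsewhere;
  multiplying it by the indicator of the boundary, a closed subset of \<open>euc d\<close>, makes it
  Borel.\<close>

lemma trace_term_measurable:
  assumes "continuous_on (euc d) \<phi>" "g \<in> borel_measurable borel"
  shows "(\<lambda>x. ennreal ((cmod (\<phi> x - g x))\<^sup>2) * indicator (boundary d \<Omega>) x) \<in> borel_measurable (surface_measure d)"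
proof -
  let ?B = "boundary d \<Omega>"
  have "closedin (top_of_set (euc d)) ?B" by (rule closedin_frontier_of)
  then have B: "closed ?B" "?B \<subseteq> euc d" using closed_euc closedin_closed_trans closedin_subset by fastforce+
  have "(\<lambda>x. indicator ?B x *\<^sub>R \<phi> x) \<in> borel_measurable borel"
    using B assms(1) by (intro borel_measurable_continuous_on_indicator) (auto intro: continuous_on_subset)
  moreover have [measurable]: "?B \<in> sets borel" using B(1) by simp
  ultimately have "(\<lambda>x. ennreal ((cmod (indicator ?B x *\<^sub>R \<phi> x - g x))\<^sup>2) * indicator ?B x) \<in> borel_measurable borel"
    using assms(2) by measurable
  moreover have "(\<lambda>x. ennreal ((cmod (indicator ?B x *\<^sub>R \<phi> x - g x))\<^sup>2) * indicator ?B x) =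
      (\<lambda>x. ennreal ((cmod (\<phi> x - g x))\<^sup>2) * indicator ?B x)"
    by (auto simp: indicator_def)
  ultimately show ?thesis by (subst measurable_cong_sets[OF sets_surface_measure refl]) simp
qed

text \<open>The combinations of the two approximating sequences approximate the combination; all
  three limits follow from the inequality for squares, in the boundary term under the
  integral.\<close>

lemma has_trace_lincomb:
  assumes u: "u \<in> L2 d \<Omega>" "has_trace d \<Omega> u g" and v: "v \<in> L2 d \<Omega>" "has_trace d \<Omega> v h"
  shows "has_trace d \<Omega> (\<lambda>x. a * u x + b * v x) (\<lambda>x. a * g x + b * h x)"
proof -
  let ?\<mu> = "surface_measure d" and ?B = "boundary d \<Omega>"
  obtain \<phi> G where \<phi>: "\<And>n::nat. smooth d (\<phi> n)" "is_weak_gradient d \<Omega> u G"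
      "(\<lambda>n. L2_norm d \<Omega> (\<lambda>x. \<phi> n x - u x)) \<longlonglongrightarrow> 0"
      "\<And>i. i < d \<Longrightarrow> (\<lambda>n. L2_norm d \<Omega> (\<lambda>x. partial_deriv i (\<phi> n) x - G i x)) \<longlonglongrightarrow> 0"
      "(\<lambda>n. \<integral>\<^sup>+x\<in>?B. ennreal ((cmod (\<phi> n x - g x))\<^sup>2) \<partial>?\<mu>) \<longlonglongrightarrow> 0"
    and g: "g \<in> borel_measurable borel" using u(2) unfolding has_trace_def by blast
  obtain \<psi> H where \<psi>: "\<And>n::nat. smooth d (\<psi> n)" "is_weak_gradient d \<Omega> v H"
      "(\<lambda>n. L2_norm d \<Omega> (\<lambda>x. \<psi> n x - v x)) \<longlonglongrightarrow> 0"
      "\<And>i. i < d \<Longrightarrow> (\<lambda>n. L2_norm d \<Omega> (\<lambda>x. partial_deriv i (\<psi> n) x - H i x)) \<longlonglongrightarrow> 0"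
      "(\<lambda>n. \<integral>\<^sup>+x\<in>?B. ennreal ((cmod (\<psi> n x - h x))\<^sup>2) \<partial>?\<mu>) \<longlonglongrightarrow> 0"
    and h: "h \<in> borel_measurable borel" using v(2) unfolding has_trace_def by blast
  have diff: "(\<lambda>x. p x - q x) \<in> L2 d \<Omega>" if "p \<in> L2 d \<Omega>" "q \<in> L2 d \<Omega>" for p q
    using L2_lincomb(1)[OF that, of 1 "- 1"] by simp
  have 1: "(\<lambda>n. L2_norm d \<Omega> (\<lambda>x. (a * \<phi> n x + b * \<psi> n x) - (a * u x + b * v x))) \<longlonglongrightarrow> 0"
  proof -
    have "(a * \<phi> n x + b * \<psi> n x) - (a * u x + b * v x) = a * (\<phi> n x - u x) + b * (\<psi> n x - v x)" for n x
      by (simp add: algebra_simps)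
    then show ?thesis
      using L2_norm_lincomb_tendsto[OF diff[OF continuous_L2[OF smooth_continuous[OF \<phi>(1)]] u(1)]
          diff[OF continuous_L2[OF smooth_continuous[OF \<psi>(1)]] v(1)] \<phi>(3) \<psi>(3)] by (simp only:)
  qed
  have 2: "(\<lambda>n. L2_norm d \<Omega> (\<lambda>x. partial_deriv i (\<lambda>x. a * \<phi> n x + b * \<psi> n x) x - (a * G i x + b * H i x))) \<longlonglongrightarrow> 0" if i: "i < d" for i
  proof -
    \<comment> \<open>The derivative of the combination splits at points of \<open>euc d\<close>,
      and the integral sees only points of \<Omega>.\<close>
    have "L2_norm d \<Omega> (\<lambda>x. partial_deriv i (\<lambda>x. a * \<phi> n x + b * \<psi> n x) x - (a * G i x + b * H i x)) =
        L2_norm d \<Omega> (\<lambda>x. a * (partial_deriv i (\<phi> n) x - G i x) + b * (partial_deriv i (\<psi> n) x - H i x))" for n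
    proof -
      have "partial_deriv i (\<lambda>x. a * \<phi> n x + b * \<psi> n x) x - (a * G i x + b * H i x) =
          a * (partial_deriv i (\<phi> n) x - G i x) + b * (partial_deriv i (\<psi> n) x - H i x)" if "x \<in> \<Omega>" for x
      proof -
        have x: "x \<in> euc d" using that \<Omega>_subset by auto
        show ?thesis
          unfolding partial_deriv_lincomb(1)[OF smooth_partial_deriv(2)[OF \<phi>(1) i x] smooth_partial_deriv(2)[OF \<psi>(1) i x]]
          by (simp add: algebra_simps)
      qed
      then show ?thesis unfolding L2_norm_def
        by (intro arg_cong[where f = sqrt] Bochner_Integration.integral_cong refl) simp
    qed
    moreover have "(\<lambda>n. L2_norm d \<Omega> (\<lambda>x. a * (partial_deriv i (\<phi> n) x - G i x) + b * (partial_deriv i (\<psi> n) x - H i x))) \<longlonglongrightarrow> 0"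
    proof -
      have GH: "G i \<in> L2 d \<Omega>" "H i \<in> L2 d \<Omega>" using \<phi>(2) \<psi>(2) i by (auto simp: is_weak_gradient_def)
      show ?thesis
        by (rule L2_norm_lincomb_tendsto[OF diff[OF continuous_L2[OF smooth_partial_deriv(1)[OF \<phi>(1) i]] GH(1)]
            diff[OF continuous_L2[OF smooth_partial_deriv(1)[OF \<psi>(1) i]] GH(2)] \<phi>(4)[OF i] \<psi>(4)[OF i]])
    qed
    ultimately show ?thesis by simp
  qed
  have 3: "(\<lambda>n. \<integral>\<^sup>+x\<in>?B. ennreal ((cmod (a * \<phi> n x + b * \<psi> n x - (a * g x + b * h x)))\<^sup>2) \<partial>?\<mu>) \<longlonglongrightarrow> 0"
  proof -
    let ?p = "\<lambda>n. \<integral>\<^sup>+x\<in>?B. ennreal ((cmod (\<phi> n x - g x))\<^sup>2) \<partial>?\<mu>" and ?q = "\<lambda>n. \<integral>\<^sup>+x\<in>?B. ennreal ((cmod (\<psi> n x - h x))\<^sup>2) \<partial>?\<mu>"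
    let ?A = "ennreal (2 * (cmod a)\<^sup>2)" and ?C = "ennreal (2 * (cmod b)\<^sup>2)"
    have meas: "(\<lambda>x. ennreal ((cmod (\<phi> n x - g x))\<^sup>2) * indicator ?B x) \<in> borel_measurable ?\<mu>"
      "(\<lambda>x. ennreal ((cmod (\<psi> n x - h x))\<^sup>2) * indicator ?B x) \<in> borel_measurable ?\<mu>" for n
      using trace_term_measurable[OF smooth_continuous[OF \<phi>(1)] g] trace_term_measurable[OF smooth_continuous[OF \<psi>(1)] h] by auto
    have le: "(\<integral>\<^sup>+x\<in>?B. ennreal ((cmod (a * \<phi> n x + b * \<psi> n x - (a * g x + b * h x)))\<^sup>2) \<partial>?\<mu>) \<le> ?A * ?p n + ?C * ?q n" for n
    proof -
      have "(\<integral>\<^sup>+x\<in>?B. ennreal ((cmod (a * \<phi> n x + b * \<psi> n x - (a * g x + b * h x)))\<^sup>2) \<partial>?\<mu>)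
        \<le> (\<integral>\<^sup>+x. ?A * (ennreal ((cmod (\<phi> n x - g x))\<^sup>2) * indicator ?B x) + ?C * (ennreal ((cmod (\<psi> n x - h x))\<^sup>2) * indicator ?B x) \<partial>?\<mu>)"
      proof (rule nn_integral_mono)
        fix x
        have "a * \<phi> n x + b * \<psi> n x - (a * g x + b * h x) = a * (\<phi> n x - g x) + b * (\<psi> n x - h x)" by (simp add: algebra_simps)
        then have "(cmod (a * \<phi> n x + b * \<psi> n x - (a * g x + b * h x)))\<^sup>2 \<le> 2 * (cmod a)\<^sup>2 * (cmod (\<phi> n x - g x))\<^sup>2 + 2 * (cmod b)\<^sup>2 * (cmod (\<psi> n x - h x))\<^sup>2"
          using cmod_lincomb_sq by simp
        then have "ennreal ((cmod (a * \<phi> n x + b * \<psi> n x - (a * g x + b * h x)))\<^sup>2) \<le> ?A * ennreal ((cmod (\<phi> n x - g x))\<^sup>2) + ?C * ennreal ((cmod (\<psi> n x - h x))\<^sup>2)"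
          by (simp add: ennreal_mult[symmetric] ennreal_plus[symmetric] del: ennreal_plus)
        then show "ennreal ((cmod (a * \<phi> n x + b * \<psi> n x - (a * g x + b * h x)))\<^sup>2) * indicator ?B x
          \<le> ?A * (ennreal ((cmod (\<phi> n x - g x))\<^sup>2) * indicator ?B x) + ?C * (ennreal ((cmod (\<psi> n x - h x))\<^sup>2) * indicator ?B x)"
          by (auto simp: indicator_def)
      qed
      also have "\<dots> = ?A * ?p n + ?C * ?q n"
        using meas by (subst nn_integral_add) (auto simp: nn_integral_cmult)
      finally show ?thesis .
    qed
    have "(\<lambda>n. ?A * ?p n) \<longlonglongrightarrow> ?A * 0" "(\<lambda>n. ?C * ?q n) \<longlonglongrightarrow> ?C * 0"
      using \<phi>(5) \<psi>(5) by (intro ennreal_tendsto_cmult; simp)+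
    then have "(\<lambda>n. ?A * ?p n + ?C * ?q n) \<longlonglongrightarrow> ?A * 0 + ?C * 0" by (rule tendsto_add)
    then have lim: "(\<lambda>n. ?A * ?p n + ?C * ?q n) \<longlonglongrightarrow> 0" by simp
    show ?thesis
      by (rule tendsto_sandwich[OF _ always_eventually[OF allI[OF le]] tendsto_const lim]) simp
  qed
  show ?thesis unfolding has_trace_def
  proof (rule conjI, goal_cases)
    case trace: 2
    show ?case
    proof (rule exI[of _ "\<lambda>n x. a * \<phi> n x + b * \<psi> n x"], rule exI[of _ "\<lambda>i x. a * G i x + b * H i x"], intro conjI)
      show "\<forall>n. smooth d (\<lambda>x. a * \<phi> n x + b * \<psi> n x)" using smooth_lincomb \<phi>(1) \<psi>(1) by blast
      show "is_weak_gradient d \<Omega> (\<lambda>x. a * u x + b * v x) (\<lambda>i x. a * G i x + b * H i x)"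
        by (rule weak_gradient_lincomb[OF u(1) v(1) \<phi>(2) \<psi>(2)])
      show "\<forall>i<d. (\<lambda>n. L2_norm d \<Omega> (\<lambda>x. partial_deriv i (\<lambda>x. a * \<phi> n x + b * \<psi> n x) x - (a * G i x + b * H i x))) \<longlonglongrightarrow> 0"
        by (intro allI impI 2)
    qed (rule 1, rule 3)
  qed (use g h in measurable)
qed

lemma zero_L2: "(\<lambda>x. 0) \<in> L2 d \<Omega>"
  by (intro continuous_L2 continuous_intros)

lemma V_space_function_subspace: "function_subspace (V_space d \<Omega> \<Gamma>\<^sub>D)"
proof
  have wg: "is_weak_gradient d \<Omega> (\<lambda>x. 0) (\<lambda>i x. 0)" by (simp add: is_weak_gradient_def zero_L2)
  have "has_trace d \<Omega> (\<lambda>x. 0) (\<lambda>x. 0)"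
    unfolding has_trace_def
    by (intro conjI exI[of _ "\<lambda>n x. 0"] exI[of _ "\<lambda>i x. 0"]) (auto simp: smooth_zero wg partial_deriv_zero L2_norm_def)
  then show "(\<lambda>x. 0) \<in> V_space d \<Omega> \<Gamma>\<^sub>D"
    using wg zero_L2 unfolding V_space_def H1_def by (auto intro!: exI[of _ "\<lambda>x. 0"])
next
  fix u v a b assume "u \<in> V_space d \<Omega> \<Gamma>\<^sub>D" "v \<in> V_space d \<Omega> \<Gamma>\<^sub>D"
  then obtain g h where uv: "u \<in> H1 d \<Omega>" "v \<in> H1 d \<Omega>" "has_trace d \<Omega> u g" "has_trace d \<Omega> v h"
    "AE x in surface_measure d. x \<in> \<Gamma>\<^sub>D \<longrightarrow> g x = 0" "AE x in surface_measure d. x \<in> \<Gamma>\<^sub>D \<longrightarrow> h x = 0"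
    by (auto simp: V_space_def)
  have "has_trace d \<Omega> (\<lambda>x. a * u x + b * v x) (\<lambda>x. a * g x + b * h x)"
    using uv by (intro has_trace_lincomb) (auto simp: H1_def)
  moreover have "AE x in surface_measure d. x \<in> \<Gamma>\<^sub>D \<longrightarrow> a * g x + b * h x = 0"
    using uv(5,6) by eventually_elim auto
  ultimately show "(\<lambda>x. a * u x + b * v x) \<in> V_space d \<Omega> \<Gamma>\<^sub>D"
    unfolding V_space_def using H1_lincomb[OF uv(1,2)] by blast
qed

lemma V_space_L2: "u \<in> V_space d \<Omega> \<Gamma>\<^sub>D \<Longrightarrow> u \<in> L2 d \<Omega>"
  by (simp add: V_space_def H1_def)

section \<open>The finite element space as a finite-dimensional inner product space\<close>

lemma Vh_space_function_subspace: "function_subspace (Vh_space d \<Omega> \<Gamma>\<^sub>D \<T>)"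
proof
  interpret V: function_subspace "V_space d \<Omega> \<Gamma>\<^sub>D" by (rule V_space_function_subspace)
  show "(\<lambda>x. 0) \<in> Vh_space d \<Omega> \<Gamma>\<^sub>D \<T>"
    using V.zero_mem by (auto simp: Vh_space_def intro!: exI[of _ 0] exI[of _ "\<lambda>_. 0"])
  fix u v a b assume u: "u \<in> Vh_space d \<Omega> \<Gamma>\<^sub>D \<T>" and v: "v \<in> Vh_space d \<Omega> \<Gamma>\<^sub>D \<T>"
  have "\<exists>c p. \<forall>x\<in>T. a * u x + b * v x = c + (\<Sum>i<d. p i * of_real (coord x i))" if T: "T \<in> \<T>" for T
  proof -
    obtain c p where 1: "\<forall>x\<in>T. u x = c + (\<Sum>i<d. p i * of_real (coord x i))" using u T unfolding Vh_space_def by blast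
    obtain c' p' where 2: "\<forall>x\<in>T. v x = c' + (\<Sum>i<d. p' i * of_real (coord x i))" using v T unfolding Vh_space_def by blast
    show ?thesis
    proof (intro exI ballI)
      fix x assume "x \<in> T"
      then show "a * u x + b * v x = (a * c + b * c') + (\<Sum>i<d. (a * p i + b * p' i) * of_real (coord x i))"
        using 1 2 by (simp add: distrib_left distrib_right sum.distrib sum_distrib_left mult.assoc)
    qed
  qed
  then show "(\<lambda>x. a * u x + b * v x) \<in> Vh_space d \<Omega> \<Gamma>\<^sub>D \<T>"
    using u v V.lincomb_mem[of u v a b] by (auto simp: Vh_space_def intro!: continuous_intros)
qed

text \<open>Instead of a nodal basis, each point is assigned to one simplex containing it, and the
  affine functions are cut off to the points assigned to a given simplex. Indices below
  \<open>d\<close> stand for coordinates, the index \<open>d\<close> for the constant 1.\<close>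

lemma Vh_space_spanned:
  assumes fin: "finite \<T>" and cover: "\<Union>\<T> = closure \<Omega>"
  obtains e where "\<forall>v\<in>Vh_space d \<Omega> \<Gamma>\<^sub>D \<T>. \<exists>c. v = (\<lambda>x. \<Sum>i\<in>\<T> \<times> {..d}. c i * e i x)"
proof -
  define sel where "sel x = (SOME T. T \<in> \<T> \<and> x \<in> T)" for x
  have sel: "sel x \<in> \<T>" "x \<in> sel x" if "x \<in> closure \<Omega>" for x
  proof -
    have "\<exists>T. T \<in> \<T> \<and> x \<in> T" using that cover by blast
    from someI_ex[OF this] show "sel x \<in> \<T>" "x \<in> sel x" by (auto simp: sel_def)
  qed
  define e where "e = (\<lambda>(T, i) x. if x \<in> closure \<Omega> \<and> sel x = T then (if i < d then complex_of_real (coord x i) else 1) else 0)"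
  have "\<exists>c. v = (\<lambda>x. \<Sum>i\<in>\<T> \<times> {..d}. c i * e i x)" if v: "v \<in> Vh_space d \<Omega> \<Gamma>\<^sub>D \<T>" for v
  proof -
    have "\<forall>T\<in>\<T>. \<exists>cp. \<forall>x\<in>T. v x = fst cp + (\<Sum>i<d. snd cp i * of_real (coord x i))"
      using v by (fastforce simp: Vh_space_def)
    from bchoice[OF this] obtain cp where cp: "\<And>T x. T \<in> \<T> \<Longrightarrow> x \<in> T \<Longrightarrow> v x = fst (cp T) + (\<Sum>i<d. snd (cp T) i * of_real (coord x i))"
      by blast
    let ?c = "\<lambda>(T, i). if i < d then snd (cp T) i else fst (cp T)"
    have "v x = (\<Sum>i\<in>\<T> \<times> {..d}. ?c i * e i x)" for x
    proof (cases "x \<in> closure \<Omega>")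
      case False
      then have "v x = 0" using v by (simp add: Vh_space_def)
      moreover have "(\<Sum>i\<in>\<T> \<times> {..d}. ?c i * e i x) = 0" using False by (intro sum.neutral) (auto simp: e_def)
      ultimately show ?thesis by simp
    next
      case True
      have "(\<Sum>i\<in>\<T> \<times> {..d}. ?c i * e i x) = (\<Sum>T\<in>\<T>. \<Sum>i\<le>d. ?c (T, i) * e (T, i) x)"
        by (subst sum.cartesian_product) (intro sum.cong refl, auto)
      also have "\<dots> = (\<Sum>T\<in>\<T>. if T = sel x then (\<Sum>i\<le>d. ?c (T, i) * e (T, i) x) else 0)"
        by (intro sum.cong refl) (auto simp: e_def)
      also have "\<dots> = (\<Sum>i\<le>d. ?c (sel x, i) * e (sel x, i) x)" using fin sel(1)[OF True] by simp
      also have "\<dots> = (\<Sum>i\<in>insert d {..<d}. ?c (sel x, i) * e (sel x, i) x)"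
        by (intro sum.cong) auto
      also have "\<dots> = v x" using True cp[OF sel[OF True]] by (simp add: e_def)
      finally show ?thesis by simp
    qed
    then show ?thesis by blast
  qed
  then have "\<forall>v\<in>Vh_space d \<Omega> \<Gamma>\<^sub>D \<T>. \<exists>c. v = (\<lambda>x. \<Sum>i\<in>\<T> \<times> {..d}. c i * e i x)" by (rule ballI)
  then show ?thesis by (rule that)
qed

text \<open>A function of norm 0 vanishes on \<Omega> as a continuous function, then on the closure,
  and outside it by the extension by zero.\<close>

lemma Vh_space_inner_product:
  "inner_product_functions (Vh_space d \<Omega> \<Gamma>\<^sub>D \<T>) (L2_inner d \<Omega>)"
proof -
  interpret function_subspace "Vh_space d \<Omega> \<Gamma>\<^sub>D \<T>" by (rule Vh_space_function_subspace)
  have L2: "u \<in> L2 d \<Omega>" if "u \<in> Vh_space d \<Omega> \<Gamma>\<^sub>D \<T>" for u using that V_space_L2 by (auto simp: Vh_space_def)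
  show ?thesis
  proof
    show "0 < Re (L2_inner d \<Omega> u u)" if u: "u \<in> Vh_space d \<Omega> \<Gamma>\<^sub>D \<T>" "u \<noteq> (\<lambda>x. 0)" for u
    proof (rule ccontr)
      assume "\<not> 0 < Re (L2_inner d \<Omega> u u)"
      then have "L2_norm d \<Omega> u = 0" using L2_norm_nonneg[of u] by (simp add: L2_inner_self)
      moreover have cont: "continuous_on (closure \<Omega>) u" using u by (simp add: Vh_space_def)
      ultimately have "u x = 0" if "x \<in> \<Omega>" for x
        using L2_norm_eq_0_continuous[OF L2[OF u(1)] continuous_on_subset[OF cont closure_subset]] that by blast
      then have "u x = 0" if "x \<in> closure \<Omega>" for x
        using continuous_constant_on_closure[OF cont _ that] by blast
      then have "u = (\<lambda>x. 0)" using u(1) by (auto simp: Vh_space_def)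
      then show False using u by simp
    qed
    show "L2_inner d \<Omega> (\<lambda>x. a * u x + b * v x) w = a * L2_inner d \<Omega> u w + b * L2_inner d \<Omega> v w"
      if "u \<in> Vh_space d \<Omega> \<Gamma>\<^sub>D \<T>" "v \<in> Vh_space d \<Omega> \<Gamma>\<^sub>D \<T>" "w \<in> Vh_space d \<Omega> \<Gamma>\<^sub>D \<T>" for u v w a b
      by (intro L2_inner_lincomb L2 that)
    show "L2_inner d \<Omega> v u = cnj (L2_inner d \<Omega> u v)" for u v by (rule L2_inner_cnj)
  qed
qed

end

section \<open>Choice of the strip and the error estimate\<close>

text \<open>A \<open>LEAST\<close> over the reals says something only if the infimum is attained.
  Here it is: each \<open>v\<close> with positive real part imposes a closed lower bound on \<beta>,
  where the real part is 0 the imaginary part vanishes too, and \<open>K\<close> is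
  admissible.\<close>

lemma index_of_bound:
  assumes re: "\<forall>v\<in>V. 0 \<le> Re (A v v)" and K: "0 \<le> K" "\<forall>v\<in>V. cmod (A v v) \<le> K * Re (A v v)"
  shows "0 \<le> index_of V A" and "\<forall>v\<in>V. \<bar>Im (A v v)\<bar> \<le> index_of V A * Re (A v v)"
proof -
  have im: "cmod (form_Im A v v) = \<bar>Im (A v v)\<bar>" for v
    by (simp add: form_Im_def adjoint_form_def complex_diff_cnj norm_mult norm_divide)
  have rf: "Re (form_Re A v v) = Re (A v v)" for v
    by (simp add: form_Re_def adjoint_form_def)
  define S where "S = {\<beta>. 0 \<le> \<beta> \<and> (\<forall>v\<in>V. \<bar>Im (A v v)\<bar> \<le> \<beta> * Re (A v v))}"
  have idx: "index_of V A = (LEAST \<beta>. \<beta> \<in> S)" by (simp add: index_of_def S_def im rf)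
  have "K \<in> S" using K order_trans[OF abs_Im_le_cmod] by (auto simp: S_def)
  have bdd: "bdd_below S" by (rule bdd_belowI[of _ 0]) (simp add: S_def)
  have "Inf S \<in> S"
  proof -
    have "0 \<le> Inf S" using \<open>K \<in> S\<close> by (intro cInf_greatest) (auto simp: S_def)
    moreover have "\<bar>Im (A v v)\<bar> \<le> Inf S * Re (A v v)" if v: "v \<in> V" for v
    proof (cases "Re (A v v) = 0")
      case True
      then show ?thesis using \<open>K \<in> S\<close> v by (auto simp: S_def)
    next
      case False
      then have pos: "0 < Re (A v v)" using re v by (simp add: less_le)
      have "\<bar>Im (A v v)\<bar> / Re (A v v) \<le> Inf S"
        using \<open>K \<in> S\<close> v pos by (intro cInf_greatest) (auto simp: S_def field_simps)
      then show ?thesis using pos by (simp add: field_simps)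
    qed
    ultimately show ?thesis by (simp add: S_def)
  qed
  moreover have "(LEAST \<beta>. \<beta> \<in> S) = Inf S"
    by (rule Least_equality[where P = "\<lambda>\<beta>. \<beta> \<in> S", OF \<open>Inf S \<in> S\<close>]) (rule cInf_lower[OF _ bdd])
  ultimately have "index_of V A \<in> S" using idx by simp
  then show "0 \<le> index_of V A" "\<forall>v\<in>V. \<bar>Im (A v v)\<bar> \<le> index_of V A * Re (A v v)"
    by (auto simp: S_def)
qed

text \<open>Turns the logarithm from the integral of \<open>log_kernel\<close> into the shape it has
  in \<open>C_tau\<close>.\<close>

lemma ln_one_plus_inverse_le:
  fixes \<epsilon> :: real
  assumes "0 < \<epsilon>"
  shows "ln (1 + 1 / \<epsilon>) \<le> 1 + \<bar>ln \<epsilon>\<bar>"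
proof (cases "1 \<le> \<epsilon>")
  case True
  have "ln (1 + 1 / \<epsilon>) \<le> 1 / \<epsilon>" using assms ln_add_one_self_le_self[of "1 / \<epsilon>"] by simp
  also have "\<dots> \<le> 1" using True by simp
  finally show ?thesis by simp
next
  case False
  have "1 + 1 / \<epsilon> = (1 + \<epsilon>) / \<epsilon>" using assms by (simp add: field_simps)
  then have "ln (1 + 1 / \<epsilon>) = ln (1 + \<epsilon>) - ln \<epsilon>" using assms by (simp add: ln_div)
  also have "\<dots> \<le> \<epsilon> + \<bar>ln \<epsilon>\<bar>" using assms ln_add_one_self_le_self[of \<epsilon>] by linarith
  finally show ?thesis using False by simp
qed

text \<open>Away from 0, subtracting 1 from the exponential costs only a constant factor.\<close>

lemma inverse_exp_minus_one_le:
  fixes X0 X :: real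
  assumes "0 < X0" "X0 \<le> X"
  shows "1 / (exp X - 1) \<le> exp (- X) / (1 - exp (- X0))"
proof -
  have q: "0 < 1 - exp (- X0)" using assms by simp
  have "exp X * (1 - exp (- X0)) \<le> exp X * (1 - exp (- X))" using assms by (intro mult_left_mono) auto
  also have "\<dots> = exp X - 1" by (simp add: algebra_simps exp_minus)
  finally have "1 / (exp X - 1) \<le> 1 / (exp X * (1 - exp (- X0)))" using q by (intro frac_le mult_pos_pos) auto
  then show ?thesis by (simp add: exp_minus field_simps)
qed

lemma sin_min_half_pi:
  assumes "0 < x"
  shows "0 < sin (min x (pi / 2))" "1 \<le> 1 / sin (min x (pi / 2))"
proof -
  have "0 < min x (pi / 2)" "min x (pi / 2) < pi" using assms by (auto simp: min_less_iff_disj)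
  then show pos: "0 < sin (min x (pi / 2))" by (rule sin_gt_zero)
  then show "1 \<le> 1 / sin (min x (pi / 2))" by simp
qed

text \<open>
  For small \<open>\<tau>\<close> the height \<open>d\<close> of the strip stays at distance of order \<open>\<tau>\<close> below the nearest
  singularity; for the remaining \<open>\<tau>\<close> a fixed \<open>d\<close> gives a bound by a constant, which suffices.
\<close>

lemma strip_height_choice:
  assumes \<alpha>: "0 < \<alpha>" "\<alpha> < 1"
  obtains C where "0 \<le> C" "\<And>\<beta> \<tau>. 0 \<le> \<beta> \<Longrightarrow> 0 < \<tau> \<Longrightarrow> \<tau> < pi - arctan \<beta> \<Longrightarrow>
    \<exists>d>0. d < \<alpha> * (pi - arctan \<beta>) \<and> d < (1 - \<alpha>) * pi \<and>
      ln (1 + 1 / ((1 - \<alpha>) * pi - d)) / sin (min ((\<alpha> * (pi - arctan \<beta>) - d) / \<alpha>) (pi / 2)) / (exp (2 * pi * d / \<tau>) - 1)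
      \<le> C * C_tau \<alpha> (\<alpha> * (pi - arctan \<beta>)) ((1 - \<alpha>) * pi) \<tau> * exp (- 2 * pi * min (\<alpha> * (pi - arctan \<beta>)) ((1 - \<alpha>) * pi) / \<tau>)"
proof -
  define m0 where "m0 = min \<alpha> (1 - \<alpha>)"
  \<comment> \<open>For \<open>\<tau> \<le> 1\<close> the exponent
    \<open>2 * pi * d / \<tau>\<close> will be at least \<open>m0\<close>.\<close>
  define q where "q = 1 - exp (- m0)"
  \<comment> \<open>A height that fits below both singularities for every \<beta>, since
    \<open>\<kappa>1 > \<alpha> * pi / 2\<close>.\<close>
  define d0 where "d0 = m0 * pi / 4"
  define L where "L = 1 + \<bar>ln (1 - \<alpha>)\<bar>"
  define C1 where "C1 = ln (1 + 1 / ((1 - \<alpha>) * pi / 2)) * 2 / (2 * d0)"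
  \<comment> \<open>The first summand serves \<open>\<tau> \<le> 1\<close>, the second
    \<open>\<tau> > 1\<close>.\<close>
  define C where "C = L * exp (2 * pi) / q + C1 * exp (2 * pi * pi)"
  have m0: "0 < m0" "m0 \<le> \<alpha>" "m0 \<le> 1 - \<alpha>" using \<alpha> by (auto simp: m0_def)
  have q: "0 < q" using m0 by (simp add: q_def)
  have d0: "0 < d0" using m0 by (simp add: d0_def)
  have L: "1 \<le> L" by (simp add: L_def)
  have C1: "0 \<le> C1" unfolding C1_def using d0 \<alpha> by (intro divide_nonneg_pos mult_nonneg_nonneg ln_ge_zero) auto
  have C: "0 \<le> C" "L * exp (2 * pi) / q \<le> C" "C1 * exp (2 * pi * pi) \<le> C"
    unfolding C_def using L q C1 by auto
  have "\<exists>d>0. d < \<alpha> * (pi - arctan \<beta>) \<and> d < (1 - \<alpha>) * pi \<and>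
      ln (1 + 1 / ((1 - \<alpha>) * pi - d)) / sin (min ((\<alpha> * (pi - arctan \<beta>) - d) / \<alpha>) (pi / 2)) / (exp (2 * pi * d / \<tau>) - 1)
      \<le> C * C_tau \<alpha> (\<alpha> * (pi - arctan \<beta>)) ((1 - \<alpha>) * pi) \<tau> * exp (- 2 * pi * min (\<alpha> * (pi - arctan \<beta>)) ((1 - \<alpha>) * pi) / \<tau>)"
    if \<beta>: "0 \<le> \<beta>" and \<tau>: "0 < \<tau>" "\<tau> < pi - arctan \<beta>" for \<beta> \<tau>
  proof -
    define A where "A = pi - arctan \<beta>"
    have A: "pi / 2 < A" "A \<le> pi" using \<beta> arctan_ubound[of \<beta>] by (auto simp: A_def)
    define \<kappa>1 where "\<kappa>1 = \<alpha> * A"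
    define \<kappa>2 where "\<kappa>2 = (1 - \<alpha>) * pi"
    have \<kappa>: "0 < \<kappa>1" "0 < \<kappa>2" using \<alpha> A pi_gt_zero by (auto simp: \<kappa>1_def \<kappa>2_def intro!: mult_pos_pos)
    have \<tau>A: "\<tau> < A" using \<tau> by (simp add: A_def)
    define Ct where "Ct = C_tau \<alpha> \<kappa>1 \<kappa>2 \<tau>"
    define E where "E = exp (- 2 * pi * min \<kappa>1 \<kappa>2 / \<tau>)"
    define R where "R d = ln (1 + 1 / (\<kappa>2 - d)) / sin (min ((\<kappa>1 - d) / \<alpha>) (pi / 2)) / (exp (2 * pi * d / \<tau>) - 1)" for d
    \<comment> \<open>Hence a bound by a constant can be multiplied by \<open>Ct\<close> without
      loss.\<close>
    have Ct1: "1 \<le> Ct"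
    proof (cases "\<kappa>1 > \<kappa>2")
      case True
      have "0 < (\<kappa>1 - \<kappa>2) / \<alpha> + (1 - \<alpha>) / \<alpha> * \<tau>" using True \<alpha> \<tau> by (intro add_pos_pos divide_pos_pos mult_pos_pos) auto
      from mult_mono[OF sin_min_half_pi(2)[OF this], of 1 "1 + \<bar>ln \<tau>\<bar>"] show ?thesis
        using True sin_min_half_pi(1)[OF \<open>0 < (\<kappa>1 - \<kappa>2) / \<alpha> + (1 - \<alpha>) / \<alpha> * \<tau>\<close>] by (simp add: Ct_def C_tau_def)
    next
      case False
      from mult_mono[OF sin_min_half_pi(2)[OF \<tau>(1)], of 1 "1 + \<bar>ln (\<kappa>2 - \<kappa>1 + \<alpha> * \<tau>)\<bar>"] show ?thesis
        using False sin_min_half_pi(1)[OF \<tau>(1)] by (simp add: Ct_def C_tau_def)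
    qed
    have "\<exists>d>0. d < \<kappa>1 \<and> d < \<kappa>2 \<and> R d \<le> C * Ct * E"
    proof (cases "\<tau> \<le> 1")
      case False
      have k: "d0 \<le> \<alpha> * pi / 4" "d0 \<le> (1 - \<alpha>) * pi / 4" using m0 by (simp_all add: d0_def)
      have "\<alpha> * (pi / 2) < \<kappa>1" unfolding \<kappa>1_def using A \<alpha> by (intro mult_strict_left_mono) auto
      then have dk: "d0 < \<kappa>1" "d0 < \<kappa>2" using k d0 \<kappa> by (auto simp: \<kappa>2_def)
      have "(1 - \<alpha>) * pi / 2 \<le> \<kappa>2 - d0" using k(2) \<kappa>(2) unfolding \<kappa>2_def by linarith
      then have ln: "ln (1 + 1 / (\<kappa>2 - d0)) \<le> ln (1 + 1 / ((1 - \<alpha>) * pi / 2))"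
        using \<alpha> dk by (intro ln_mono add_left_mono divide_left_mono mult_pos_pos) (auto intro!: add_pos_pos)
      have s: "1 / 2 \<le> sin (min ((\<kappa>1 - d0) / \<alpha>) (pi / 2))"
      proof -
        have "\<alpha> * (pi / 6) \<le> \<kappa>1 - d0" using k(1) \<open>\<alpha> * (pi / 2) < \<kappa>1\<close> mult_pos_pos[OF \<alpha>(1) pi_gt_zero] by linarith
        then have "pi / 6 \<le> (\<kappa>1 - d0) / \<alpha>" using \<alpha> by (simp add: field_simps)
        then have "sin (pi / 6) \<le> sin (min ((\<kappa>1 - d0) / \<alpha>) (pi / 2))"
          by (intro sin_monotone_2pi_le) (auto simp: min_def)
        then show ?thesis by (simp add: sin_30)
      qed
      have e: "2 * d0 \<le> exp (2 * pi * d0 / \<tau>) - 1"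
      proof -
        \<comment> \<open>From \<open>\<tau> < A \<le> pi\<close>.\<close>
        have "2 * d0 \<le> 2 * pi * d0 / \<tau>" using d0 \<tau> \<tau>A A by (simp add: field_simps)
        then show ?thesis using exp_ge_add_one_self[of "2 * pi * d0 / \<tau>"] by linarith
      qed
      have "R d0 \<le> ln (1 + 1 / ((1 - \<alpha>) * pi / 2)) / (1 / 2) / (2 * d0)"
        unfolding R_def using ln s e d0 dk \<alpha> by (intro frac_le) (auto intro!: divide_nonneg_pos ln_ge_zero)
      also have "\<dots> = C1" by (simp add: C1_def)
      \<comment> \<open>For \<open>\<tau> > 1\<close> the factor \<open>E\<close> is at least
        \<open>exp (- 2 * pi * pi)\<close>, so the constant can absorb its inverse.\<close>
      also have "\<dots> = C1 * exp (2 * pi * pi) * 1 * exp (- 2 * pi * pi)" by (simp add: exp_minus)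
      also have "\<dots> \<le> C * Ct * E"
      proof (intro mult_mono C Ct1)
        have "min \<kappa>1 \<kappa>2 \<le> \<kappa>2" by simp
        also have "\<kappa>2 \<le> pi" using \<alpha> by (simp add: \<kappa>2_def)
        finally have "2 * pi * min \<kappa>1 \<kappa>2 / \<tau> \<le> 2 * pi * pi / 1"
          using False \<tau> \<kappa> by (intro frac_le mult_left_mono) auto
        then show "exp (- 2 * pi * pi) \<le> E" by (simp add: E_def)
      qed (use C C1 Ct1 in auto)
      finally show ?thesis using d0 dk by blast
    next
      case True
      \<comment> \<open>Isolates what a choice of \<open>d\<close> has to provide: an exponent at
        least \<open>m0\<close>, a loss of at most \<open>exp (2 * pi)\<close> when
        \<open>min \<kappa>1 \<kappa>2\<close> is lowered to \<open>d\<close>, and logarithm over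
        sine matching \<open>C_tau\<close> up to \<open>L\<close>.\<close>
      have main: "R d \<le> C * Ct * E"
        if d: "d < \<kappa>2" and X: "m0 \<le> 2 * pi * d / \<tau>" "exp (- (2 * pi * d / \<tau>)) \<le> exp (2 * pi) * E"
          and s: "0 < sin (min ((\<kappa>1 - d) / \<alpha>) (pi / 2))"
          and Ct: "ln (1 + 1 / (\<kappa>2 - d)) / sin (min ((\<kappa>1 - d) / \<alpha>) (pi / 2)) \<le> L * Ct" for d
      proof -
        have "R d = (ln (1 + 1 / (\<kappa>2 - d)) / sin (min ((\<kappa>1 - d) / \<alpha>) (pi / 2))) * (1 / (exp (2 * pi * d / \<tau>) - 1))"
          by (simp add: R_def)
        also have "\<dots> \<le> (L * Ct) * (exp (- (2 * pi * d / \<tau>)) / q)"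
          unfolding q_def using Ct L Ct1 s d X(1) m0(1)
          by (intro mult_mono inverse_exp_minus_one_le) auto
        also have "\<dots> \<le> (L * Ct) * (exp (2 * pi) * E / q)"
          using X(2) q L Ct1 by (intro mult_left_mono divide_right_mono) auto
        also have "\<dots> = (L * exp (2 * pi) / q) * Ct * E" by simp
        also have "\<dots> \<le> C * Ct * E" using C Ct1 by (intro mult_right_mono) (auto simp: E_def)
        finally show ?thesis .
      qed
      show ?thesis
      proof (cases "\<kappa>1 > \<kappa>2")
        case case1: True
        \<comment> \<open>The distance \<open>(1 - \<alpha>) * \<tau>\<close> keeps \<open>d\<close>
          positive for every \<open>\<tau> < pi\<close> and turns the argument of the sine into the
          one in \<open>C_tau\<close>.\<close>
        define d where "d = \<kappa>2 - (1 - \<alpha>) * \<tau>"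
        have d: "d = (1 - \<alpha>) * (pi - \<tau>)" by (simp add: d_def \<kappa>2_def algebra_simps)
        have dpos: "0 < d" "d < \<kappa>2"
        proof -
          show "0 < d" unfolding d using \<alpha> \<tau>A A by simp
          show "d < \<kappa>2" unfolding d_def using \<alpha> \<tau> by simp
        qed
        have Xeq: "2 * pi * d / \<tau> = 2 * pi * min \<kappa>1 \<kappa>2 / \<tau> - 2 * pi * (1 - \<alpha>)"
          using case1 \<tau> by (simp add: d_def field_simps)
        have "R d \<le> C * Ct * E"
        proof (rule main[OF dpos(2)])
          have "m0 * 1 \<le> (1 - \<alpha>) * (2 * pi * (pi - \<tau>) / \<tau>)"
          proof (intro mult_mono m0)
            have "1 * \<tau> \<le> 2 * pi * (pi - \<tau>)" using True \<tau> pi_gt3 by (intro mult_mono) auto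
            then show "1 \<le> 2 * pi * (pi - \<tau>) / \<tau>" using \<tau> by (simp add: field_simps)
          qed (use \<alpha> in auto)
          then show "m0 \<le> 2 * pi * d / \<tau>" unfolding d by (simp add: mult_ac)
          have "- (2 * pi * d / \<tau>) = 2 * pi * (1 - \<alpha>) + (- 2 * pi * min \<kappa>1 \<kappa>2 / \<tau>)" unfolding Xeq by simp
          then have "exp (- (2 * pi * d / \<tau>)) = exp (2 * pi * (1 - \<alpha>)) * E" by (simp only: exp_add E_def)
          also have "\<dots> \<le> exp (2 * pi) * E" using \<alpha> by (intro mult_right_mono) (auto simp: E_def)
          finally show "exp (- (2 * pi * d / \<tau>)) \<le> exp (2 * pi) * E" .
          have arg: "(\<kappa>1 - d) / \<alpha> = (\<kappa>1 - \<kappa>2) / \<alpha> + (1 - \<alpha>) / \<alpha> * \<tau>"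
            using \<alpha> by (simp add: d_def field_simps)
          have argpos: "0 < (\<kappa>1 - d) / \<alpha>" using dpos case1 \<alpha> by simp
          show s: "0 < sin (min ((\<kappa>1 - d) / \<alpha>) (pi / 2))" by (rule sin_min_half_pi(1)[OF argpos])
          have "ln (1 + 1 / (\<kappa>2 - d)) \<le> 1 + \<bar>ln ((1 - \<alpha>) * \<tau>)\<bar>"
            unfolding d_def using \<alpha> \<tau> ln_one_plus_inverse_le[of "(1 - \<alpha>) * \<tau>"] by simp
          \<comment> \<open>The summand depending on \<alpha> alone goes into
            \<open>L\<close>.\<close>
          also have "ln ((1 - \<alpha>) * \<tau>) = ln (1 - \<alpha>) + ln \<tau>" using \<alpha> \<tau> ln_mult_pos[of "1 - \<alpha>" \<tau>] by simp
          also have "1 + \<bar>ln (1 - \<alpha>) + ln \<tau>\<bar> \<le> L * (1 + \<bar>ln \<tau>\<bar>)"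
            using abs_triangle_ineq[of "ln (1 - \<alpha>)" "ln \<tau>"]
            by (simp add: L_def algebra_simps) (erule order_trans, simp)
          finally have "ln (1 + 1 / (\<kappa>2 - d)) / sin (min ((\<kappa>1 - d) / \<alpha>) (pi / 2)) \<le> L * (1 + \<bar>ln \<tau>\<bar>) / sin (min ((\<kappa>1 - d) / \<alpha>) (pi / 2))"
            using s by (intro divide_right_mono) auto
          also have "\<dots> = L * Ct" using case1 by (simp add: Ct_def C_tau_def arg)
          finally show "ln (1 + 1 / (\<kappa>2 - d)) / sin (min ((\<kappa>1 - d) / \<alpha>) (pi / 2)) \<le> L * Ct" .
        qed
        then show ?thesis using dpos case1 by (intro exI[of _ d]) auto
      next
        case case2: False
        \<comment> \<open>The distance \<open>\<alpha> * \<tau>\<close> makes the argument of the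
          sine exactly \<tau> and leaves \<open>\<kappa>2 - \<kappa>1 + \<alpha> * \<tau>\<close> in
          the logarithm.\<close>
        define d where "d = \<kappa>1 - \<alpha> * \<tau>"
        have d: "d = \<alpha> * (A - \<tau>)" by (simp add: d_def \<kappa>1_def algebra_simps)
        have dpos: "0 < d" "d < \<kappa>1"
        proof -
          show "0 < d" unfolding d using \<alpha> \<tau>A by simp
          show "d < \<kappa>1" unfolding d_def using \<alpha> \<tau> by simp
        qed
        then have dk2: "d < \<kappa>2" using case2 by simp
        have Xeq: "2 * pi * d / \<tau> = 2 * pi * min \<kappa>1 \<kappa>2 / \<tau> - 2 * pi * \<alpha>"
          using case2 \<tau> by (simp add: d_def field_simps min_def)
        have "R d \<le> C * Ct * E"
        proof (rule main[OF dk2])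
          have "m0 * 1 \<le> \<alpha> * (2 * pi * (A - \<tau>) / \<tau>)"
          proof (intro mult_mono m0)
            \<comment> \<open>Since \<open>A > pi / 2 > 3 / 2\<close>.\<close>
            have "1 / 2 \<le> A - \<tau>" using True A pi_gt3 by simp
            then have "2 * pi * (1 / 2) \<le> 2 * pi * (A - \<tau>)" by (intro mult_left_mono) auto
            then have "\<tau> \<le> 2 * pi * (A - \<tau>)" using True pi_gt3 by linarith
            then show "1 \<le> 2 * pi * (A - \<tau>) / \<tau>" using \<tau> by (simp add: field_simps)
          qed (use \<alpha> in auto)
          then show "m0 \<le> 2 * pi * d / \<tau>" unfolding d by (simp add: mult_ac)
          have "- (2 * pi * d / \<tau>) = 2 * pi * \<alpha> + (- 2 * pi * min \<kappa>1 \<kappa>2 / \<tau>)" unfolding Xeq by simp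
          then have "exp (- (2 * pi * d / \<tau>)) = exp (2 * pi * \<alpha>) * E" by (simp only: exp_add E_def)
          also have "\<dots> \<le> exp (2 * pi) * E" using \<alpha> by (intro mult_right_mono) (auto simp: E_def)
          finally show "exp (- (2 * pi * d / \<tau>)) \<le> exp (2 * pi) * E" .
          have arg: "(\<kappa>1 - d) / \<alpha> = \<tau>" using \<alpha> by (simp add: d_def)
          show s: "0 < sin (min ((\<kappa>1 - d) / \<alpha>) (pi / 2))" unfolding arg by (rule sin_min_half_pi(1)[OF \<tau>(1)])
          have eps: "\<kappa>2 - d = \<kappa>2 - \<kappa>1 + \<alpha> * \<tau>" by (simp add: d_def)
          have "0 < \<kappa>2 - \<kappa>1 + \<alpha> * \<tau>" using dk2 eps by linarith
          from ln_one_plus_inverse_le[OF this] have "ln (1 + 1 / (\<kappa>2 - d)) \<le> 1 * (1 + \<bar>ln (\<kappa>2 - \<kappa>1 + \<alpha> * \<tau>)\<bar>)"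
            unfolding eps by simp
          also have "\<dots> \<le> L * (1 + \<bar>ln (\<kappa>2 - \<kappa>1 + \<alpha> * \<tau>)\<bar>)" using L by (intro mult_right_mono) auto
          finally have "ln (1 + 1 / (\<kappa>2 - d)) / sin (min ((\<kappa>1 - d) / \<alpha>) (pi / 2)) \<le> L * (1 + \<bar>ln (\<kappa>2 - \<kappa>1 + \<alpha> * \<tau>)\<bar>) / sin (min ((\<kappa>1 - d) / \<alpha>) (pi / 2))"
            using s by (intro divide_right_mono) auto
          also have "\<dots> = L * Ct" using case2 by (simp add: Ct_def C_tau_def arg)
          finally show "ln (1 + 1 / (\<kappa>2 - d)) / sin (min ((\<kappa>1 - d) / \<alpha>) (pi / 2)) \<le> L * Ct" .
        qed
        then show ?thesis using dpos dk2 by (intro exI[of _ d]) auto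
      qed
    qed
    then show ?thesis unfolding R_def Ct_def E_def \<kappa>1_def \<kappa>2_def A_def .
  qed
  then show ?thesis using that C(1) by blast
qed

section \<open>Application to the finite element operator\<close>

lemma L2_norm_le_H1_norm: "(L2_norm d \<Omega> v)\<^sup>2 \<le> (H1_norm d \<Omega> v)\<^sup>2"
proof -
  have "0 \<le> (\<Sum>i<d. (L2_norm d \<Omega> (weak_grad d \<Omega> v i))\<^sup>2)" by (intro sum_nonneg) auto
  then show ?thesis by (simp add: H1_norm_def)
qed

theorem theorem4p2:
  fixes \<alpha> :: real
  assumes "0 < \<alpha>" and "\<alpha> < 1"
  shows "\<exists>C\<^sub>\<alpha>::real. \<forall>(d::nat) \<Omega> \<Gamma>\<^sub>D \<Gamma>\<^sub>N C a r A c\<^sub>0 c\<^sub>1 \<rho> h \<T> b f \<tau>.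
    1 \<le> d \<and> polygonal_lipschitz_domain d \<Omega> \<and> boundary_partition d \<Omega> \<Gamma>\<^sub>D \<Gamma>\<^sub>N \<and>
    sesquilinear_on (V_space d \<Omega> \<Gamma>\<^sub>D) A \<and>
    (\<forall>w\<in>V_space d \<Omega> \<Gamma>\<^sub>D. \<forall>v\<in>V_space d \<Omega> \<Gamma>\<^sub>D.
      has_bochner_integral (leb_on d \<Omega>) (form_integrand d \<Omega> C a r w v) (A w v)) \<and>
    0 < c\<^sub>0 \<and> (\<forall>v\<in>V_space d \<Omega> \<Gamma>\<^sub>D. Re (A v v) \<ge> c\<^sub>0 * (H1_norm d \<Omega> v)\<^sup>2) \<and>
    0 < c\<^sub>1 \<and> (\<forall>w\<in>V_space d \<Omega> \<Gamma>\<^sub>D. \<forall>v\<in>V_space d \<Omega> \<Gamma>\<^sub>D.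
      cmod (A w v) \<le> c\<^sub>1 * H1_norm d \<Omega> w * H1_norm d \<Omega> v) \<and>
    fe_mesh d \<Omega> \<Gamma>\<^sub>D \<Gamma>\<^sub>N \<rho> h \<T> \<and>
    1 \<le> b \<and> f \<in> L2 d \<Omega> \<and> 0 < \<tau> \<longrightarrow>
    (let \<beta> = index_of (V_space d \<Omega> \<Gamma>\<^sub>D) A;
         V\<^sub>h = Vh_space d \<Omega> \<Gamma>\<^sub>D \<T>;
         A\<^sub>h = discrete_operator d \<Omega> V\<^sub>h A;
         f\<^sub>h = L2_projection d \<Omega> V\<^sub>h f;
         \<kappa>\<^sub>1 = \<alpha> * (pi - arctan \<beta>);
         \<kappa>\<^sub>2 = (1 - \<alpha>) * pi;
         u\<^sub>h = u_exact V\<^sub>h A\<^sub>h \<alpha> b f\<^sub>h;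
         u\<^sub>h\<^sub>\<tau> = u_sinc V\<^sub>h A\<^sub>h \<alpha> b \<tau> f\<^sub>h
     in \<tau> < pi - arctan \<beta> \<longrightarrow>
        L2_norm d \<Omega> (\<lambda>x. u\<^sub>h x - u\<^sub>h\<^sub>\<tau> x)
          \<le> C\<^sub>\<alpha> / b * C_tau \<alpha> \<kappa>\<^sub>1 \<kappa>\<^sub>2 \<tau> * exp (- 2 * pi * min \<kappa>\<^sub>1 \<kappa>\<^sub>2 / \<tau>) * L2_norm d \<Omega> f\<^sub>h)"
proof -
  obtain C\<^sub>0 where C\<^sub>0: "0 \<le> C\<^sub>0" "\<And>\<beta> \<tau>. 0 \<le> \<beta> \<Longrightarrow> 0 < \<tau> \<Longrightarrow> \<tau> < pi - arctan \<beta> \<Longrightarrow>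
    \<exists>d>0. d < \<alpha> * (pi - arctan \<beta>) \<and> d < (1 - \<alpha>) * pi \<and>
      ln (1 + 1 / ((1 - \<alpha>) * pi - d)) / sin (min ((\<alpha> * (pi - arctan \<beta>) - d) / \<alpha>) (pi / 2)) / (exp (2 * pi * d / \<tau>) - 1)
      \<le> C\<^sub>0 * C_tau \<alpha> (\<alpha> * (pi - arctan \<beta>)) ((1 - \<alpha>) * pi) \<tau> * exp (- 2 * pi * min (\<alpha> * (pi - arctan \<beta>)) ((1 - \<alpha>) * pi) / \<tau>)"
    using strip_height_choice[OF assms] by blast
  \<comment> \<open>The constant is 320 = 2 * 80 * 2, from the two edges of the strip, the weight
    bound and the integral of \<open>log_kernel\<close>.\<close>
  define P where "P = sin (pi * \<alpha>) / (\<alpha> * pi) * (320 / min \<alpha> (1 - \<alpha>))"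
  have P: "0 \<le> P"
    unfolding P_def using assms by (intro mult_nonneg_nonneg divide_nonneg_nonneg sin_ge_zero) auto
  \<comment> \<open>The let-bound quantities become variables with defining equations, so that the
    locales can be interpreted for arbitrary data.\<close>
  have main: "L2_norm d \<Omega> (\<lambda>x. u_exact V\<^sub>h A\<^sub>h \<alpha> b f\<^sub>h x - u_sinc V\<^sub>h A\<^sub>h \<alpha> b \<tau> f\<^sub>h x)
          \<le> P * C\<^sub>0 / b * C_tau \<alpha> \<kappa>\<^sub>1 \<kappa>\<^sub>2 \<tau> * exp (- 2 * pi * min \<kappa>\<^sub>1 \<kappa>\<^sub>2 / \<tau>) * L2_norm d \<Omega> f\<^sub>h"
    if dom: "polygonal_lipschitz_domain d \<Omega>" and sesq: "sesquilinear_on (V_space d \<Omega> \<Gamma>\<^sub>D) A"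
      and c\<^sub>0: "0 < c\<^sub>0" "\<forall>v\<in>V_space d \<Omega> \<Gamma>\<^sub>D. Re (A v v) \<ge> c\<^sub>0 * (H1_norm d \<Omega> v)\<^sup>2"
      and c\<^sub>1: "0 < c\<^sub>1" "\<forall>w\<in>V_space d \<Omega> \<Gamma>\<^sub>D. \<forall>v\<in>V_space d \<Omega> \<Gamma>\<^sub>D. cmod (A w v) \<le> c\<^sub>1 * H1_norm d \<Omega> w * H1_norm d \<Omega> v"
      and mesh: "fe_mesh d \<Omega> \<Gamma>\<^sub>D \<Gamma>\<^sub>N \<rho> h \<T>" and b: "1 \<le> b" and f: "f \<in> L2 d \<Omega>" and \<tau>: "0 < \<tau>" "\<tau> < pi - arctan \<beta>"
      and \<beta>_eq: "\<beta> = index_of (V_space d \<Omega> \<Gamma>\<^sub>D) A" and V\<^sub>h_eq: "V\<^sub>h = Vh_space d \<Omega> \<Gamma>\<^sub>D \<T>"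
      and A\<^sub>h_eq: "A\<^sub>h = discrete_operator d \<Omega> V\<^sub>h A" and f\<^sub>h_eq: "f\<^sub>h = L2_projection d \<Omega> V\<^sub>h f"
      and \<kappa>: "\<kappa>\<^sub>1 = \<alpha> * (pi - arctan \<beta>)" "\<kappa>\<^sub>2 = (1 - \<alpha>) * pi"
    for d :: nat and \<Omega> \<Gamma>\<^sub>D \<Gamma>\<^sub>N A c\<^sub>0 c\<^sub>1 \<rho> h \<T> b f \<tau> \<beta> V\<^sub>h A\<^sub>h f\<^sub>h \<kappa>\<^sub>1 \<kappa>\<^sub>2
  proof -
    let ?V = "V_space d \<Omega> \<Gamma>\<^sub>D" and ?ip = "L2_inner d \<Omega>"
    interpret bounded_domain d \<Omega>
      using dom by unfold_locales (auto simp: polygonal_lipschitz_domain_def)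
    interpret V: function_subspace ?V by (rule V_space_function_subspace)
    have "finite \<T>" "\<Union>\<T> = closure \<Omega>" using mesh by (auto simp: fe_mesh_def)
    then obtain e where e: "\<forall>v\<in>V\<^sub>h. \<exists>c. v = (\<lambda>x. \<Sum>i\<in>\<T> \<times> {..d}. c i * e i x)"
      unfolding V\<^sub>h_eq by (rule Vh_space_spanned[where \<Gamma>\<^sub>D = \<Gamma>\<^sub>D])
    interpret H0: finite_dim_inner_product V\<^sub>h ?ip "\<T> \<times> {..d}" e
      using Vh_space_inner_product[of \<Gamma>\<^sub>D \<T>, folded V\<^sub>h_eq] e \<open>finite \<T>\<close>
      by (intro finite_dim_inner_product.intro finite_dim_inner_product_axioms.intro) auto
    have VhV: "v \<in> ?V" if "v \<in> V\<^sub>h" for v using that by (simp add: V\<^sub>h_eq Vh_space_def)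
    have VhL2: "v \<in> L2 d \<Omega>" if "v \<in> V\<^sub>h" for v by (rule V_space_L2[OF VhV[OF that]])
    have A_left: "A (\<lambda>x. p * u x + q * v x) w = p * A u w + q * A v w"
      and A_right: "A w (\<lambda>x. p * u x + q * v x) = cnj p * A w u + cnj q * A w v"
      if "u \<in> ?V" "v \<in> ?V" "w \<in> ?V" for u v w p q
      using that sesq V.scale_mem unfolding sesquilinear_on_def by auto
    have re: "0 \<le> Re (A v v)" if "v \<in> ?V" for v
      using c\<^sub>0 that by (meson mult_nonneg_nonneg less_imp_le zero_le_power2 order_trans)
    have bd: "cmod (A v v) \<le> c\<^sub>1 / c\<^sub>0 * Re (A v v)" if v: "v \<in> ?V" for v
    proof -
      have "cmod (A v v) \<le> c\<^sub>1 / c\<^sub>0 * (c\<^sub>0 * (H1_norm d \<Omega> v)\<^sup>2)" using c\<^sub>1(2) v c\<^sub>0(1) by (simp add: power2_eq_square mult.assoc)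
      also have "\<dots> \<le> c\<^sub>1 / c\<^sub>0 * Re (A v v)" using c\<^sub>0 c\<^sub>1(1) v by (intro mult_left_mono) auto
      finally show ?thesis .
    qed
    have K: "0 \<le> c\<^sub>1 / c\<^sub>0" using c\<^sub>0(1) c\<^sub>1(1) by simp
    \<comment> \<open>The quotient \<open>c\<^sub>1 / c\<^sub>0\<close> is an admissible bound, so
      the index is attained; its size plays no part in the constant.\<close>
    note \<beta> = index_of_bound[of ?V A, OF _ K, folded \<beta>_eq, OF ballI[OF re] ballI[OF bd]]
    have "\<exists>!u. u \<in> V\<^sub>h \<and> (\<forall>v\<in>V\<^sub>h. ?ip u v = A w v)" if "w \<in> V\<^sub>h" for w
      using VhV that by (intro H0.Riesz_representation A_right) auto
    from theI'[OF this] have Ah: "A\<^sub>h w \<in> V\<^sub>h" "\<And>v. v \<in> V\<^sub>h \<Longrightarrow> ?ip (A\<^sub>h w) v = A w v" if "w \<in> V\<^sub>h" for w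
      unfolding A\<^sub>h_eq discrete_operator_def using that by blast+
    have "?ip f (\<lambda>x. p * u x + q * v x) = cnj p * ?ip f u + cnj q * ?ip f v" if "u \<in> V\<^sub>h" "v \<in> V\<^sub>h" for u v p q
      using L2_inner_lincomb[OF VhL2[OF that(1)] VhL2[OF that(2)] f, of p q] L2_inner_cnj[of f] by simp
    then have "\<exists>!u. u \<in> V\<^sub>h \<and> (\<forall>v\<in>V\<^sub>h. ?ip u v = ?ip f v)" by (intro H0.Riesz_representation)
    from theI'[OF this] have fh: "f\<^sub>h \<in> V\<^sub>h" unfolding f\<^sub>h_eq L2_projection_def by blast
    interpret H: accretive_operator V\<^sub>h ?ip "\<T> \<times> {..d}" e A\<^sub>h \<beta> c\<^sub>0
    proof
      show "A\<^sub>h v \<in> V\<^sub>h" if "v \<in> V\<^sub>h" for v by (rule Ah(1)[OF that])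
      show "A\<^sub>h (\<lambda>x. p * u x + q * v x) = (\<lambda>x. p * A\<^sub>h u x + q * A\<^sub>h v x)" if "u \<in> V\<^sub>h" "v \<in> V\<^sub>h" for u v p q
      proof (rule H0.ip_eq_imp_eq)
        have m: "(\<lambda>x. p * u x + q * v x) \<in> V\<^sub>h" by (rule H0.lincomb_mem[OF that])
        show "A\<^sub>h (\<lambda>x. p * u x + q * v x) \<in> V\<^sub>h" by (rule Ah(1)[OF m])
        show "(\<lambda>x. p * A\<^sub>h u x + q * A\<^sub>h v x) \<in> V\<^sub>h" by (intro H0.lincomb_mem Ah(1) that)
        show "?ip (A\<^sub>h (\<lambda>x. p * u x + q * v x)) w = ?ip (\<lambda>x. p * A\<^sub>h u x + q * A\<^sub>h v x) w" if w: "w \<in> V\<^sub>h" for w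
          using Ah \<open>u \<in> V\<^sub>h\<close> \<open>v \<in> V\<^sub>h\<close> w m VhV by (simp add: H0.ip_lincomb A_left)
      qed
      show "c\<^sub>0 * Re (?ip v v) \<le> Re (?ip (A\<^sub>h v) v)" if "v \<in> V\<^sub>h" for v
      proof -
        have "c\<^sub>0 * (L2_norm d \<Omega> v)\<^sup>2 \<le> c\<^sub>0 * (H1_norm d \<Omega> v)\<^sup>2"
          using c\<^sub>0(1) by (intro mult_left_mono L2_norm_le_H1_norm) auto
        also have "\<dots> \<le> Re (A v v)" using c\<^sub>0(2) VhV[OF that] by blast
        finally show ?thesis by (simp add: L2_inner_self Ah(2)[OF that that] del: of_real_power)
      qed
      \<comment> \<open>On \<open>V\<^sub>h\<close> the operator has the same quadratic form as
        \<open>A\<close>, so the index on all of \<open>V\<close> serves every mesh.\<close>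
      show "\<bar>Im (?ip (A\<^sub>h v) v)\<bar> \<le> \<beta> * Re (?ip (A\<^sub>h v) v)" if "v \<in> V\<^sub>h" for v
        using \<beta>(2) VhV[OF that] by (simp add: Ah(2)[OF that that])
    qed (use c\<^sub>0(1) \<beta>(1) in auto)
    have nrm: "H0.nrm u = L2_norm d \<Omega> u" for u
      by (simp add: H0.nrm_def L2_inner_self L2_norm_nonneg del: of_real_power)
    obtain s where s: "0 < s" "s < \<kappa>\<^sub>1" "s < \<kappa>\<^sub>2"
      and est: "ln (1 + 1 / (\<kappa>\<^sub>2 - s)) / sin (min ((\<kappa>\<^sub>1 - s) / \<alpha>) (pi / 2)) / (exp (2 * pi * s / \<tau>) - 1)
        \<le> C\<^sub>0 * C_tau \<alpha> \<kappa>\<^sub>1 \<kappa>\<^sub>2 \<tau> * exp (- 2 * pi * min \<kappa>\<^sub>1 \<kappa>\<^sub>2 / \<tau>)"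
      using C\<^sub>0(2)[OF \<beta>(1) \<tau>] unfolding \<kappa> by blast
    let ?Q = "ln (1 + 1 / (\<kappa>\<^sub>2 - s)) / sin (min ((\<kappa>\<^sub>1 - s) / \<alpha>) (pi / 2)) / (exp (2 * pi * s / \<tau>) - 1)"
    have b0: "0 < b" using b by simp
    have "L2_norm d \<Omega> (\<lambda>x. u_exact V\<^sub>h A\<^sub>h \<alpha> b f\<^sub>h x - u_sinc V\<^sub>h A\<^sub>h \<alpha> b \<tau> f\<^sub>h x) \<le>
        sin (pi * \<alpha>) / (\<alpha> * pi) * (2 * (80 / (min \<alpha> (1 - \<alpha>) * b) * (2 * ln (1 + 1 / (\<kappa>\<^sub>2 - s))) *
          (L2_norm d \<Omega> f\<^sub>h / sin (min ((\<kappa>\<^sub>1 - s) / \<alpha>) (pi / 2)))) / (exp (2 * pi * s / \<tau>) - 1))"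
      using H.sinc_approximation_error[OF assms b0 \<tau>(1) fh s(1) s(2)[unfolded \<kappa>] s(3)[unfolded \<kappa>]]
      unfolding nrm \<kappa>[symmetric] .
    also have "\<dots> = P / b * ?Q * L2_norm d \<Omega> f\<^sub>h"
      by (simp add: P_def)
    also have "\<dots> \<le> P / b * (C\<^sub>0 * C_tau \<alpha> \<kappa>\<^sub>1 \<kappa>\<^sub>2 \<tau> * exp (- 2 * pi * min \<kappa>\<^sub>1 \<kappa>\<^sub>2 / \<tau>)) * L2_norm d \<Omega> f\<^sub>h"
      using est P b0 L2_norm_nonneg by (intro mult_right_mono mult_left_mono) auto
    finally show ?thesis by simp
  qed
  show ?thesis
    unfolding Let_def by (intro exI[of _ "P * C\<^sub>0"] allI impI, elim conjE) (rule main, (assumption | rule refl)+)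
qed

end
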